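(* For every $\varepsilon>0$ there exist a constant $\delta=\delta(\varepsilon)>0$ and instances $(G,D)$ of Non-Uniform Sparsest Cut, on $n$ vertices with supply graph $G$ of treewidth $2$ (series-parallel graphs), for which the integrality gap of the $r$-round Sherali-Adams relaxation of Sparsest Cut is at least $2-\varepsilon$, even when $r=n^{\delta}$.
   Context: Non-Uniform Sparsest Cut: supply graph $G=(V,E_G)$ with positive capacities $\mathrm{cap}_e$, demand graph $D=(V,E_D)$ with demands $\mathrm{dem}_e$; the sparsity of $S\subseteq V$ is $\sum_{e\in\partial_G(S)}\mathrm{cap}_e/\sum_{e\in\partial_D(S)}\mathrm{dem}_e$, where $\partial(S)$ is the set of edges with exactly one endpoint in $S$, and $\Phi_{G,D}$ is the minimum sparsity. For $|V|=n$, the $r$-round Sherali-Adams polytope $\mathbf{SA}_r(n)$ is the set of vectors $(y_{uv})_{u,v\in V}$ for which there exist reals $x(S,T)$, for $S\subseteq V$ with $|S|\le r$ and $T\subseteq S$, satisfying: $y_{uv}=x(\{u,v\},\{u\})+x(\{u,v\},\{v\})$ for all $u,v$; $\sum_{T\subseteq S}x(S,T)=1$ for all $|S|\le r$; $x(S,T)=x(S\cup\{u\},T)+x(S\cup\{u\},T\cup\{u\})$ for all $|S|\le r-1$, $T\subseteq S$, $u\notin S$; and $x(S,T)\ge 0$. The $r$-round Sherali-Adams relaxation of Sparsest Cut has value $\min\{\sum_{(u,v)\in E_G}\mathrm{cap}_{uv}y_{uv}/\sum_{(u,v)\in E_D}\mathrm{dem}_{uv}y_{uv} : y\in\mathbf{SA}_r(n)\}$,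 and its integrality gap on $(G,D)$ is $\Phi_{G,D}$ divided by this value. *)

theory Defs
  imports Complex_Main
begin

section \<open>Simple graphs and treewidth\<close>

definition simple_graph :: "'a set \<Rightarrow> 'a set set \<Rightarrow> bool" where
  "simple_graph V E \<longleftrightarrow> finite V \<and> (\<forall>e\<in>E. e \<subseteq> V \<and> card e = 2)"

definition connected_graph :: "'a set \<Rightarrow> 'a set set \<Rightarrow> bool" where
  "connected_graph V E \<longleftrightarrow> V \<noteq> {} \<and> (\<forall>u\<in>V. \<forall>v\<in>V. (u, v) \<in> {(a, b). {a, b} \<in> E}\<^sup>*)"

definition is_cycle :: "'a set set \<Rightarrow> 'a list \<Rightarrow> bool" where
  "is_cycle E c \<longleftrightarrow> 3 \<le> length c \<and> distinct c \<and>
     (\<forall>i<length c. {c ! i, c ! (Suc i mod length c)} \<in> E)"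

definition is_tree :: "'a set \<Rightarrow> 'a set set \<Rightarrow> bool" where
  "is_tree V E \<longleftrightarrow> simple_graph V E \<and> connected_graph V E \<and> (\<nexists>c. is_cycle E c)"

definition induced_edges :: "'a set set \<Rightarrow> 'a set \<Rightarrow> 'a set set" where
  "induced_edges E W = {e \<in> E. e \<subseteq> W}"

definition tree_decomposition ::
  "'a set \<Rightarrow> 'a set set \<Rightarrow> 'i set \<Rightarrow> 'i set set \<Rightarrow> ('i \<Rightarrow> 'a set) \<Rightarrow> bool" where
  "tree_decomposition V E I F B \<longleftrightarrow>
     is_tree I F \<and>
     (\<Union>i\<in>I. B i) = V \<and>
     (\<forall>e\<in>E. \<exists>i\<in>I. e \<subseteq> B i) \<and>
     (\<forall>v\<in>V. connected_graph {i \<in> I. v \<in> B i} (induced_edges F {i \<in> I. v \<in> B i}))"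

definition decomposition_width :: "'i set \<Rightarrow> ('i \<Rightarrow> 'a set) \<Rightarrow> nat" where
  "decomposition_width I B = Max ((\<lambda>i. card (B i)) ` I) - 1"

text \<open>Decomposition trees are finite, so their nodes can be taken to be natural numbers.\<close>

definition treewidth :: "'a set \<Rightarrow> 'a set set \<Rightarrow> nat" where
  "treewidth V E = (LEAST k. \<exists>(I :: nat set) F B.
     tree_decomposition V E I F B \<and> decomposition_width I B = k)"


section \<open>Non-uniform sparsest cut\<close>

definition sparsest_cut_instance ::
  "'a set \<Rightarrow> 'a set set \<Rightarrow> ('a set \<Rightarrow> real) \<Rightarrow> 'a set set \<Rightarrow> ('a set \<Rightarrow> real) \<Rightarrow> bool" where
  "sparsest_cut_instance V EG cap ED dem \<longleftrightarrow>
     simple_graph V EG \<and> (\<forall>e\<in>EG. 0 < cap e) \<and>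
     simple_graph V ED \<and> (\<forall>e\<in>ED. 0 < dem e) \<and> ED \<noteq> {}"

definition edge_boundary :: "'a set set \<Rightarrow> 'a set \<Rightarrow> 'a set set" where
  "edge_boundary E S = {e \<in> E. card (e \<inter> S) = 1}"

definition sparsity ::
  "'a set set \<Rightarrow> ('a set \<Rightarrow> real) \<Rightarrow> 'a set set \<Rightarrow> ('a set \<Rightarrow> real) \<Rightarrow> 'a set \<Rightarrow> real" where
  "sparsity EG cap ED dem S =
     (\<Sum>e\<in>edge_boundary EG S. cap e) / (\<Sum>e\<in>edge_boundary ED S. dem e)"

text \<open>Sparsity is only meaningful for cuts that separate some demand; the others are excluded,
  since division by zero would give them sparsity \<open>0\<close>.\<close>

definition min_sparsity ::
  "'a set \<Rightarrow> 'a set set \<Rightarrow> ('a set \<Rightarrow> real) \<Rightarrow> 'a set set \<Rightarrow> ('a set \<Rightarrow> real) \<Rightarrow> real" where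
  "min_sparsity V EG cap ED dem =
     Min {sparsity EG cap ED dem S | S. S \<subseteq> V \<and> 0 < (\<Sum>e\<in>edge_boundary ED S. dem e)}"


section \<open>The Sherali-Adams relaxation\<close>

text \<open>The defining equation makes \<open>y\<^sub>u\<^sub>v\<close> symmetric in \<open>u\<close> and \<open>v\<close>, so the vector \<open>y\<close> is indexed by
  the unordered pair \<open>{u, v}\<close>. The diagonal coordinates \<open>y {u}\<close> never enter the objective, as
  graphs have no loops. The definition is meant for \<open>r \<ge> 2\<close>: otherwise \<open>x\<close> is not constrained
  on two-element sets.\<close>

definition sherali_adams :: "'a set \<Rightarrow> nat \<Rightarrow> ('a set \<Rightarrow> real) set" where
  "sherali_adams V r = {y. \<exists>x :: 'a set \<Rightarrow> 'a set \<Rightarrow> real.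
     (\<forall>u\<in>V. \<forall>v\<in>V. y {u, v} = x {u, v} {u} + x {u, v} {v}) \<and>
     (\<forall>S\<subseteq>V. card S \<le> r \<longrightarrow> (\<Sum>T\<in>Pow S. x S T) = 1) \<and>
     (\<forall>S\<subseteq>V. card S + 1 \<le> r \<longrightarrow> (\<forall>T\<subseteq>S. \<forall>u\<in>V - S.
        x S T = x (S \<union> {u}) T + x (S \<union> {u}) (T \<union> {u}))) \<and>
     (\<forall>S\<subseteq>V. card S \<le> r \<longrightarrow> (\<forall>T\<subseteq>S. 0 \<le> x S T))}"

text \<open>The infimum is a minimum: the objective is linear-fractional, so it is minimised at one of
  the finitely many vertices of the polytope. As for cuts, points with zero denominator are
  excluded.\<close>

definition sa_value ::
  "'a set \<Rightarrow> 'a set set \<Rightarrow> ('a set \<Rightarrow> real) \<Rightarrow> 'a set set \<Rightarrow> ('a set \<Rightarrow> real) \<Rightarrow> nat \<Rightarrow> real" where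
  "sa_value V EG cap ED dem r =
     Inf {(\<Sum>e\<in>EG. cap e * y e) / (\<Sum>e\<in>ED. dem e * y e) | y.
            y \<in> sherali_adams V r \<and> 0 < (\<Sum>e\<in>ED. dem e * y e)}"

text \<open>If the relaxation has value \<open>0\<close>, this quotient is \<open>0\<close> by convention rather than infinite;
  a positive lower bound on it thus entails that the value is nonzero.\<close>

definition integrality_gap ::
  "'a set \<Rightarrow> 'a set set \<Rightarrow> ('a set \<Rightarrow> real) \<Rightarrow> 'a set set \<Rightarrow> ('a set \<Rightarrow> real) \<Rightarrow> nat \<Rightarrow> real" where
  "integrality_gap V EG cap ED dem r =
     min_sparsity V EG cap ED dem / sa_value V EG cap ED dem r"

end

theory Submission
  imports Defs "HOL-Analysis.Analysis" "HOL-Real_Asymp.Real_Asymp"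
begin

text \<open>
  A cut problem on series-parallel graphs is built from a weighted base graph \<open>H\<close> on \<open>n\<close> vertices
  all of whose cuts have weight at most \<open>1/2 + \<eta>\<close> and that has no cycle shorter than \<open>c ln n\<close>. Start
  with one edge of capacity \<open>1\<close> and \<open>k\<close> times replace every edge by a copy of \<open>K\<^sub>2\<^sub>,\<^sub>n\<close>, with demands
  a copy of \<open>H\<close> on its \<open>n\<close> middle vertices. As every cut of \<open>H\<close> has about half of its weight at most, a cut
  of capacity \<open>1\<close> separates demand at most about \<open>k/2 + 2\<close>; this is shown level by level.

  A Sherali-Adams solution that cuts almost every edge of \<open>H\<close> extends along the levels, independently in
  each copy, to one of cost \<open>1\<close> separating demand about \<open>k\<close>. On \<open>H\<close> it comes from rounding a Gaussian
  vector: its covariance is the truncated generating function of non-backtracking walks at a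
  parameter near \<open>-1\<close>, which is positive semidefinite on every set of \<open>n\<^sup>\<delta>\<close> vertices because small
  subgraphs of large girth have few walks. The rounding function is an odd trigonometric polynomial close to
  a square wave, so all probabilities are finite sums that depend only on the covariance; this makes
  local distributions on different sets agree, while nonnegativity is a local question.
\<close>

section \<open>Gaussian pseudo-distributions\<close>

text \<open>A Gaussian vector on all of \<open>H\<close>, almost antipodal along every edge, would
  round to a true cut of almost the whole weight, which \<open>H\<close> forbids. So no global
  Gaussian vector can exist. Marginals, independence and expectations are therefore proved as
  identities between finite sums for arbitrary symmetric covariances, and positivity enters only on
  sets of at most \<open>R\<close> coordinates.

  The parameter near -1 gives the ends of an edge a covariance close to minus their variance. As the
  rounding function is odd and mostly close to 1 or -1, such ends are separated with probability
  close to 1. Truncating the walks leaves the kernel positive semidefinite only up to an error of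
  order \<theta>^L times a polynomial in the size of the set. With L of order ln n this error is
  smaller than 1 for sets as large as a small power of n, which is the origin of the n^\<delta>
  rounds; a multiple of the identity absorbs the rest.

  The number of levels depends on \<epsilon> alone, so that the vertex count stays polynomial in the
  size of \<open>H\<close>.\<close>

definition quad :: "('b \<Rightarrow> 'b \<Rightarrow> real) \<Rightarrow> 'b set \<Rightarrow> ('b \<Rightarrow> real) \<Rightarrow> real" where
  "quad K U z = (\<Sum>u\<in>U. \<Sum>v\<in>U. K u v * z u * z v)"

lemma quad_cong:
  assumes "\<And>u. u \<in> U \<Longrightarrow> y u = z u"
  shows "quad K U y = quad K U z"
  unfolding quad_def using assms by (intro sum.cong refl) auto

lemma quad_insert:
  assumes "finite U" "u \<notin> U" "\<And>v w. K v w = K w v"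
  shows "quad K (insert u U) z = K u u * (z u)\<^sup>2 + 2 * z u * (\<Sum>v\<in>U. K u v * z v) + quad K U z"
proof -
  have "quad K (insert u U) z = (K u u * z u * z u + (\<Sum>v\<in>U. K u v * z u * z v))
      + (\<Sum>w\<in>U. K w u * z w * z u + (\<Sum>v\<in>U. K w v * z w * z v))"
    unfolding quad_def using assms(1,2) by simp
  also have "(\<Sum>w\<in>U. K w u * z w * z u + (\<Sum>v\<in>U. K w v * z w * z v)) =
      (\<Sum>w\<in>U. K u w * z w * z u) + quad K U z"
    by (simp add: sum.distrib quad_def assms(3)[of _ u])
  finally show ?thesis
    by (simp add: sum_distrib_left sum_distrib_right sum.distrib power2_eq_square algebra_simps)
qed

text \<open>Lagrange reduction: completing the square in the coordinate \<open>u\<close> splits off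
  one square and leaves the Schur complement \<open>K'\<close>, while a zero diagonal entry forces
  its whole row to vanish. The squares supply the independent directions of the Gaussian steps
  below.\<close>

lemma psd_sum_of_squares:
  assumes "finite U" "\<And>v w. K v w = K w v" "\<And>z. 0 \<le> quad K U z"
  shows "\<exists>(m::nat) V. \<forall>z. quad K U z = (\<Sum>j<m. (\<Sum>u\<in>U. V j u * z u)\<^sup>2)"
  using assms
proof (induction U arbitrary: K rule: finite_induct)
  case empty
  then show ?case by (intro exI[of _ 0]) (simp add: quad_def)
next
  case (insert u U)
  note ins = quad_insert[OF insert.hyps, of K, OF insert.prems(1)]
  have K0: "0 \<le> K u u"
  proof -
    let ?z = "\<lambda>v. of_bool (v = u) :: real"
    have "(\<Sum>v\<in>U. K u v * ?z v) = 0" "quad K U ?z = 0"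
      unfolding quad_def using insert.hyps by (auto intro!: sum.neutral)
    then show ?thesis using insert.prems(2)[of ?z] by (simp add: ins)
  qed
  show ?case
  proof (cases "K u u = 0")
    case True
    have Kuv: "K u v = 0" if v: "v \<in> U" for v
    proof (rule ccontr)
      assume nz: "K u v \<noteq> 0"
      \<comment> \<open>With \<open>K u u = 0\<close> the form is affine in the coordinate at
        \<open>u\<close>; this value brings it to -1.\<close>
      let ?t = "- (K v v + 1) / (2 * K u v)"
      let ?z = "\<lambda>w. if w = u then ?t else of_bool (w = v)"
      have uv: "u \<noteq> v" using insert.hyps v by auto
      have s1: "(\<Sum>w\<in>U. K u w * ?z w) = K u v"
      proof -
        have "(\<Sum>w\<in>U. K u w * ?z w) = (\<Sum>w\<in>U. if w = v then K u v else 0)"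
          using insert.hyps by (intro sum.cong) auto
        then show ?thesis using insert.hyps v by simp
      qed
      have s2: "quad K U ?z = K v v"
      proof -
        have "quad K U ?z = (\<Sum>w\<in>U. \<Sum>x\<in>U. if x = v then (if w = v then K v v else 0) else 0)"
          unfolding quad_def using insert.hyps by (intro sum.cong) auto
        also have "\<dots> = K v v" using insert.hyps v by simp
        finally show ?thesis .
      qed
      have "quad K (insert u U) ?z = 2 * ?t * K u v + K v v"
        unfolding ins s1 s2 using True by simp
      also have "\<dots> = -1" using nz by (simp add: field_simps)
      finally show False using insert.prems(2)[of ?z] by linarith
    qed
    have q: "quad K (insert u U) z = quad K U z" for z
      unfolding ins using True Kuv by simp
    obtain m :: nat and V where V: "\<And>z. quad K U z = (\<Sum>j<m. (\<Sum>u\<in>U. V j u * z u)\<^sup>2)"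
    proof -
      have "0 \<le> quad K U z" for z using insert.prems(2)[of z] q[of z] by simp
      from insert.IH[OF insert.prems(1) this] show thesis using that by blast
    qed
    show ?thesis
      by (rule exI[of _ m], rule exI[of _ "\<lambda>j v. if v = u then 0 else V j v"])
        (use insert.hyps in \<open>auto simp: q V intro!: sum.cong arg_cong[where f="\<lambda>x. x\<^sup>2"]\<close>)
  next
    case False
    with K0 have pos: "K u u > 0" by simp
    let ?l = "\<lambda>z. \<Sum>v\<in>U. K u v * z v"
    define K' where "K' v w = K v w - K u v * K u w / K u u" for v w
    have qK': "quad K' U z = quad K U z - (?l z)\<^sup>2 / K u u" for z
    proof -
      have "quad K' U z = quad K U z - (\<Sum>v\<in>U. \<Sum>w\<in>U. (K u v * z v) * (K u w * z w) / K u u)"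
        by (simp add: quad_def K'_def sum_subtractf algebra_simps)
      also have "(\<Sum>v\<in>U. \<Sum>w\<in>U. (K u v * z v) * (K u w * z w) / K u u) = (?l z)\<^sup>2 / K u u"
        by (simp add: power2_eq_square sum_product sum_divide_distrib)
      finally show ?thesis .
    qed
    have sym': "K' v w = K' w v" for v w
      using insert.prems(1) by (simp add: K'_def mult.commute)
    have nn': "0 \<le> quad K' U z" for z
    proof -
      \<comment> \<open>This value minimises the form over the coordinate \<open>u\<close>, and the
        minimum is the form of \<open>K'\<close>.\<close>
      let ?z = "z(u := - ?l z / K u u)"
      have e1: "?l ?z = ?l z" using insert.hyps by (intro sum.cong) auto
      have e2: "quad K U ?z = quad K U z" using insert.hyps by (intro quad_cong) auto
      have "0 \<le> quad K (insert u U) ?z" by (rule insert.prems(2))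
      also have "\<dots> = K u u * (?l z / K u u)\<^sup>2 - 2 * (?l z / K u u) * ?l z + quad K U z"
        unfolding ins e1 e2 by simp
      also have "\<dots> = quad K' U z"
        unfolding qK' using pos by (simp add: field_simps power2_eq_square)
      finally show ?thesis .
    qed
    obtain m :: nat and V where V: "\<And>z. quad K' U z = (\<Sum>j<m. (\<Sum>u\<in>U. V j u * z u)\<^sup>2)"
      using insert.IH[OF sym' nn'] by blast
    define V' where "V' j v = (if j = m then K u v / sqrt (K u u) else if v = u then 0 else V j v)" for j v
    have "quad K (insert u U) z = (\<Sum>j<Suc m. (\<Sum>w\<in>insert u U. V' j w * z w)\<^sup>2)" for z
    proof -
      have a: "(\<Sum>w\<in>insert u U. V' m w * z w) = (K u u * z u + ?l z) / sqrt (K u u)"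
        using insert.hyps by (simp add: V'_def sum_divide_distrib add_divide_distrib)
      have b: "(\<Sum>w\<in>insert u U. V' j w * z w) = (\<Sum>w\<in>U. V j w * z w)" if "j < m" for j
      proof -
        have "(\<Sum>w\<in>insert u U. V' j w * z w) = V' j u * z u + (\<Sum>w\<in>U. V' j w * z w)"
          using insert.hyps by simp
        also have "(\<Sum>w\<in>U. V' j w * z w) = (\<Sum>w\<in>U. V j w * z w)"
          using insert.hyps that by (intro sum.cong) (auto simp: V'_def)
        finally show ?thesis using that by (simp add: V'_def)
      qed
      have "(\<Sum>j<Suc m. (\<Sum>w\<in>insert u U. V' j w * z w)\<^sup>2)
          = quad K' U z + ((K u u * z u + ?l z) / sqrt (K u u))\<^sup>2"
        unfolding V sum.lessThan_Suc a using b by simp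
      also have "((K u u * z u + ?l z) / sqrt (K u u))\<^sup>2 = (K u u * z u + ?l z)\<^sup>2 / K u u"
        using pos by (simp add: power_divide)
      also have "quad K' U z + \<dots> = quad K (insert u U) z"
        unfolding qK' ins using pos by (simp add: field_simps power2_eq_square)
      finally show ?thesis by simp
    qed
    then show ?thesis by blast
  qed
qed

section \<open>Gaussian averages of nonnegative trigonometric sums\<close>

lemma cos_power_tendsto: "(\<lambda>M. cos (a / sqrt (real M)) ^ M) \<longlonglongrightarrow> exp (- (a\<^sup>2 / 2))"
proof -
  have "(\<lambda>M. cos (a / sqrt (real M)) ^ M) \<longlonglongrightarrow> exp (- (a * a / 2))" by real_asymp
  then show ?thesis by (simp add: power2_eq_square)
qed

abbreviation lin_form :: "'b set \<Rightarrow> ('b \<Rightarrow> int) \<Rightarrow> ('b \<Rightarrow> real) \<Rightarrow> real" where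
  "lin_form U k x \<equiv> \<Sum>u\<in>U. real_of_int (k u) * x u"

text \<open>A Gaussian step in direction \<open>v\<close> is the limit of \<open>M\<close> random steps \<open>\<plusminus> v / sqrt M\<close>, each of which
  averages two nonnegative values.\<close>

lemma trig_sum_gaussian_average:
  fixes B :: "('b \<Rightarrow> int) \<Rightarrow> complex"
  assumes "finite P" and nn: "\<And>x. 0 \<le> Re (\<Sum>k\<in>P. B k * cis (lin_form U k x))"
  shows "0 \<le> Re (\<Sum>k\<in>P. B k * of_real (exp (- ((lin_form U k v)\<^sup>2 / 2))) * cis (lin_form U k x))"
proof -
  have pw: "0 \<le> Re (\<Sum>k\<in>P. B k * of_real (cos (lin_form U k v * h) ^ M) * cis (lin_form U k x))" for h M x
  proof (induction M arbitrary: x)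
    case 0
    then show ?case using nn[of x] by simp
  next
    case (Suc M)
    define F where "F y = (\<Sum>k\<in>P. B k * of_real (cos (lin_form U k v * h) ^ M) * cis (lin_form U k y))" for y
    have lin: "lin_form U k (\<lambda>u. x u + t * v u) = lin_form U k x + t * lin_form U k v" for k t
      by (simp add: sum.distrib sum_distrib_left algebra_simps)
    have cc: "cis (a + h * b) + cis (a + (- h) * b) = 2 * of_real (cos (b * h)) * cis a" for a b
      by (simp add: complex_eq_iff cos_add sin_add cos_diff sin_diff mult.commute)
    have "F (\<lambda>u. x u + h * v u) + F (\<lambda>u. x u + (-h) * v u) =
        (\<Sum>k\<in>P. B k * of_real (cos (lin_form U k v * h) ^ M) *
           (cis (lin_form U k x + h * lin_form U k v) + cis (lin_form U k x + (-h) * lin_form U k v)))"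
      unfolding F_def lin sum.distrib[symmetric] distrib_left[symmetric] ..
    also have "\<dots> = 2 * (\<Sum>k\<in>P. B k * of_real (cos (lin_form U k v * h) ^ Suc M) * cis (lin_form U k x))"
      unfolding cc unfolding sum_distrib_left by (intro sum.cong refl) (simp add: mult_ac)
    finally have e: "F (\<lambda>u. x u + h * v u) + F (\<lambda>u. x u + (-h) * v u) = \<dots>" .
    have "0 \<le> Re (F (\<lambda>u. x u + h * v u) + F (\<lambda>u. x u + (-h) * v u))"
      unfolding F_def plus_complex.sel by (intro add_nonneg_nonneg Suc.IH)
    then show ?case unfolding e by simp
  qed
  have "(\<lambda>M. Re (\<Sum>k\<in>P. B k * of_real (cos (lin_form U k v * (1 / sqrt (real M))) ^ M) * cis (lin_form U k x)))
     \<longlonglongrightarrow> Re (\<Sum>k\<in>P. B k * of_real (exp (- ((lin_form U k v)\<^sup>2 / 2))) * cis (lin_form U k x))"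
    using cos_power_tendsto[of "lin_form U _ v"] by (intro tendsto_intros) auto
  then show ?thesis
    by (rule tendsto_lowerbound) (intro always_eventually allI pw, simp)
qed

text \<open>A Gaussian vector with covariance \<open>K\<close> is a sum of independent steps along
  the directions \<open>V j\<close>, whose characteristic functions multiply to the exponential. The
  point \<open>x\<close> stays arbitrary until all steps are made, because every step averages over
  shifted points.\<close>

lemma trig_sum_gaussian_nonneg:
  fixes B :: "('b \<Rightarrow> int) \<Rightarrow> complex"
  assumes "finite P" "finite U" and sym: "\<And>v w. K v w = K w v" and psd: "\<And>z. 0 \<le> quad K U z"
    and nn: "\<And>x. 0 \<le> Re (\<Sum>k\<in>P. B k * cis (lin_form U k x))"
  shows "0 \<le> Re (\<Sum>k\<in>P. B k * of_real (exp (- (quad K U (\<lambda>u. real_of_int (k u)) / 2))))"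
proof -
  obtain m :: nat and V where V: "\<And>z. quad K U z = (\<Sum>j<m. (\<Sum>u\<in>U. V j u * z u)\<^sup>2)"
    using psd_sum_of_squares[OF assms(2) sym psd] by blast
  have "0 \<le> Re (\<Sum>k\<in>P. B k * of_real (exp (- ((\<Sum>j<i. (lin_form U k (V j))\<^sup>2) / 2))) * cis (lin_form U k x))" for x i
  proof (induction i arbitrary: x)
    case 0
    show ?case using nn[of x] by simp
  next
    case (Suc i)
    have e: "exp (- ((\<Sum>j<Suc i. (lin_form U k (V j))\<^sup>2) / 2)) =
        exp (- ((\<Sum>j<i. (lin_form U k (V j))\<^sup>2) / 2)) * exp (- ((lin_form U k (V i))\<^sup>2 / 2))" for k
      by (simp add: exp_add[symmetric] add_divide_distrib)
    show ?case using trig_sum_gaussian_average[OF assms(1) Suc.IH, of "V i" x]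
      unfolding e of_real_mult by (simp only: mult.assoc)
  qed
  from this[of m "\<lambda>_. 0"] show ?thesis unfolding V by (simp add: mult.commute)
qed

text \<open>These are the Fourier coefficients of \<open>(1 \<plusminus> p) / 2\<close> for the rounding function \<open>p(x) = \<Sum>k. s k * sin (k * x)\<close>.\<close>

definition rounding_coeff :: "(int \<Rightarrow> real) \<Rightarrow> bool \<Rightarrow> int \<Rightarrow> complex" where
  "rounding_coeff s \<tau> k = (of_bool (k = 0) + (if \<tau> then - \<i> * s k else \<i> * s k)) / 2"

definition pseudo_coeff :: "(int \<Rightarrow> real) \<Rightarrow> 'b set \<Rightarrow> 'b set \<Rightarrow> ('b \<Rightarrow> int) \<Rightarrow> complex" where
  "pseudo_coeff s U T k = (\<Prod>u\<in>U. rounding_coeff s (u \<in> T) (k u))"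

text \<open>The probability that the set of all \<open>u \<in> U\<close> rounded to \<open>True\<close> is \<open>T\<close>, when \<open>u\<close> is rounded to \<open>True\<close> with
  probability \<open>(1 + p(X u)) / 2\<close> for a centred Gaussian vector \<open>X\<close> with covariance \<open>K\<close>: the
  exponentials are the characteristic function of \<open>X\<close>. The sum makes sense for every \<open>K\<close>.\<close>

definition pseudo_probc :: "(int \<Rightarrow> real) \<Rightarrow> int \<Rightarrow> ('b \<Rightarrow> 'b \<Rightarrow> real) \<Rightarrow> 'b set \<Rightarrow> 'b set \<Rightarrow> complex" where
  "pseudo_probc s D K U T = (\<Sum>k\<in>PiE U (\<lambda>_. {-D..D}). pseudo_coeff s U T k *
     of_real (exp (- (quad K U (\<lambda>u. real_of_int (k u)) / 2))))"

definition pseudo_prob :: "(int \<Rightarrow> real) \<Rightarrow> int \<Rightarrow> ('b \<Rightarrow> 'b \<Rightarrow> real) \<Rightarrow> 'b set \<Rightarrow> 'b set \<Rightarrow> real" where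
  "pseudo_prob s D K U T = Re (pseudo_probc s D K U T)"

lemma sum_PiE_insert:
  fixes g :: "('b \<Rightarrow> 'c) \<Rightarrow> 'd::comm_monoid_add"
  assumes "u \<notin> U"
  shows "(\<Sum>k\<in>PiE (insert u U) (\<lambda>_. A). g k) = (\<Sum>y\<in>A. \<Sum>k\<in>PiE U (\<lambda>_. A). g (k(u := y)))"
proof -
  have "(\<Sum>k\<in>PiE (insert u U) (\<lambda>_. A). g k) = (\<Sum>(y, k)\<in>A \<times> PiE U (\<lambda>_. A). g (k(u := y)))"
    unfolding PiE_insert_eq
    by (subst sum.reindex) (use assms in \<open>auto intro!: inj_combinator simp: case_prod_beta comp_def\<close>)
  then show ?thesis by (simp add: sum.cartesian_product)
qed

text \<open>For odd \<open>s\<close> the terms of \<open>k\<close> and \<open>- k\<close> agree, so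
  \<open>- \<i> * s k\<close> is the Fourier coefficient of the rounding function at
  \<open>k\<close>, and its mean square over a period is the sum of the squares of all
  \<open>s k\<close>. The bound 1 makes \<open>(1 + p) / 2\<close> a probability.\<close>

locale sine_rounding =
  fixes s :: "int \<Rightarrow> real" and D :: int
  assumes D: "0 \<le> D" and odd: "\<And>k. s (- k) = - s k"
    and bound: "\<And>x. \<bar>\<Sum>k\<in>{-D..D}. s k * sin (real_of_int k * x)\<bar> \<le> 1"
begin

lemma cos_sum: "(\<Sum>k\<in>{-D..D}. s k * cos (real_of_int k * x)) = 0"
proof -
  have "(\<Sum>k\<in>{-D..D}. s k * cos (real_of_int k * x)) = (\<Sum>k\<in>{-D..D}. s (-k) * cos (real_of_int (-k) * x))"
    by (rule sum.reindex_bij_witness[of _ uminus uminus]) auto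
  also have "\<dots> = - (\<Sum>k\<in>{-D..D}. s k * cos (real_of_int k * x))" by (simp add: odd sum_negf)
  finally show ?thesis by simp
qed

lemma rounding_sum:
  "(\<Sum>k\<in>{-D..D}. rounding_coeff s \<tau> k * cis (real_of_int k * x)) =
     of_real ((1 + (if \<tau> then 1 else - 1) * (\<Sum>k\<in>{-D..D}. s k * sin (real_of_int k * x))) / 2)"
proof -
  have a: "(\<Sum>k\<in>{-D..D}. of_bool (k = 0) * cis (real_of_int k * x)) = 1"
  proof -
    have "(\<Sum>k\<in>{-D..D}. of_bool (k = 0) * cis (real_of_int k * x)) = (\<Sum>k\<in>{-D..D}. if k = 0 then 1 else 0)"
      by (intro sum.cong) auto
    then show ?thesis using D by simp
  qed
  have b: "(\<Sum>k\<in>{-D..D}. of_real (s k) * cis (real_of_int k * x)) = \<i> * of_real (\<Sum>k\<in>{-D..D}. s k * sin (real_of_int k * x))"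
    using cos_sum[of x] by (simp add: complex_eq_iff)
  have "(\<Sum>k\<in>{-D..D}. rounding_coeff s \<tau> k * cis (real_of_int k * x)) =
    ((\<Sum>k\<in>{-D..D}. of_bool (k = 0) * cis (real_of_int k * x)) +
      (if \<tau> then - \<i> else \<i>) * (\<Sum>k\<in>{-D..D}. of_real (s k) * cis (real_of_int k * x))) / 2"
    unfolding rounding_coeff_def sum_distrib_left sum.distrib[symmetric] sum_divide_distrib
    by (intro sum.cong refl) (auto simp: algebra_simps)
  also have "\<dots> = of_real ((1 + (if \<tau> then 1 else - 1) * (\<Sum>k\<in>{-D..D}. s k * sin (real_of_int k * x))) / 2)"
    unfolding a b by simp
  finally show ?thesis .
qed

lemma rounding_coeff_add: "rounding_coeff s False k + rounding_coeff s True k = of_bool (k = 0)"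
  by (auto simp: rounding_coeff_def add_divide_distrib[symmetric])

text \<open>At a fixed \<open>x\<close> the sum factorises over \<open>U\<close> into probabilities
  \<open>(1 + p) / 2\<close> or \<open>(1 - p) / 2\<close> of independent roundings.\<close>

lemma pseudo_coeff_sum_nonneg:
  assumes "finite U"
  shows "0 \<le> Re (\<Sum>k\<in>PiE U (\<lambda>_. {-D..D}). pseudo_coeff s U T k * cis (lin_form U k x))"
proof -
  have cis_sum: "cis (\<Sum>u\<in>U. f u) = (\<Prod>u\<in>U. cis (f u))" for f
    using assms by (induction U rule: finite_induct) (auto simp: cis_mult[symmetric])
  have "(\<Sum>k\<in>PiE U (\<lambda>_. {-D..D}). pseudo_coeff s U T k * cis (lin_form U k x)) =
    (\<Sum>k\<in>PiE U (\<lambda>_. {-D..D}). \<Prod>u\<in>U. rounding_coeff s (u \<in> T) (k u) * cis (real_of_int (k u) * x u))"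
    unfolding pseudo_coeff_def cis_sum prod.distrib by simp
  also have "\<dots> = (\<Prod>u\<in>U. \<Sum>k\<in>{-D..D}. rounding_coeff s (u \<in> T) k * cis (real_of_int k * x u))"
    using assms by (subst prod_sum_PiE) auto
  also have "\<dots> = of_real (\<Prod>u\<in>U. (1 + (if u \<in> T then 1 else - 1) * (\<Sum>k\<in>{-D..D}. s k * sin (real_of_int k * x u))) / 2)"
    unfolding rounding_sum of_real_prod ..
  finally have e: "(\<Sum>k\<in>PiE U (\<lambda>_. {-D..D}). pseudo_coeff s U T k * cis (lin_form U k x)) = \<dots>" .
  have nn: "0 \<le> (1 + (if \<tau> then 1 else - 1) * p) / 2" if "\<bar>p\<bar> \<le> 1" for p :: real and \<tau>
    using that by auto
  show ?thesis unfolding e Re_complex_of_real by (intro prod_nonneg nn bound)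
qed

lemma pseudo_prob_nonneg:
  assumes "finite U" "\<And>v w. K v w = K w v" "\<And>z. 0 \<le> quad K U z"
  shows "0 \<le> pseudo_prob s D K U T"
  unfolding pseudo_prob_def pseudo_probc_def
  by (rule trig_sum_gaussian_nonneg[OF _ assms pseudo_coeff_sum_nonneg[OF assms(1)]])
    (use assms(1) in \<open>auto intro: finite_PiE\<close>)

lemma pseudo_prob_empty: "pseudo_prob s D K {} {} = 1"
  by (simp add: pseudo_prob_def pseudo_probc_def pseudo_coeff_def quad_def)

text \<open>The two outcomes at \<open>u\<close> add up to the constant 1, so only the frequency 0
  survives at \<open>u\<close> and the quadratic form loses this coordinate. Positivity of
  \<open>K\<close> does not enter, so local distributions agree even where no Gaussian vector
  exists.\<close>

lemma pseudo_prob_marginal: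
  assumes "finite U" "u \<notin> U" "T \<subseteq> U" "\<And>v w. K v w = K w v"
  shows "pseudo_prob s D K (insert u U) T + pseudo_prob s D K (insert u U) (insert u T) = pseudo_prob s D K U T"
proof -
  have c1: "pseudo_coeff s (insert u U) T (k(u := y)) = rounding_coeff s False y * pseudo_coeff s U T k" for k y
  proof -
    have "(\<Prod>w\<in>U. rounding_coeff s (w \<in> T) ((k(u := y)) w)) = pseudo_coeff s U T k"
      unfolding pseudo_coeff_def using assms by (intro prod.cong) auto
    moreover have "u \<notin> T" using assms by auto
    ultimately show ?thesis using assms by (simp add: pseudo_coeff_def)
  qed
  have c2: "pseudo_coeff s (insert u U) (insert u T) (k(u := y)) = rounding_coeff s True y * pseudo_coeff s U T k" for k y
  proof -
    have "(\<Prod>w\<in>U. rounding_coeff s (w \<in> insert u T) ((k(u := y)) w)) = pseudo_coeff s U T k"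
      unfolding pseudo_coeff_def using assms by (intro prod.cong) auto
    then show ?thesis using assms by (simp add: pseudo_coeff_def)
  qed
  let ?e = "\<lambda>U k. complex_of_real (exp (- (quad K U (\<lambda>u. real_of_int (k u)) / 2)))"
  have q: "quad K (insert u U) (\<lambda>w. real_of_int ((k(u := 0)) w)) = quad K U (\<lambda>w. real_of_int (k w))" for k
  proof -
    have "quad K U (\<lambda>w. real_of_int ((k(u := 0)) w)) = quad K U (\<lambda>w. real_of_int (k w))"
      using assms(2) by (intro quad_cong) auto
    then show ?thesis by (simp add: quad_insert[OF assms(1,2,4)])
  qed
  have "pseudo_probc s D K (insert u U) T + pseudo_probc s D K (insert u U) (insert u T) =
     (\<Sum>y\<in>{-D..D}. \<Sum>k\<in>PiE U (\<lambda>_. {-D..D}).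
        (rounding_coeff s False y + rounding_coeff s True y) * pseudo_coeff s U T k * ?e (insert u U) (k(u := y)))"
    unfolding pseudo_probc_def sum_PiE_insert[OF assms(2)] c1 c2 sum.distrib[symmetric] distrib_right[symmetric] ..
  also have "\<dots> = (\<Sum>y\<in>{-D..D}. if y = 0 then \<Sum>k\<in>PiE U (\<lambda>_. {-D..D}).
        pseudo_coeff s U T k * ?e (insert u U) (k(u := 0)) else 0)"
    unfolding rounding_coeff_add by (intro sum.cong) auto
  also have "\<dots> = pseudo_probc s D K U T"
    unfolding q using D by (simp add: pseudo_probc_def)
  finally show ?thesis unfolding pseudo_prob_def by (metis plus_complex.sel(1))
qed

lemma rounding_coeff_uminus: "rounding_coeff s \<tau> (- k) = cnj (rounding_coeff s \<tau> k)"
  by (simp add: rounding_coeff_def odd)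

text \<open>Negating all frequencies conjugates the coefficients and fixes the exponentials. Being
  real matters for the product rule, since \<open>Re\<close> is not multiplicative.\<close>

lemma pseudo_probc_real:
  assumes "finite U"
  shows "pseudo_probc s D K U T = of_real (pseudo_prob s D K U T)"
proof -
  have "pseudo_probc s D K U T = (\<Sum>k\<in>PiE U (\<lambda>_. {-D..D}). cnj (pseudo_coeff s U T k *
     of_real (exp (- (quad K U (\<lambda>u. real_of_int (k u)) / 2)))))"
    unfolding pseudo_probc_def
  proof (rule sum.reindex_bij_witness[of _ "\<lambda>k. \<lambda>u\<in>U. - k u" "\<lambda>k. \<lambda>u\<in>U. - k u"])
    fix k assume k: "k \<in> PiE U (\<lambda>_. {-D..D})"
    have c: "pseudo_coeff s U T (\<lambda>u\<in>U. - k u) = cnj (pseudo_coeff s U T k)"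
      unfolding pseudo_coeff_def cnj_prod by (intro prod.cong) (auto simp: rounding_coeff_uminus)
    have q: "quad K U (\<lambda>u. real_of_int ((\<lambda>u\<in>U. - k u) u)) = quad K U (\<lambda>u. real_of_int (k u))"
      unfolding quad_def by (intro sum.cong) auto
    show "cnj (pseudo_coeff s U T (\<lambda>u\<in>U. - k u) *
       of_real (exp (- (quad K U (\<lambda>u. real_of_int ((\<lambda>u\<in>U. - k u) u)) / 2)))) =
       pseudo_coeff s U T k * of_real (exp (- (quad K U (\<lambda>u. real_of_int (k u)) / 2)))"
      unfolding c q by simp
    show "(\<lambda>u\<in>U. - (\<lambda>u\<in>U. - k u) u) = k" "(\<lambda>u\<in>U. - k u) \<in> PiE U (\<lambda>_. {-D..D})"
      using k by (auto simp: fun_eq_iff PiE_def extensional_def Pi_def)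
  next
    fix k assume k: "k \<in> PiE U (\<lambda>_. {-D..D})"
    show "(\<lambda>u\<in>U. - (\<lambda>u\<in>U. - k u) u) = k" "(\<lambda>u\<in>U. - k u) \<in> PiE U (\<lambda>_. {-D..D})"
      using k by (auto simp: fun_eq_iff PiE_def extensional_def Pi_def)
  qed
  then have "pseudo_probc s D K U T = cnj (pseudo_probc s D K U T)"
    unfolding pseudo_probc_def cnj_sum .
  then show ?thesis
    unfolding pseudo_prob_def by (simp add: complex_eq_iff)
qed

text \<open>Uncorrelated Gaussian blocks are independent: without cross terms the quadratic form
  splits and its exponential factorises.\<close>

lemma pseudo_prob_mult:
  assumes "finite U" "finite U'" "U \<inter> U' = {}" "T \<subseteq> U" "T' \<subseteq> U'"
    and "\<And>u v. u \<in> U \<Longrightarrow> v \<in> U' \<Longrightarrow> K u v = 0" "\<And>u v. u \<in> U \<Longrightarrow> v \<in> U' \<Longrightarrow> K v u = 0"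
  shows "pseudo_prob s D K (U \<union> U') (T \<union> T') = pseudo_prob s D K U T * pseudo_prob s D K U' T'"
proof -
  let ?e = "\<lambda>U k. complex_of_real (exp (- (quad K U (\<lambda>u. real_of_int (k u)) / 2)))"
  let ?P = "\<lambda>U. PiE U (\<lambda>_::'a. {-D..D})"
  have "pseudo_probc s D K (U \<union> U') (T \<union> T') =
      (\<Sum>(k, l)\<in>?P U \<times> ?P U'. (pseudo_coeff s U T k * ?e U k) * (pseudo_coeff s U' T' l * ?e U' l))"
    unfolding pseudo_probc_def
  proof (rule sum.reindex_bij_witness[of _ "\<lambda>(k, l). \<lambda>u. if u \<in> U then k u else l u"
        "\<lambda>k. (restrict k U, restrict k U')"], goal_cases)
    case (1 k) then show ?case by (auto simp: fun_eq_iff PiE_def extensional_def)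
  next
    case (2 k) then show ?case by (auto simp: PiE_def Pi_def)
  next
    case (3 b)
    then obtain k l where b: "b = (k, l)" "k \<in> ?P U" "l \<in> ?P U'" by auto
    have "restrict (\<lambda>u. if u \<in> U then k u else l u) U = k"
      using b(2) by (auto simp: fun_eq_iff PiE_def extensional_def)
    moreover have "restrict (\<lambda>u. if u \<in> U then k u else l u) U' = l"
      using b(3) assms(3) by (auto simp: fun_eq_iff PiE_def extensional_def)
    ultimately show ?case by (simp add: b)
  next
    case (4 b) then show ?case using assms(3) by (auto simp: PiE_def Pi_def extensional_def split: if_splits)
  next
    case (5 k)
    have c1: "pseudo_coeff s U T (restrict k U) = (\<Prod>u\<in>U. rounding_coeff s (u \<in> T \<union> T') (k u))"
      unfolding pseudo_coeff_def using assms by (intro prod.cong) (auto intro!: arg_cong[where f="\<lambda>\<tau>. rounding_coeff s \<tau> _"])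
    have c2: "pseudo_coeff s U' T' (restrict k U') = (\<Prod>u\<in>U'. rounding_coeff s (u \<in> T \<union> T') (k u))"
      unfolding pseudo_coeff_def using assms by (intro prod.cong) (auto intro!: arg_cong[where f="\<lambda>\<tau>. rounding_coeff s \<tau> _"])
    have q1: "quad K U (\<lambda>u. real_of_int (restrict k U u)) = quad K U (\<lambda>u. real_of_int (k u))"
      by (rule quad_cong) auto
    have q2: "quad K U' (\<lambda>u. real_of_int (restrict k U' u)) = quad K U' (\<lambda>u. real_of_int (k u))"
      by (rule quad_cong) auto
    have q: "quad K (U \<union> U') z = quad K U z + quad K U' z" for z
      using assms by (simp add: quad_def sum.union_disjoint sum.distrib)
    show ?case
      unfolding case_prod_conv c1 c2 q1 q2
      unfolding pseudo_coeff_def q prod.union_disjoint[OF assms(1-3)] add_divide_distrib minus_add_distrib exp_add of_real_mult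
      by (simp only: mult_ac)
  qed
  also have "\<dots> = pseudo_probc s D K U T * pseudo_probc s D K U' T'"
    unfolding pseudo_probc_def sum_product sum.cartesian_product ..
  finally show ?thesis
    using assms(1,2) by (simp add: pseudo_probc_real flip: of_real_mult)
qed

text \<open>This is \<open>(1 - E (p (X i) * p (X j))) / 2\<close>; the minus sign cancels against
  the square of the factor \<open>- \<i>\<close> in the sine coefficients.\<close>

lemma pseudo_prob_pair:
  assumes "i \<noteq> j" "K j i = K i j"
  shows "pseudo_prob s D K {i, j} {i} + pseudo_prob s D K {i, j} {j} =
    (1 + (\<Sum>k\<in>{-D..D}. \<Sum>l\<in>{-D..D}. s k * s l *
        exp (- ((K i i * (real_of_int k)\<^sup>2 + K j j * (real_of_int l)\<^sup>2 + 2 * K i j * real_of_int k * real_of_int l) / 2)))) / 2"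
proof -
  let ?e = "\<lambda>k l::int. exp (- ((K i i * (real_of_int k)\<^sup>2 + K j j * (real_of_int l)\<^sup>2 + 2 * K i j * real_of_int k * real_of_int l) / 2))"
  have two: "(\<Sum>k\<in>PiE {i, j} (\<lambda>_. {-D..D}). g k) =
      (\<Sum>k\<in>{-D..D}. \<Sum>l\<in>{-D..D}. g ((\<lambda>_. undefined)(j := l, i := k)))" for g :: "_ \<Rightarrow> complex"
  proof -
    have "(\<Sum>k\<in>PiE {i, j} (\<lambda>_. {-D..D}). g k) = (\<Sum>y\<in>{-D..D}. \<Sum>k\<in>PiE {j} (\<lambda>_. {-D..D}). g (k(i := y)))"
      using assms(1) by (intro sum_PiE_insert) auto
    also have "\<dots> = (\<Sum>k\<in>{-D..D}. \<Sum>l\<in>{-D..D}. g ((\<lambda>_. undefined)(j := l, i := k)))"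
      by (intro sum.cong refl) (subst sum_PiE_insert, simp, simp add: fun_upd_def)
    finally show ?thesis .
  qed
  have q: "quad K {i, j} (\<lambda>u. real_of_int (((\<lambda>_. undefined)(j := l, i := k)) u)) =
      K i i * (real_of_int k)\<^sup>2 + K j j * (real_of_int l)\<^sup>2 + 2 * K i j * real_of_int k * real_of_int l" for k l
    using assms by (simp add: quad_def power2_eq_square algebra_simps)
  have c: "pseudo_coeff s {i, j} {i} ((\<lambda>_. undefined)(j := l, i := k)) +
     pseudo_coeff s {i, j} {j} ((\<lambda>_. undefined)(j := l, i := k)) =
      (of_bool (k = 0) * of_bool (l = 0) + of_real (s k * s l)) / 2" for k l
    using assms(1) by (simp add: pseudo_coeff_def rounding_coeff_def field_simps)
  have "pseudo_probc s D K {i, j} {i} + pseudo_probc s D K {i, j} {j} =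
      (\<Sum>k\<in>{-D..D}. \<Sum>l\<in>{-D..D}. (of_bool (k = 0) * of_bool (l = 0) + of_real (s k * s l)) / 2 * of_real (?e k l))"
    unfolding pseudo_probc_def two q sum.distrib[symmetric] distrib_right[symmetric] c ..
  also have "\<dots> = (\<Sum>k\<in>{-D..D}. \<Sum>l\<in>{-D..D}. of_bool (k = 0) * (of_bool (l = 0) * of_real (?e k l)) / 2)
      + (\<Sum>k\<in>{-D..D}. \<Sum>l\<in>{-D..D}. of_real (s k * s l * ?e k l) / 2)"
    unfolding sum.distrib[symmetric] by (intro sum.cong refl) (simp add: field_simps)
  also have "(\<Sum>k\<in>{-D..D}. \<Sum>l\<in>{-D..D}. of_bool (k = 0) * (of_bool (l = 0) * complex_of_real (?e k l)) / 2) = 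
     (\<Sum>k\<in>{-D..D}. if k = 0 then (\<Sum>l\<in>{-D..D}. if l = 0 then 1 / 2 else 0) else 0)"
  proof (intro sum.cong refl)
    fix k :: int assume "k \<in> {-D..D}"
    show "(\<Sum>l\<in>{-D..D}. of_bool (k = 0) * (of_bool (l = 0) * complex_of_real (?e k l)) / 2) =
       (if k = 0 then (\<Sum>l\<in>{-D..D}. if l = 0 then 1 / 2 else 0) else 0)"
    proof (cases "k = 0")
      case True
      show ?thesis unfolding True if_P[OF refl] by (intro sum.cong refl) auto
    qed simp
  qed
  also have "\<dots> = 1 / 2" using D by simp
  also have "1 / 2 + (\<Sum>k\<in>{-D..D}. \<Sum>l\<in>{-D..D}. complex_of_real (s k * s l * ?e k l) / 2) = 
     complex_of_real ((1 + (\<Sum>k\<in>{-D..D}. \<Sum>l\<in>{-D..D}. s k * s l * ?e k l)) / 2)"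
    unfolding of_real_divide of_real_add of_real_sum by (simp only: sum_divide_distrib add_divide_distrib of_real_1 of_real_numeral)
  finally have e: "pseudo_probc s D K {i, j} {i} + pseudo_probc s D K {i, j} {j} = \<dots>" .
  show ?thesis unfolding pseudo_prob_def plus_complex.sel(1)[symmetric] e Re_complex_of_real ..
qed

text \<open>For \<open>\<kappa>\<close> close to 1, \<open>X j\<close> is almost
  \<open>- X i\<close>. Then the terms with \<open>k = l\<close> have exponents near 0 and recover
  the mean square of the rounding function, while a large variance \<open>a\<^sup>2\<close> damps
  all other terms.\<close>

lemma pseudo_prob_cut_ge:
  assumes "i \<noteq> j" "K i i = a\<^sup>2" "K j j = a\<^sup>2" "K i j = - (a\<^sup>2 * \<kappa>)" "K j i = K i j" "0 \<le> \<kappa>" "\<kappa> \<le> 1"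
  shows "pseudo_prob s D K {i, j} {i} + pseudo_prob s D K {i, j} {j} \<ge>
    (1 + (\<Sum>k\<in>{-D..D}. (s k)\<^sup>2) * exp (- (a\<^sup>2 * D\<^sup>2 * (1 - \<kappa>))) - (\<Sum>k\<in>{-D..D}. \<bar>s k\<bar>)\<^sup>2 * exp (- (a\<^sup>2 / 2))) / 2"
proof -
  let ?A = "{-D..D}"
  let ?e = "\<lambda>k l::int. exp (- ((a\<^sup>2 * k\<^sup>2 + a\<^sup>2 * l\<^sup>2 - 2 * a\<^sup>2 * \<kappa> * k * l) / 2))"
  let ?E1 = "exp (- (a\<^sup>2 * D\<^sup>2 * (1 - \<kappa>)))" and ?E2 = "exp (- (a\<^sup>2 / 2))"
  have pt: "s k * s l * ?e k l \<ge> of_bool (k = l) * ((s k)\<^sup>2 * ?E1) - \<bar>s k\<bar> * \<bar>s l\<bar> * ?E2"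
    if "k \<in> ?A" "l \<in> ?A" for k l
  proof (cases "k = l")
    case True
    have "real_of_int (k\<^sup>2) \<le> real_of_int (D\<^sup>2)"
      using that(1) by (simp only: of_int_le_iff abs_le_square_iff[symmetric]) auto
    then have "a\<^sup>2 * k\<^sup>2 * (1 - \<kappa>) \<le> a\<^sup>2 * D\<^sup>2 * (1 - \<kappa>)"
      using assms by (intro mult_right_mono mult_left_mono) auto
    moreover have "(a\<^sup>2 * k\<^sup>2 + a\<^sup>2 * k\<^sup>2 - 2 * a\<^sup>2 * \<kappa> * k * k) / 2 = a\<^sup>2 * k\<^sup>2 * (1 - \<kappa>)"
      by (simp add: power2_eq_square field_simps)
    ultimately have "?E1 \<le> ?e k k" by simp
    then have "(s k)\<^sup>2 * ?E1 \<le> (s k)\<^sup>2 * ?e k k" by (intro mult_left_mono) auto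
    moreover have "0 \<le> \<bar>s k\<bar> * \<bar>s k\<bar> * ?E2" by simp
    moreover have "s k * s k * ?e k k = (s k)\<^sup>2 * ?e k k" by (simp only: power2_eq_square[of "s k"])
    ultimately have "(s k)\<^sup>2 * ?E1 - \<bar>s k\<bar> * \<bar>s k\<bar> * ?E2 \<le> s k * s k * ?e k k" by linarith
    then show ?thesis unfolding True[symmetric] by (simp only: simp_thms of_bool_eq mult_1)
  next
    case False
    have "0 < (k - l)\<^sup>2" using False by simp
    then have "real_of_int 1 \<le> real_of_int ((k - l)\<^sup>2)" by (subst of_int_le_iff) linarith
    then have k1: "1 \<le> (real_of_int k - real_of_int l)\<^sup>2" by simp
    have "0 < k\<^sup>2 + l\<^sup>2" using False by (auto simp: sum_power2_gt_zero_iff)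
    then have "real_of_int 1 \<le> real_of_int (k\<^sup>2 + l\<^sup>2)" by (subst of_int_le_iff) linarith
    then have k2: "1 \<le> (real_of_int k)\<^sup>2 + (real_of_int l)\<^sup>2" by simp
    \<comment> \<open>Up to the factor \<open>a\<^sup>2\<close>, the form is a convex combination of
      the square of \<open>k - l\<close> and of the sum of the two squares; both are at least 1 for
      distinct integers.\<close>
    have "1 = \<kappa> * 1 + (1 - \<kappa>) * 1" by simp
    also have "\<dots> \<le> \<kappa> * (real_of_int k - real_of_int l)\<^sup>2 + (1 - \<kappa>) * ((real_of_int k)\<^sup>2 + (real_of_int l)\<^sup>2)"
      using k1 k2 assms by (intro add_mono mult_left_mono) auto
    finally have "a\<^sup>2 * 1 \<le> a\<^sup>2 * \<dots>" by (intro mult_left_mono) auto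
    also have "\<dots> = a\<^sup>2 * k\<^sup>2 + a\<^sup>2 * l\<^sup>2 - 2 * a\<^sup>2 * \<kappa> * k * l"
      by (simp add: power2_eq_square algebra_simps)
    finally have "?e k l \<le> ?E2" by simp
    then have "\<bar>s k * s l\<bar> * ?e k l \<le> \<bar>s k * s l\<bar> * ?E2" by (intro mult_left_mono) auto
    moreover have "- (\<bar>s k * s l\<bar> * ?e k l) \<le> s k * s l * ?e k l"
      using mult_right_mono[of "- \<bar>s k * s l\<bar>" "s k * s l" "?e k l"] by simp
    ultimately show ?thesis using False by (simp add: abs_mult)
  qed
  have "(\<Sum>k\<in>?A. \<Sum>l\<in>?A. of_bool (k = l) * ((s k)\<^sup>2 * ?E1) - \<bar>s k\<bar> * \<bar>s l\<bar> * ?E2) \<le>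
     (\<Sum>k\<in>?A. \<Sum>l\<in>?A. s k * s l * ?e k l)"
    by (intro sum_mono pt)
  moreover have "(\<Sum>k\<in>?A. \<Sum>l\<in>?A. of_bool (k = l) * ((s k)\<^sup>2 * ?E1) - \<bar>s k\<bar> * \<bar>s l\<bar> * ?E2) =
     (\<Sum>k\<in>?A. (s k)\<^sup>2) * ?E1 - (\<Sum>k\<in>?A. \<bar>s k\<bar>)\<^sup>2 * ?E2"
  proof -
    have "(\<Sum>l\<in>?A. of_bool (k = l) * ((s k)\<^sup>2 * ?E1)) = (s k)\<^sup>2 * ?E1" if "k \<in> ?A" for k
    proof -
      have "(\<Sum>l\<in>?A. of_bool (k = l) * ((s k)\<^sup>2 * ?E1)) = (\<Sum>l\<in>?A. if l = k then (s k)\<^sup>2 * ?E1 else 0)"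
        by (intro sum.cong) auto
      then show ?thesis using that by simp
    qed
    moreover have "(\<Sum>k\<in>?A. \<Sum>l\<in>?A. \<bar>s k\<bar> * \<bar>s l\<bar> * ?E2) = (\<Sum>k\<in>?A. \<bar>s k\<bar>)\<^sup>2 * ?E2"
      unfolding power2_eq_square sum_product unfolding sum_distrib_right ..
    ultimately show ?thesis by (simp add: sum_subtractf sum_distrib_right)
  qed
  ultimately show ?thesis
    unfolding pseudo_prob_pair[of i j K, OF assms(1,5)] using assms by (simp add: algebra_simps)
qed

end

section \<open>Odd trigonometric polynomials close to a square wave\<close>

definition trig_poly :: "(real \<Rightarrow> complex) \<Rightarrow> bool" where
  "trig_poly f \<longleftrightarrow> (\<exists>F c. finite F \<and> (\<forall>x. f x = (\<Sum>k\<in>F. c k * cis (real_of_int k * x))))"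

lemma trig_poly_of_sum:
  assumes "finite I"
  shows "trig_poly (\<lambda>x. \<Sum>i\<in>I. c i * cis (real_of_int (n i) * x))"
  unfolding trig_poly_def
proof (intro exI conjI allI)
  show "finite (n ` I)" using assms by simp
  fix x
  have "(\<Sum>i\<in>I. c i * cis (real_of_int (n i) * x)) = (\<Sum>k\<in>n ` I. \<Sum>i\<in>{i\<in>I. n i = k}. c i * cis (real_of_int (n i) * x))"
    by (rule sum.image_gen[OF assms])
  also have "\<dots> = (\<Sum>k\<in>n ` I. (\<Sum>i\<in>{i\<in>I. n i = k}. c i) * cis (real_of_int k * x))"
    by (intro sum.cong refl) (auto simp: sum_distrib_right)
  finally show "(\<Sum>i\<in>I. c i * cis (real_of_int (n i) * x)) = \<dots>" .
qed

lemma trig_poly_mult: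
  assumes "trig_poly f" "trig_poly g"
  shows "trig_poly (\<lambda>x. f x * g x)"
proof -
  obtain F c G d where f: "finite F" "\<And>x. f x = (\<Sum>k\<in>F. c k * cis (real_of_int k * x))"
    and g: "finite G" "\<And>x. g x = (\<Sum>k\<in>G. d k * cis (real_of_int k * x))"
    using assms unfolding trig_poly_def by (elim exE conjE) blast
  have e: "f x * g x = (\<Sum>i\<in>F\<times>G. (c (fst i) * d (snd i)) * cis (real_of_int (fst i + snd i) * x))" for x
    unfolding f g sum_product sum.cartesian_product
    by (intro sum.cong refl) (auto simp: cis_mult[symmetric] distrib_right)
  show ?thesis unfolding e by (rule trig_poly_of_sum) (use f g in auto)
qed

lemma trig_poly_add:
  assumes "trig_poly f" "trig_poly g"
  shows "trig_poly (\<lambda>x. f x + g x)"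
proof -
  obtain F c G d where f: "finite F" "\<And>x. f x = (\<Sum>k\<in>F. c k * cis (real_of_int k * x))"
    and g: "finite G" "\<And>x. g x = (\<Sum>k\<in>G. d k * cis (real_of_int k * x))"
    using assms unfolding trig_poly_def by (elim exE conjE) blast
  have e: "f x + g x = (\<Sum>i\<in>F <+> G. case_sum c d i * cis (real_of_int (case_sum id id i) * x))" for x
    unfolding f g using f(1) g(1) by (simp add: sum.Plus)
  show ?thesis unfolding e by (rule trig_poly_of_sum) (use f g in auto)
qed

lemma trig_poly_cmult:
  assumes "trig_poly f"
  shows "trig_poly (\<lambda>x. a * f x)"
proof -
  obtain F c where f: "finite F" "\<And>x. f x = (\<Sum>k\<in>F. c k * cis (real_of_int k * x))"
    using assms unfolding trig_poly_def by (elim exE conjE) blast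
  show ?thesis unfolding trig_poly_def
    by (rule exI[of _ F], rule exI[of _ "\<lambda>k. a * c k"]) (auto simp: f sum_distrib_left mult.assoc)
qed

lemma trig_poly_sin: "trig_poly (\<lambda>x. of_real (sin x))"
  unfolding trig_poly_def
  by (rule exI[of _ "{-1, 1}"], rule exI[of _ "\<lambda>k. if k = 1 then - \<i> / 2 else \<i> / 2"])
    (auto simp: complex_eq_iff)

text \<open>This cubic fixes -1, 0 and 1 and moves every other value in between towards its sign.
  Being a polynomial, it keeps iterates started at the sine among the trigonometric
  polynomials.\<close>

definition smooth_step :: "real \<Rightarrow> real" where
  "smooth_step t = (3 * t - t ^ 3) / 2"

lemma smooth_step_odd: "smooth_step (- t) = - smooth_step t"
  by (simp add: smooth_step_def field_simps)

lemma smooth_step_bounds: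
  assumes "0 \<le> t" "t \<le> 1"
  shows "t \<le> smooth_step t" "smooth_step t \<le> 1" "1 - smooth_step t \<le> (1 - t) * (1 - t / 2)"
proof -
  have t2: "t\<^sup>2 \<le> 1" using assms by (simp add: power_le_one)
  have "smooth_step t - t = t * (1 - t\<^sup>2) / 2" by (simp add: smooth_step_def power2_eq_square power3_eq_cube field_simps)
  also have "\<dots> \<ge> 0" using t2 assms by simp
  finally show "t \<le> smooth_step t" by simp
  have "1 - smooth_step t = (1 - t)\<^sup>2 * (2 + t) / 2"
    by (simp add: smooth_step_def power2_eq_square power3_eq_cube field_simps)
  also have "\<dots> \<ge> 0" using assms by simp
  finally show "smooth_step t \<le> 1" by simp
  have "(1 - t) * (1 - t / 2) - (1 - smooth_step t) = (1 - t) * t\<^sup>2 / 2"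
    by (simp add: smooth_step_def power2_eq_square power3_eq_cube field_simps)
  also have "\<dots> \<ge> 0" using assms by simp
  finally show "1 - smooth_step t \<le> (1 - t) * (1 - t / 2)" by simp
qed

text \<open>The iterates never fall below \<open>t\<close>, so each step shrinks the distance to 1
  by at least the factor \<open>1 - t / 2\<close>.\<close>

lemma smooth_step_iter_bounds:
  assumes "0 \<le> t" "t \<le> 1"
  shows "t \<le> (smooth_step ^^ j) t \<and> (smooth_step ^^ j) t \<le> 1 \<and> 1 - (smooth_step ^^ j) t \<le> (1 - t / 2) ^ j"
proof (induction j)
  case 0
  then show ?case using assms by simp
next
  case (Suc j)
  let ?u = "(smooth_step ^^ j) t"
  have u: "t \<le> ?u" "?u \<le> 1" "1 - ?u \<le> (1 - t / 2) ^ j" "0 \<le> ?u" using Suc assms by auto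
  have "1 - smooth_step ?u \<le> (1 - ?u) * (1 - ?u / 2)" using smooth_step_bounds u by auto
  also have "\<dots> \<le> (1 - t / 2) ^ j * (1 - t / 2)" using u assms by (intro mult_mono) auto
  finally show ?case using smooth_step_bounds[of ?u] u by (auto simp: mult.commute)
qed

lemma smooth_step_iter_odd: "(smooth_step ^^ j) (- t) = - (smooth_step ^^ j) t"
  by (induction j) (auto simp: smooth_step_odd)

lemma smooth_step_iter_abs:
  assumes "\<bar>t\<bar> \<le> 1"
  shows "\<bar>(smooth_step ^^ j) t\<bar> = (smooth_step ^^ j) \<bar>t\<bar>"
proof (cases "t \<ge> 0")
  case True
  then show ?thesis using smooth_step_iter_bounds[of t j] assms by simp
next
  case False
  then show ?thesis using smooth_step_iter_bounds[of "-t" j] assms by (simp add: smooth_step_iter_odd)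
qed

definition square_wave :: "nat \<Rightarrow> real \<Rightarrow> real" where
  "square_wave j x = (smooth_step ^^ j) (sin x)"

lemma abs_square_wave_le: "\<bar>square_wave j x\<bar> \<le> 1"
  using smooth_step_iter_bounds[of "\<bar>sin x\<bar>" j] smooth_step_iter_abs[of "sin x" j]
  by (simp add: square_wave_def)

lemma square_wave_odd: "square_wave j (- x) = - square_wave j x"
  by (simp add: square_wave_def smooth_step_iter_odd)

lemma trig_poly_square_wave: "trig_poly (\<lambda>x. of_real (square_wave j x))"
proof (induction j)
  case 0
  then show ?case using trig_poly_sin by (simp add: square_wave_def)
next
  case (Suc j)
  let ?f = "\<lambda>x. complex_of_real (square_wave j x)"
  have "of_real (square_wave (Suc j) x) = (3 / 2) * ?f x + (- 1 / 2) * (?f x * (?f x * ?f x))" for x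
    by (simp add: square_wave_def smooth_step_def power3_eq_cube field_simps)
  moreover have "trig_poly (\<lambda>x. (3 / 2) * ?f x + (- 1 / 2) * (?f x * (?f x * ?f x)))"
    by (intro trig_poly_add trig_poly_cmult trig_poly_mult Suc)
  ultimately show ?case by simp
qed

lemma square_wave_sine_poly:
  "\<exists>D s. 0 \<le> D \<and> (\<forall>k. s (- k) = - s k) \<and> (\<forall>x. square_wave j x = (\<Sum>k\<in>{-D..D}. s k * sin (real_of_int k * x)))"
proof -
  obtain F c where F: "finite F" "\<And>x. complex_of_real (square_wave j x) = (\<Sum>k\<in>F. c k * cis (real_of_int k * x))"
    using trig_poly_square_wave[of j] unfolding trig_poly_def by (elim exE conjE) blast
  \<comment> \<open>The sum dominates every frequency in \<open>F\<close> and makes sense for empty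
    \<open>F\<close> too.\<close>
  define D where "D = (\<Sum>k\<in>F. \<bar>k\<bar>)"
  have D: "0 \<le> D" unfolding D_def by (rule sum_nonneg) auto
  have FD: "F \<subseteq> {-D..D}"
  proof
    fix k assume "k \<in> F"
    then have "\<bar>k\<bar> \<le> D" unfolding D_def by (intro member_le_sum F) auto
    then show "k \<in> {-D..D}" by auto
  qed
  define c' where "c' k = (if k \<in> F then c k else 0)" for k
  have F': "complex_of_real (square_wave j x) = (\<Sum>k\<in>{-D..D}. c' k * cis (real_of_int k * x))" for x
    unfolding F(2) c'_def by (rule sum.mono_neutral_cong_left) (use FD in auto)
  \<comment> \<open>In \<open>square_wave j x - square_wave j (- x)\<close> the cosines cancel;
    averaging the sine coefficients over \<open>k\<close> and \<open>- k\<close> makes them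
    odd.\<close>
  define s where "s k = (Im (c' (- k)) - Im (c' k)) / 2" for k
  have "square_wave j x = (\<Sum>k\<in>{-D..D}. s k * sin (real_of_int k * x))" for x
  proof -
    have r: "square_wave j y = (\<Sum>k\<in>{-D..D}. Re (c' k) * cos (real_of_int k * y) - Im (c' k) * sin (real_of_int k * y))" for y
      using arg_cong[OF F'[of y], of Re] by simp
    have "2 * square_wave j x = square_wave j x - square_wave j (- x)"
      by (simp add: square_wave_odd)
    also have "\<dots> = (\<Sum>k\<in>{-D..D}. - Im (c' k) * sin (real_of_int k * x)) + (\<Sum>k\<in>{-D..D}. - Im (c' k) * sin (real_of_int k * x))"
      unfolding r sum_subtractf[symmetric] sum.distrib[symmetric] by (intro sum.cong) auto
    also have "\<dots> = (\<Sum>k\<in>{-D..D}. Im (c' (- k)) * sin (real_of_int k * x)) + (\<Sum>k\<in>{-D..D}. - Im (c' k) * sin (real_of_int k * x))"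
      by (intro arg_cong2[where f = "(+)"] refl sum.reindex_bij_witness[of _ uminus uminus]) auto
    also have "\<dots> = 2 * (\<Sum>k\<in>{-D..D}. s k * sin (real_of_int k * x))"
      unfolding sum_distrib_left sum.distrib[symmetric] by (intro sum.cong) (auto simp: s_def field_simps)
    finally show ?thesis by simp
  qed
  moreover have "s (- k) = - s k" for k by (simp add: s_def field_simps)
  ultimately show ?thesis using D by blast
qed

lemma integral_cos_period:
  fixes m :: int
  shows "((\<lambda>x. cos (real_of_int m * x)) has_integral (if m = 0 then 2 * pi else 0)) {0..2 * pi}"
proof (cases "m = 0")
  case True
  then show ?thesis using has_integral_const_real[of "1::real" 0 "2 * pi"] by simp
next
  case False
  have "((\<lambda>x. cos (real_of_int m * x)) has_integral
      (sin (real_of_int m * (2 * pi)) / real_of_int m - sin (real_of_int m * 0) / real_of_int m)) {0..2 * pi}"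
    using False
    by (intro fundamental_theorem_of_calculus)
      (auto intro!: derivative_eq_intros simp: has_real_derivative_iff_has_vector_derivative[symmetric])
  moreover have "sin (real_of_int m * (2 * pi)) = 0"
    using sin_integer_2pi[of "of_int m"] by (simp add: mult_ac)
  ultimately show ?thesis using False by simp
qed

text \<open>By orthogonality only \<open>l = k\<close> and \<open>l = - k\<close> survive, and for
  odd \<open>s\<close> they contribute equally.\<close>

lemma sine_poly_parseval:
  fixes s :: "int \<Rightarrow> real"
  assumes odd: "\<And>k. s (- k) = - s k"
  shows "((\<lambda>x. (\<Sum>k\<in>{-D..D}. s k * sin (real_of_int k * x))\<^sup>2) has_integral (2 * pi * (\<Sum>k\<in>{-D..D}. (s k)\<^sup>2))) {0..2 * pi}"
proof -
  have e: "(\<Sum>k\<in>{-D..D}. s k * sin (real_of_int k * x))\<^sup>2 =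
     (\<Sum>k\<in>{-D..D}. \<Sum>l\<in>{-D..D}. s k * s l / 2 * (cos (real_of_int (k - l) * x) - cos (real_of_int (k + l) * x)))" for x
    unfolding power2_eq_square sum_product
    by (intro sum.cong refl) (simp add: cos_add cos_diff distrib_right left_diff_distrib)
  have s1: "(\<Sum>l\<in>{-D..D}. s k * s l / 2 * ((if k - l = 0 then 2 * pi else 0) - (if k + l = 0 then 2 * pi else 0))) =
     2 * pi * (s k)\<^sup>2" if k: "k \<in> {-D..D}" for k
  proof -
    have "(\<Sum>l\<in>{-D..D}. s k * s l / 2 * ((if k - l = 0 then 2 * pi else 0) - (if k + l = 0 then 2 * pi else 0))) =
       (\<Sum>l\<in>{-D..D}. (if l = k then pi * (s k)\<^sup>2 else 0) + (if l = - k then pi * (s k)\<^sup>2 else 0))"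
      by (intro sum.cong refl) (use odd[of k] odd[of 0] in \<open>auto simp: power2_eq_square\<close>)
    also have "\<dots> = 2 * pi * (s k)\<^sup>2"
      unfolding sum.distrib using k by simp
    finally show ?thesis .
  qed
  have "((\<lambda>x. \<Sum>k\<in>{-D..D}. \<Sum>l\<in>{-D..D}. s k * s l / 2 * (cos (real_of_int (k - l) * x) - cos (real_of_int (k + l) * x))) has_integral
     (\<Sum>k\<in>{-D..D}. \<Sum>l\<in>{-D..D}. s k * s l / 2 * ((if k - l = 0 then 2 * pi else 0) - (if k + l = 0 then 2 * pi else 0)))) {0..2 * pi}"
    by (intro has_integral_sum finite_atLeastAtMost_int has_integral_mult_right has_integral_diff integral_cos_period)
  also have "(\<Sum>k\<in>{-D..D}. \<Sum>l\<in>{-D..D}. s k * s l / 2 * ((if k - l = 0 then 2 * pi else 0) - (if k + l = 0 then 2 * pi else 0)))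
     = 2 * pi * (\<Sum>k\<in>{-D..D}. (s k)\<^sup>2)"
    unfolding sum_distrib_left by (intro sum.cong refl s1)
  finally show ?thesis unfolding e .
qed

lemma square_wave_mean_square_tendsto:
  "(\<lambda>j. integral {0..2 * pi} (\<lambda>x. (square_wave j x)\<^sup>2)) \<longlonglongrightarrow> 2 * pi"
proof -
  let ?g = "\<lambda>x::real. if sin x = 0 then 0 else 1 :: real"
  have int: "(\<lambda>x. (square_wave j x)\<^sup>2) integrable_on {0..2 * pi}" for j
  proof -
    obtain D s where Ds: "\<And>k. s (- k) = - s k" "\<And>x. square_wave j x = (\<Sum>k\<in>{-D..D}. s k * sin (real_of_int k * x))"
      using square_wave_sine_poly[of j] by metis
    show ?thesis unfolding Ds(2) using sine_poly_parseval[of s D, OF Ds(1)] by blast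
  qed
  have "(\<lambda>j. integral {0..2 * pi} (\<lambda>x. (square_wave j x)\<^sup>2)) \<longlonglongrightarrow> integral {0..2 * pi} ?g"
  proof (rule dominated_convergence(2)[where h="\<lambda>_. 1"])
    show "(\<lambda>x. (square_wave j x)\<^sup>2) integrable_on {0..2 * pi}" for j by (rule int)
    show "norm ((square_wave j x)\<^sup>2) \<le> 1" for j x
      using abs_square_wave_le[of j x] by (simp add: abs_square_le_1)
    show "(\<lambda>j. (square_wave j x)\<^sup>2) \<longlonglongrightarrow> ?g x" for x
    proof (cases "sin x = 0")
      case True
      have "square_wave j x = 0" for j
        unfolding square_wave_def True by (induction j) (auto simp: smooth_step_def)
      then show ?thesis using True by simp
    next
      case False
      let ?t = "\<bar>sin x\<bar>"
      have t: "0 < ?t" "?t \<le> 1" using False by auto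
      have "(\<lambda>j. 1 - (1 - ?t / 2) ^ j) \<longlonglongrightarrow> 1 - 0"
      proof (intro tendsto_diff tendsto_const LIMSEQ_power_zero)
        have "norm (1 - u / 2) < 1" if "0 < u" "u \<le> 1" for u :: real
          using that by auto
        then show "norm (1 - ?t / 2) < 1" using t .
      qed
      then have lim: "(\<lambda>j. 1 - (1 - ?t / 2) ^ j) \<longlonglongrightarrow> 1" by simp
      have lb: "1 - (1 - ?t / 2) ^ j \<le> \<bar>square_wave j x\<bar>" for j
      proof -
        have "1 - (smooth_step ^^ j) ?t \<le> (1 - ?t / 2) ^ j"
          using smooth_step_iter_bounds[OF abs_ge_zero t(2), of j] by (elim conjE)
        then show ?thesis
          unfolding square_wave_def smooth_step_iter_abs[OF t(2)] by linarith
      qed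
      have "(\<lambda>j. \<bar>square_wave j x\<bar>) \<longlonglongrightarrow> 1"
        by (rule tendsto_sandwich[OF _ _ lim tendsto_const]) (auto simp: lb abs_square_wave_le)
      from tendsto_power[OF this, of 2] show ?thesis using False by simp
    qed
  qed auto
  moreover have "(?g has_integral 2 * pi) {0..2 * pi}"
  proof (rule has_integral_spike_finite[of "{0, pi, 2 * pi}" _ _ "\<lambda>_. 1"])
    fix x assume x: "x \<in> {0..2 * pi} - {0, pi, 2 * pi}"
    then have "0 < x" "x \<noteq> pi" "x < 2 * pi" by auto
    then have "sin x \<noteq> 0"
      using sin_gt_zero[of x] sin_lt_zero[of x] by (cases "x < pi") force+
    then show "?g x = 1" by (rule if_not_P)
  qed (use has_integral_const_real[of "1::real" 0 "2 * pi"] in auto)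
  ultimately show ?thesis by (simp only: integral_unique)
qed

text \<open>By Parseval the sum of squares is the mean square over a period, which tends to 1 along
  the square waves.\<close>

lemma sine_poly_exists:
  fixes \<epsilon> :: real
  assumes "\<epsilon> > 0"
  shows "\<exists>D s. 0 \<le> D \<and> (\<forall>k. s (- k) = - s k) \<and> (\<forall>x. \<bar>\<Sum>k\<in>{-D..D}. s k * sin (real_of_int k * x)\<bar> \<le> 1) \<and>
     (\<Sum>k\<in>{-D..D}. (s k)\<^sup>2) \<ge> 1 - \<epsilon>"
proof -
  have "\<forall>\<^sub>F j in sequentially. integral {0..2 * pi} (\<lambda>x. (square_wave j x)\<^sup>2) > 2 * pi * (1 - \<epsilon>)"
    by (rule order_tendstoD(1)[OF square_wave_mean_square_tendsto]) (use assms in simp)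
  then obtain j where j: "integral {0..2 * pi} (\<lambda>x. (square_wave j x)\<^sup>2) > 2 * pi * (1 - \<epsilon>)"
    unfolding eventually_sequentially by blast
  obtain D s where Ds: "0 \<le> D" "\<And>k. s (- k) = - s k" "\<And>x. square_wave j x = (\<Sum>k\<in>{-D..D}. s k * sin (real_of_int k * x))"
    using square_wave_sine_poly[of j] by metis
  have "2 * pi * (1 - \<epsilon>) < 2 * pi * (\<Sum>k\<in>{-D..D}. (s k)\<^sup>2)"
    using j integral_unique[OF sine_poly_parseval[of s D, OF Ds(2)]] unfolding Ds(3) by simp
  then have "1 - \<epsilon> < (\<Sum>k\<in>{-D..D}. (s k)\<^sup>2)"
    by (simp only: mult_less_cancel_left_pos[OF pi_gt_zero] mult.assoc) simp
  moreover have "\<bar>\<Sum>k\<in>{-D..D}. s k * sin (real_of_int k * x)\<bar> \<le> 1" for x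
    using abs_square_wave_le[of j x] unfolding Ds(3) .
  ultimately show ?thesis using Ds(1,2) by (intro exI[of _ D] exI[of _ s]) auto
qed

section \<open>Non-backtracking walks in graphs of high girth\<close>

text \<open>Walks are stored with their last vertex first.\<close>

fun nb_walk :: "('a \<Rightarrow> 'a \<Rightarrow> bool) \<Rightarrow> 'a list \<Rightarrow> bool" where
  "nb_walk r [] = False"
| "nb_walk r [x] = True"
| "nb_walk r [x, y] = r x y"
| "nb_walk r (x # y # z # p) = (r x y \<and> x \<noteq> z \<and> nb_walk r (y # z # p))"

definition nb_walks :: "('a \<Rightarrow> 'a \<Rightarrow> bool) \<Rightarrow> 'a set \<Rightarrow> nat \<Rightarrow> 'a \<Rightarrow> 'a \<Rightarrow> 'a list set" where
  "nb_walks r C k u v = {p. set p \<subseteq> C \<and> length p = Suc k \<and> last p = u \<and> hd p = v \<and> nb_walk r p}"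

lemma nb_walk_tl: "nb_walk r (x # p) \<Longrightarrow> p \<noteq> [] \<Longrightarrow> nb_walk r p"
  by (cases p; cases "tl p") auto

lemma nb_walk_hd: "nb_walk r (x # y # p) \<Longrightarrow> r x y"
  by (cases p) auto

lemma finite_nb_walks: "finite C \<Longrightarrow> finite (nb_walks r C k u v)"
  by (rule finite_subset[OF _ finite_lists_length_eq[of C "Suc k"]]) (auto simp: nb_walks_def)

lemma nb_walks_0: "nb_walks r C 0 u v = (if u = v \<and> u \<in> C then {[u]} else {})"
  by (auto simp: nb_walks_def length_Suc_conv)

lemma nb_walks_1: "nb_walks r C 1 u v = (if r v u \<and> u \<in> C \<and> v \<in> C then {[v, u]} else {})"
  by (auto simp: nb_walks_def length_Suc_conv)

definition nb_count :: "('a \<Rightarrow> 'a \<Rightarrow> bool) \<Rightarrow> 'a set \<Rightarrow> nat \<Rightarrow> 'a \<Rightarrow> 'a \<Rightarrow> real" where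
  "nb_count r C k u v = real (card (nb_walks r C k u v))"

definition nbrs :: "('a \<Rightarrow> 'a \<Rightarrow> bool) \<Rightarrow> 'a set \<Rightarrow> 'a \<Rightarrow> 'a set" where
  "nbrs r C v = {w \<in> C. r w v}"

locale finite_graph =
  fixes r :: "'a \<Rightarrow> 'a \<Rightarrow> bool" and C :: "'a set"
  assumes fin: "finite C" and sym: "\<And>x y. r x y \<Longrightarrow> r y x" and irrefl: "\<And>x. \<not> r x x"
begin

lemma nb_count_0: "u \<in> C \<Longrightarrow> nb_count r C 0 u v = of_bool (u = v)"
  by (auto simp: nb_count_def nb_walks_0)

lemma nb_count_1: "u \<in> C \<Longrightarrow> v \<in> C \<Longrightarrow> nb_count r C 1 u v = of_bool (u \<in> nbrs r C v)"
  by (auto simp: nb_count_def nb_walks_1[unfolded One_nat_def] nbrs_def dest: sym)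

lemma nb_count_nonneg: "0 \<le> nb_count r C k u v" by (simp add: nb_count_def)

lemma finite_nbrs: "finite (nbrs r C v)" using fin by (simp add: nbrs_def)

text \<open>Append \<open>v\<close> to a walk ending at a neighbour \<open>w\<close>. Either the
  result is non-backtracking, or the walk had come to \<open>w\<close> from \<open>v\<close>;
  removing \<open>w\<close> then leaves a shorter walk to \<open>v\<close>, and \<open>w\<close> can
  be any neighbour except its penultimate vertex. For \<open>k = 0\<close> there is no penultimate
  vertex, hence the special case.\<close>

lemma nb_count_step:
  assumes "v \<in> C" "u \<in> C"
  shows "(\<Sum>w\<in>nbrs r C v. nb_count r C (Suc k) u w) =
     nb_count r C (Suc (Suc k)) u v +
     (if k = 0 then of_bool (u = v) * real (card (nbrs r C v)) else nb_count r C k u v * (real (card (nbrs r C v)) - 1))"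
proof -
  let ?W = "SIGMA w:nbrs r C v. nb_walks r C (Suc k) u w"
  have fW: "finite ?W" using finite_nbrs finite_nb_walks[OF fin] by auto
  have "(\<Sum>w\<in>nbrs r C v. nb_count r C (Suc k) u w) = real (card ?W)"
    unfolding nb_count_def by (subst card_SigmaI) (auto simp: finite_nbrs finite_nb_walks[OF fin])
  also have "?W = {x\<in>?W. hd (tl (snd x)) \<noteq> v} \<union> {x\<in>?W. hd (tl (snd x)) = v}" by blast
  also have "card \<dots> = card {x\<in>?W. hd (tl (snd x)) \<noteq> v} + card {x\<in>?W. hd (tl (snd x)) = v}"
    by (rule card_Un_disjoint) (auto intro: finite_subset[OF _ fW])
  also have "card {x\<in>?W. hd (tl (snd x)) \<noteq> v} = card (nb_walks r C (Suc (Suc k)) u v)"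
  proof (rule bij_betw_same_card[of "\<lambda>x. v # snd x"], rule bij_betw_byWitness[where f' = "\<lambda>p. (hd (tl p), tl p)"], goal_cases)
    case 1 then show ?case by (auto simp: nb_walks_def)
  next
    case 2 then show ?case by (auto simp: nb_walks_def length_Suc_conv)
  next
    case 3
    then show ?case
      using assms by (auto simp: nb_walks_def length_Suc_conv nbrs_def dest: sym)
  next
    case 4
    then show ?case
      by (auto simp: nb_walks_def length_Suc_conv nbrs_def dest: sym nb_walk_hd)
  qed
  also have "real (card (nb_walks r C (Suc (Suc k)) u v) + card {x\<in>?W. hd (tl (snd x)) = v}) =
     nb_count r C (Suc (Suc k)) u v + real (card {x\<in>?W. hd (tl (snd x)) = v})"
    by (simp add: nb_count_def)
  also have "real (card {x\<in>?W. hd (tl (snd x)) = v}) =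
    (if k = 0 then of_bool (u = v) * real (card (nbrs r C v)) else nb_count r C k u v * (real (card (nbrs r C v)) - 1))"
  proof (cases k)
    case 0
    have "{x\<in>?W. hd (tl (snd x)) = v} = (if u = v then (\<lambda>w. (w, [w, v])) ` nbrs r C v else {})"
      using assms by (auto simp: 0 nb_walks_def length_Suc_conv nbrs_def)
    moreover have "card ((\<lambda>w. (w, [w, v])) ` nbrs r C v) = card (nbrs r C v)"
      by (rule card_image) (auto simp: inj_on_def)
    ultimately show ?thesis using 0 by simp
  next
    case (Suc j)
    let ?Z = "SIGMA p:nb_walks r C k u v. nbrs r C v - {hd (tl p)}"
    have "card {x\<in>?W. hd (tl (snd x)) = v} = card ?Z"
    proof (rule bij_betw_same_card[of "\<lambda>x. (tl (snd x), fst x)"], rule bij_betw_byWitness[where f' = "\<lambda>x. (snd x, snd x # fst x)"], goal_cases)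
      case 1 then show ?case by (auto simp: nb_walks_def length_Suc_conv)
    next
      case 2 then show ?case by auto
    next
      case 3 then show ?case by (auto simp: Suc nb_walks_def length_Suc_conv nbrs_def)
    next
      case 4 then show ?case by (auto simp: Suc nb_walks_def length_Suc_conv nbrs_def)
    qed
    also have "\<dots> = (\<Sum>p\<in>nb_walks r C k u v. card (nbrs r C v - {hd (tl p)}))"
      by (rule card_SigmaI) (auto simp: finite_nbrs finite_nb_walks[OF fin])
    also have "real \<dots> = (\<Sum>p\<in>nb_walks r C k u v. real (card (nbrs r C v)) - 1)"
      unfolding of_nat_sum
    proof (intro sum.cong refl)
      fix p assume "p \<in> nb_walks r C k u v"
      then obtain y p' where p: "p = v # y # p'" "y \<in> C" "nb_walk r (v # y # p')"
        by (auto simp: Suc nb_walks_def length_Suc_conv)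
      then have h: "hd (tl p) \<in> nbrs r C v"
        using sym[OF nb_walk_hd[OF p(3)]] by (simp add: nbrs_def)
      then have "card (nbrs r C v) \<noteq> 0" using finite_nbrs by auto
      then show "real (card (nbrs r C v - {hd (tl p)})) = real (card (nbrs r C v)) - 1"
        using h by (simp add: card_Diff_singleton)
    qed
    finally show ?thesis using Suc by (simp add: nb_count_def)
  qed
  finally show ?thesis .
qed

definition nb_kernel :: "real \<Rightarrow> nat \<Rightarrow> 'a \<Rightarrow> 'a \<Rightarrow> real" where
  "nb_kernel t L u v = (\<Sum>k\<le>L. t ^ k * nb_count r C k u v)"

text \<open>The deformed Laplacian is \<open>B = (1 - t\<^sup>2) I + t\<^sup>2 D - t A\<close>; the truncated generating function of
  non-backtracking walks inverts it up to the factor \<open>1 - t\<^sup>2\<close> and boundary terms.\<close>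

definition deformed_laplacian :: "real \<Rightarrow> ('a \<Rightarrow> real) \<Rightarrow> 'a \<Rightarrow> real" where
  "deformed_laplacian t g v = (1 - t\<^sup>2 + t\<^sup>2 * real (card (nbrs r C v))) * g v - t * (\<Sum>w\<in>nbrs r C v. g w)"

definition boundary_term :: "real \<Rightarrow> nat \<Rightarrow> 'a \<Rightarrow> 'a \<Rightarrow> real" where
  "boundary_term t L u v = t ^ Suc L * nb_count r C (Suc L) u v
     - t ^ Suc (Suc L) * nb_count r C L u v * (real (card (nbrs r C v)) - 1)"

text \<open>The walk recursion makes all inner terms telescope. The induction starts at truncation
  1, where the exceptional case \<open>k = 0\<close> of the recursion is used.\<close>

lemma deformed_laplacian_nb_kernel:
  assumes "u \<in> C" "v \<in> C"
  shows "deformed_laplacian t (nb_kernel t (Suc L) u) v = (1 - t\<^sup>2) * of_bool (u = v) - boundary_term t (Suc L) u v"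
proof (induction L)
  case 0
  have k: "nb_kernel t (Suc 0) u w = of_bool (u = w) + t * nb_count r C (Suc 0) u w" for w
    using assms(1) by (simp add: nb_kernel_def nb_count_0)
  have s1: "(\<Sum>w\<in>nbrs r C v. of_bool (u = w) :: real) = nb_count r C (Suc 0) u v"
    using nb_count_1[OF assms] finite_nbrs by (simp add: of_bool_def)
  show ?case
    using nb_count_step[OF assms(2,1), of 0]
    unfolding deformed_laplacian_def k sum.distrib s1 sum_distrib_left[symmetric]
    by (simp add: boundary_term_def power2_eq_square algebra_simps)
next
  case (Suc L)
  have k: "nb_kernel t (Suc (Suc L)) u = (\<lambda>w. nb_kernel t (Suc L) u w + t ^ Suc (Suc L) * nb_count r C (Suc (Suc L)) u w)"
    by (simp add: nb_kernel_def fun_eq_iff)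
  have lin: "deformed_laplacian t (\<lambda>w. g w + c * h w) v = deformed_laplacian t g v + c * deformed_laplacian t h v" for g h c
    by (simp add: deformed_laplacian_def sum.distrib sum_distrib_left[symmetric] algebra_simps)
  have d: "deformed_laplacian t (nb_count r C (Suc (Suc L)) u) v =
     (1 - t\<^sup>2 + t\<^sup>2 * real (card (nbrs r C v))) * nb_count r C (Suc (Suc L)) u v
      - t * (nb_count r C (Suc (Suc (Suc L))) u v + nb_count r C (Suc L) u v * (real (card (nbrs r C v)) - 1))"
    unfolding deformed_laplacian_def nb_count_step[OF assms(2,1)] by simp
  show ?case
    unfolding k lin Suc.IH d boundary_term_def by (simp add: power2_eq_square algebra_simps)
qed

lemma nbrs_double_sum_swap:
  "(\<Sum>v\<in>C. \<Sum>w\<in>nbrs r C v. F v w) = (\<Sum>v\<in>C. \<Sum>w\<in>nbrs r C v. F w v :: real)"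
proof -
  have "(\<Sum>v\<in>C. \<Sum>w\<in>nbrs r C v. F v w) = (\<Sum>w\<in>C. \<Sum>v\<in>{v\<in>C. r w v}. F v w)"
    unfolding nbrs_def by (rule sum.swap_restrict[OF fin fin])
  also have "\<dots> = (\<Sum>w\<in>C. \<Sum>v\<in>nbrs r C w. F v w)"
    unfolding nbrs_def by (intro sum.cong refl) (auto dest: sym)
  finally show ?thesis .
qed

text \<open>Ground state transform: a positive supersolution makes the form nonnegative; the sign of \<open>t\<close>
  is irrelevant.\<close>

lemma deformed_laplacian_psd:
  assumes \<theta>: "0 < \<theta>" "\<bar>t\<bar> = \<theta>" and pos: "\<And>v. v \<in> C \<Longrightarrow> 0 < \<psi> v"
    and super: "\<And>v. v \<in> C \<Longrightarrow> 0 \<le> deformed_laplacian \<theta> \<psi> v"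
  shows "0 \<le> (\<Sum>v\<in>C. g v * deformed_laplacian t g v)"
proof -
  have t2: "t\<^sup>2 = \<theta>\<^sup>2" using \<theta> by (metis power2_abs)
  let ?c = "\<lambda>v. 1 - \<theta>\<^sup>2 + \<theta>\<^sup>2 * real (card (nbrs r C v))"
  let ?S = "\<Sum>v\<in>C. \<Sum>w\<in>nbrs r C v. \<psi> w / \<psi> v * (g v)\<^sup>2"
  let ?G = "\<Sum>v\<in>C. \<Sum>w\<in>nbrs r C v. \<bar>g v * g w\<bar>"
  have am: "2 * \<bar>x * y\<bar> \<le> b / a * x\<^sup>2 + a / b * y\<^sup>2" if "0 < a" "0 < b" for a b x y :: real
  proof -
    have "0 \<le> (b * \<bar>x\<bar> - a * \<bar>y\<bar>)\<^sup>2 / (a * b)" using that by simp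
    also have "\<dots> = b / a * x\<^sup>2 + a / b * y\<^sup>2 - 2 * \<bar>x * y\<bar>"
      using that by (simp add: field_simps power2_eq_square abs_mult)
    finally show ?thesis by simp
  qed
  have "2 * ?G = (\<Sum>v\<in>C. \<Sum>w\<in>nbrs r C v. 2 * \<bar>g v * g w\<bar>)" by (simp add: sum_distrib_left)
  also have "\<dots> \<le> (\<Sum>v\<in>C. \<Sum>w\<in>nbrs r C v. \<psi> w / \<psi> v * (g v)\<^sup>2 + \<psi> v / \<psi> w * (g w)\<^sup>2)"
    by (intro sum_mono am pos) (auto simp: nbrs_def)
  also have "\<dots> = 2 * ?S"
    unfolding sum.distrib using nbrs_double_sum_swap[of "\<lambda>v w. \<psi> w / \<psi> v * (g v)\<^sup>2"] by simp
  finally have GS: "?G \<le> ?S" by simp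
  have "\<theta> * ?G \<le> \<theta> * ?S" using GS \<theta> by (intro mult_left_mono) auto
  also have "\<theta> * ?S = (\<Sum>v\<in>C. (\<theta> * (\<Sum>w\<in>nbrs r C v. \<psi> w)) / \<psi> v * (g v)\<^sup>2)"
    by (simp add: sum_distrib_left sum_distrib_right sum_divide_distrib mult.assoc)
  also have "\<dots> \<le> (\<Sum>v\<in>C. ?c v * (g v)\<^sup>2)"
  proof (intro sum_mono mult_right_mono zero_le_power2)
    fix v assume v: "v \<in> C"
    have "\<theta> * (\<Sum>w\<in>nbrs r C v. \<psi> w) \<le> ?c v * \<psi> v"
      using super[OF v] by (simp add: deformed_laplacian_def)
    then show "\<theta> * (\<Sum>w\<in>nbrs r C v. \<psi> w) / \<psi> v \<le> ?c v"
      using pos[OF v] by (simp only: pos_divide_le_eq)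
  qed
  finally have main: "\<theta> * ?G \<le> (\<Sum>v\<in>C. ?c v * (g v)\<^sup>2)" .
  have "(\<Sum>v\<in>C. \<Sum>w\<in>nbrs r C v. t * (g v * g w)) \<le> (\<Sum>v\<in>C. \<Sum>w\<in>nbrs r C v. \<theta> * \<bar>g v * g w\<bar>)"
  proof (intro sum_mono)
    fix v w
    have "t * (g v * g w) \<le> \<bar>t * (g v * g w)\<bar>" by simp
    then show "t * (g v * g w) \<le> \<theta> * \<bar>g v * g w\<bar>" by (simp add: abs_mult \<theta>)
  qed
  then have "(\<Sum>v\<in>C. \<Sum>w\<in>nbrs r C v. t * (g v * g w)) \<le> \<theta> * ?G"
    by (simp add: sum_distrib_left)
  moreover have "(\<Sum>v\<in>C. g v * deformed_laplacian t g v) =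
      (\<Sum>v\<in>C. ?c v * (g v)\<^sup>2) - (\<Sum>v\<in>C. \<Sum>w\<in>nbrs r C v. t * (g v * g w))"
    unfolding deformed_laplacian_def t2 sum_subtractf[symmetric]
    by (intro sum.cong refl) (simp add: sum_distrib_left power2_eq_square algebra_simps)
  ultimately show ?thesis using main by simp
qed

text \<open>Apply the kernel at \<open>- \<theta>\<close> to \<open>f\<close> to obtain
  \<open>g\<close>. Then \<open>(1 - \<theta>\<^sup>2) * f\<close> is the deformed Laplacian of
  \<open>g\<close> plus an error \<open>e\<close> from the boundary terms, so nonnegativity of the
  Laplacian's form at \<open>g\<close> bounds the kernel's form at \<open>f\<close> below by the
  pairing of \<open>e\<close> and \<open>g\<close>, which is of order
  \<open>\<theta> ^ L\<close>.\<close>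

lemma nb_kernel_almost_psd:
  fixes f :: "'a \<Rightarrow> real"
  assumes \<theta>: "0 < \<theta>" "\<theta> < 1" and L: "1 \<le> L" and \<mu>: "0 \<le> \<mu>" "\<mu> \<le> 1"
    and uniq: "\<And>u v. u \<in> C \<Longrightarrow> v \<in> C \<Longrightarrow> (\<Sum>k\<le>Suc L. nb_count r C k u v) \<le> 1"
    and small: "(1 + real (card C)) ^ 3 * \<theta> ^ L \<le> (1 - \<theta>\<^sup>2) * \<mu>"
  shows "- \<mu> * (\<Sum>u\<in>C. (f u)\<^sup>2) \<le> (\<Sum>u\<in>C. \<Sum>v\<in>C. nb_kernel (- \<theta>) L u v * f u * f v)"
proof -
  obtain L' where L': "L = Suc L'" using L by (cases L) auto
  define q where "q = real (card C)"
  define d where "d v = real (card (nbrs r C v))" for v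
  have q0: "0 \<le> q" by (simp add: q_def)
  have \<theta>2: "0 < 1 - \<theta>\<^sup>2" using \<theta> by (simp add: power_less_one_iff)
  have le1: "nb_count r C k u v \<le> 1" if "k \<le> Suc L" "u \<in> C" "v \<in> C" for k u v
  proof -
    have "nb_count r C k u v \<le> (\<Sum>k\<le>Suc L. nb_count r C k u v)"
      using that by (intro member_le_sum) (auto simp: nb_count_nonneg)
    then show ?thesis using uniq[OF that(2,3)] by simp
  qed
  have dq: "d v \<le> q" for v
    unfolding d_def q_def nbrs_def using fin by (auto intro!: card_mono)
  \<comment> \<open>The factor \<open>d v - 1\<close> in the boundary term is negative only at
    isolated vertices, where the count vanishes.\<close>
  have d0: "nb_count r C L u v = 0" if "d v = 0" for u v
  proof -
    have "nbrs r C v = {}" using that finite_nbrs by (simp add: d_def)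
    then have "nb_walks r C L u v = {}"
      by (auto simp: nb_walks_def nbrs_def L' length_Suc_conv dest!: nb_walk_hd dest: sym)
    then show ?thesis by (simp add: nb_count_def)
  qed
  have d1: "d v = 0 \<or> 1 \<le> d v" for v by (auto simp: d_def)
  have ker_le: "\<bar>nb_kernel t L u v\<bar> \<le> 1" if "\<bar>t\<bar> \<le> 1" "u \<in> C" "v \<in> C" for t u v
  proof -
    have "\<bar>nb_kernel t L u v\<bar> \<le> (\<Sum>k\<le>L. \<bar>t ^ k * nb_count r C k u v\<bar>)"
      unfolding nb_kernel_def by (rule sum_abs)
    also have "\<dots> \<le> (\<Sum>k\<le>L. nb_count r C k u v)"
      using that(1) by (intro sum_mono) (auto simp: abs_mult power_abs nb_count_nonneg power_le_one intro!: mult_left_le_one_le)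
    also have "\<dots> \<le> (\<Sum>k\<le>Suc L. nb_count r C k u v)" by (simp add: nb_count_nonneg)
    finally show ?thesis using uniq[OF that(2,3)] by simp
  qed
  have small': "(1 + q) ^ 3 * \<theta> ^ L \<le> 1 - \<theta>\<^sup>2"
    using small \<mu> \<theta>2 mult_left_le[of \<mu> "1 - \<theta>\<^sup>2"] unfolding q_def by linarith
  have qL: "q * \<theta> ^ Suc L \<le> 1 - \<theta>\<^sup>2"
  proof -
    have "q * \<theta> ^ Suc L \<le> (1 + q) ^ 3 * \<theta> ^ L"
    proof (rule mult_mono)
      have "q \<le> (1 + q) ^ 1" by simp
      also have "\<dots> \<le> (1 + q) ^ 3" using q0 by (intro power_increasing) auto
      finally show "q \<le> (1 + q) ^ 3" .
      show "\<theta> ^ Suc L \<le> \<theta> ^ L" using \<theta> by (intro power_decreasing) auto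
    qed (use q0 \<theta> in auto)
    then show ?thesis using small' by linarith
  qed
  have DLsum: "deformed_laplacian t (\<lambda>v. \<Sum>u\<in>C. a u * h u v) v = (\<Sum>u\<in>C. a u * deformed_laplacian t (h u) v)" for t a h v
  proof -
    have "(\<Sum>w\<in>nbrs r C v. \<Sum>u\<in>C. a u * h u w) = (\<Sum>u\<in>C. a u * (\<Sum>w\<in>nbrs r C v. h u w))"
      by (subst sum.swap) (simp add: sum_distrib_left)
    moreover have "c * (\<Sum>u\<in>C. a u * h u v) - t * (\<Sum>u\<in>C. a u * H u) = (\<Sum>u\<in>C. a u * (c * h u v - t * H u))" for c H
      by (simp add: sum_distrib_left sum_subtractf right_diff_distrib mult.left_commute)
    ultimately show ?thesis by (simp only: deformed_laplacian_def)
  qed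
  have DLker: "deformed_laplacian t (\<lambda>v. \<Sum>u\<in>C. a u * nb_kernel t L u v) v =
     (1 - t\<^sup>2) * a v - (\<Sum>u\<in>C. a u * boundary_term t L u v)" if "v \<in> C" for t a v
  proof -
    have "deformed_laplacian t (\<lambda>v. \<Sum>u\<in>C. a u * nb_kernel t L u v) v =
      (\<Sum>u\<in>C. a u * ((1 - t\<^sup>2) * of_bool (u = v) - boundary_term t L u v))"
      unfolding DLsum L' using that by (intro sum.cong refl) (simp add: deformed_laplacian_nb_kernel)
    also have "\<dots> = (\<Sum>u\<in>C. if u = v then (1 - t\<^sup>2) * a v else 0) - (\<Sum>u\<in>C. a u * boundary_term t L u v)"
      unfolding sum_subtractf[symmetric] by (intro sum.cong refl) (auto simp: algebra_simps)
    finally show ?thesis using fin that by simp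
  qed
  \<comment> \<open>Row sums of the kernel at \<open>+ \<theta>\<close> form the positive
    supersolution: the Laplacian maps them to the constant \<open>1 - \<theta>\<^sup>2\<close> up to
    a boundary term, which is smaller by \<open>qL\<close>.\<close>
  define \<psi> where "\<psi> v = (\<Sum>u\<in>C. 1 * nb_kernel \<theta> L u v)" for v
  have ker0: "0 \<le> nb_kernel \<theta> L u v" for u v
    unfolding nb_kernel_def using \<theta> by (intro sum_nonneg mult_nonneg_nonneg) (auto simp: nb_count_nonneg)
  have psi_pos: "0 < \<psi> v" if "v \<in> C" for v
  proof -
    have "1 = (\<theta> ^ 0 * nb_count r C 0 v v)" using that by (simp add: nb_count_0)
    also have "\<dots> \<le> nb_kernel \<theta> L v v"
      unfolding nb_kernel_def using \<theta> by (intro member_le_sum) (auto simp: nb_count_nonneg)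
    also have "\<dots> \<le> (\<Sum>u\<in>C. nb_kernel \<theta> L u v)"
      using that fin ker0 by (intro member_le_sum) auto
    finally show ?thesis by (simp add: \<psi>_def)
  qed
  have super: "0 \<le> deformed_laplacian \<theta> \<psi> v" if v: "v \<in> C" for v
  proof -
    have "(\<Sum>u\<in>C. 1 * boundary_term \<theta> L u v) \<le> (\<Sum>u\<in>C. \<theta> ^ Suc L)"
    proof (intro sum_mono)
      fix u assume u: "u \<in> C"
      have "0 \<le> nb_count r C L u v * (d v - 1)"
        using d1[of v] d0[of v u] nb_count_nonneg[of L u v] by auto
      then have "0 \<le> \<theta> ^ Suc (Suc L) * nb_count r C L u v * (d v - 1)"
        using \<theta> by (simp add: mult.assoc)
      moreover have "\<theta> ^ Suc L * nb_count r C (Suc L) u v \<le> \<theta> ^ Suc L * 1"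
        using le1[of "Suc L" u v] u v \<theta> by (intro mult_left_mono) auto
      ultimately show "1 * boundary_term \<theta> L u v \<le> \<theta> ^ Suc L"
        unfolding boundary_term_def d_def mult_1 by linarith
    qed
    also have "\<dots> = q * \<theta> ^ Suc L" by (simp add: q_def)
    finally show ?thesis
      using DLker[OF v, of \<theta> "\<lambda>_. 1"] qL unfolding \<psi>_def[abs_def] by simp
  qed
  define g where "g v = (\<Sum>u\<in>C. f u * nb_kernel (- \<theta>) L u v)" for v
  define e where "e v = (\<Sum>u\<in>C. f u * boundary_term (- \<theta>) L u v)" for v
  define F where "F = (\<Sum>u\<in>C. \<bar>f u\<bar>)"
  have F0: "0 \<le> F" unfolding F_def by (rule sum_nonneg) auto
  have "0 \<le> (\<Sum>v\<in>C. g v * deformed_laplacian (- \<theta>) g v)"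
    using \<theta> by (intro deformed_laplacian_psd[of \<theta> _ \<psi>] psi_pos super) auto
  also have "\<dots> = (\<Sum>v\<in>C. g v * ((1 - \<theta>\<^sup>2) * f v - e v))"
    using DLker[of _ "- \<theta>" f] unfolding g_def[abs_def] e_def by (intro sum.cong refl) auto
  also have "\<dots> = (1 - \<theta>\<^sup>2) * (\<Sum>v\<in>C. f v * g v) - (\<Sum>v\<in>C. e v * g v)"
    by (simp add: sum_distrib_left sum_subtractf[symmetric] algebra_simps)
  finally have A: "(\<Sum>v\<in>C. e v * g v) \<le> (1 - \<theta>\<^sup>2) * (\<Sum>v\<in>C. f v * g v)" by linarith
  have gb: "\<bar>g v\<bar> \<le> F" if "v \<in> C" for v
  proof -
    have "\<bar>g v\<bar> \<le> (\<Sum>u\<in>C. \<bar>f u * nb_kernel (- \<theta>) L u v\<bar>)" unfolding g_def by (rule sum_abs)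
    also have "\<dots> \<le> F" unfolding F_def
      using ker_le[of "- \<theta>" _ v] that \<theta> by (intro sum_mono) (auto simp: abs_mult intro!: mult_left_le)
    finally show ?thesis .
  qed
  have bb: "\<bar>boundary_term (- \<theta>) L u v\<bar> \<le> \<theta> ^ L * (1 + q)" if "u \<in> C" "v \<in> C" for u v
  proof -
    have "\<bar>boundary_term (- \<theta>) L u v\<bar> \<le> \<theta> ^ Suc L * nb_count r C (Suc L) u v + \<theta> ^ Suc (Suc L) * nb_count r C L u v * \<bar>d v - 1\<bar>"
      unfolding boundary_term_def d_def
      by (rule order_trans[OF abs_triangle_ineq4]) (use \<theta> in \<open>simp add: abs_mult power_abs nb_count_nonneg\<close>)
    also have "\<dots> \<le> \<theta> ^ L * 1 + \<theta> ^ L * 1 * q"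
    proof (intro add_mono mult_mono)
      show "\<theta> ^ Suc L \<le> \<theta> ^ L" "\<theta> ^ Suc (Suc L) \<le> \<theta> ^ L"
        using \<theta> by (intro power_decreasing; simp)+
      show "nb_count r C (Suc L) u v \<le> 1" "nb_count r C L u v \<le> 1"
        using that by (auto intro: le1)
      have "card C \<noteq> 0" using that fin by auto
      then have "1 \<le> q" unfolding q_def by linarith
      then show "\<bar>d v - 1\<bar> \<le> q" using dq[of v] d1[of v] by linarith
    qed (use \<theta> nb_count_nonneg in auto)
    finally show ?thesis by (simp add: algebra_simps)
  qed
  have eb: "\<bar>e v\<bar> \<le> \<theta> ^ L * (1 + q) * F" if "v \<in> C" for v
  proof -
    have "\<bar>e v\<bar> \<le> (\<Sum>u\<in>C. \<bar>f u * boundary_term (- \<theta>) L u v\<bar>)" unfolding e_def by (rule sum_abs)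
    also have "\<dots> \<le> (\<Sum>u\<in>C. \<bar>f u\<bar> * (\<theta> ^ L * (1 + q)))"
      using bb that by (intro sum_mono) (auto simp: abs_mult intro!: mult_left_mono)
    finally show ?thesis by (simp add: F_def sum_distrib_right[symmetric] mult.commute)
  qed
  \<comment> \<open>The summation over \<open>C\<close>, the bound on \<open>e\<close> and
    Cauchy-Schwarz for \<open>F\<close> each cost a factor of at most \<open>1 + q\<close>; hence
    the cube in the smallness assumption.\<close>
  have "\<bar>\<Sum>v\<in>C. e v * g v\<bar> \<le> (\<Sum>v\<in>C. (\<theta> ^ L * (1 + q) * F) * F)"
  proof (rule order_trans[OF sum_abs sum_mono])
    fix v assume "v \<in> C"
    then show "\<bar>e v * g v\<bar> \<le> (\<theta> ^ L * (1 + q) * F) * F"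
      unfolding abs_mult using F0 q0 \<theta> by (intro mult_mono eb gb) auto
  qed
  also have "\<dots> = q * (\<theta> ^ L * (1 + q)) * F\<^sup>2" by (simp add: q_def power2_eq_square)
  also have "\<dots> \<le> q * (\<theta> ^ L * (1 + q)) * (q * (\<Sum>u\<in>C. (f u)\<^sup>2))"
  proof (intro mult_left_mono)
    have "F\<^sup>2 \<le> (\<Sum>u\<in>C. 1\<^sup>2) * (\<Sum>u\<in>C. \<bar>f u\<bar>\<^sup>2)"
      using Cauchy_Schwarz_ineq_sum[of "\<lambda>_. 1" "\<lambda>u. \<bar>f u\<bar>" C] by (simp add: F_def)
    then show "F\<^sup>2 \<le> q * (\<Sum>u\<in>C. (f u)\<^sup>2)" by (simp add: q_def)
  qed (use q0 \<theta> in auto)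
  also have "\<dots> = (q * (1 + q) * q * \<theta> ^ L) * (\<Sum>u\<in>C. (f u)\<^sup>2)" by simp
  also have "\<dots> \<le> ((1 + q) * (1 + q) * (1 + q) * \<theta> ^ L) * (\<Sum>u\<in>C. (f u)\<^sup>2)"
    using q0 \<theta> by (intro mult_right_mono mult_mono sum_nonneg) auto
  also have "\<dots> = ((1 + q) ^ 3 * \<theta> ^ L) * (\<Sum>u\<in>C. (f u)\<^sup>2)" by (simp add: power3_eq_cube)
  also have "\<dots> \<le> ((1 - \<theta>\<^sup>2) * \<mu>) * (\<Sum>u\<in>C. (f u)\<^sup>2)"
    using small unfolding q_def by (intro mult_right_mono sum_nonneg) auto
  finally have "(1 - \<theta>\<^sup>2) * (- \<mu> * (\<Sum>u\<in>C. (f u)\<^sup>2)) \<le> (1 - \<theta>\<^sup>2) * (\<Sum>v\<in>C. f v * g v)"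
    using A by linarith
  then have "- \<mu> * (\<Sum>u\<in>C. (f u)\<^sup>2) \<le> (\<Sum>v\<in>C. f v * g v)"
    using \<theta>2 by (simp only: mult_le_cancel_left_pos)
  also have "(\<Sum>v\<in>C. f v * g v) = (\<Sum>v\<in>C. \<Sum>u\<in>C. nb_kernel (- \<theta>) L u v * f u * f v)"
    unfolding g_def by (simp add: sum_distrib_left mult_ac)
  also have "\<dots> = (\<Sum>u\<in>C. \<Sum>v\<in>C. nb_kernel (- \<theta>) L u v * f u * f v)" by (rule sum.swap)
  finally show ?thesis .
qed

end

section \<open>Uniqueness of short non-backtracking walks\<close>

lemma nb_walk_nth: "nb_walk r p \<Longrightarrow> Suc i < length p \<Longrightarrow> r (p ! i) (p ! Suc i)"
proof (induction p arbitrary: i)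
  case (Cons x p)
  obtain y p' where p: "p = y # p'" using Cons.prems by (cases p) auto
  show ?case
  proof (cases i)
    case 0
    then show ?thesis using nb_walk_hd[of r x y p'] Cons.prems p by simp
  next
    case (Suc j)
    then show ?thesis using Cons.IH[of j] nb_walk_tl[OF Cons.prems(1)] Cons.prems p by simp
  qed
qed simp

text \<open>Both lists end their walks at \<open>x\<close>, so one has to be reversed before gluing;
  no backtracking arises at \<open>x\<close> because the two walks reach it from different
  neighbours.\<close>

lemma nb_walk_join:
  assumes sym: "\<And>x y. r x y \<Longrightarrow> r y x"
  shows "nb_walk r (x # p) \<Longrightarrow> nb_walk r (x # q) \<Longrightarrow> (p \<noteq> [] \<Longrightarrow> q \<noteq> [] \<Longrightarrow> hd p \<noteq> hd q) \<Longrightarrow>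
    nb_walk r (rev p @ x # q)"
proof (induction p arbitrary: x q)
  case (Cons y p)
  have "nb_walk r (y # x # q)"
    using Cons.prems sym[OF nb_walk_hd[OF Cons.prems(1)]] by (cases q) auto
  moreover have "nb_walk r (y # p)" using nb_walk_tl[OF Cons.prems(1)] by simp
  moreover have "hd p \<noteq> hd (x # q)" if "p \<noteq> []" using Cons.prems(1) that by (cases p) auto
  ultimately have "nb_walk r (rev p @ y # x # q)" by (intro Cons.IH) auto
  then show ?case by simp
qed simp

locale high_girth_graph =
  fixes r :: "'a \<Rightarrow> 'a \<Rightarrow> bool" and V :: "'a set" and g :: nat
  assumes fin: "finite V" and sym: "\<And>x y. r x y \<Longrightarrow> r y x" and irrefl: "\<And>x. \<not> r x x"
    and girth: "\<And>c. set c \<subseteq> V \<Longrightarrow> distinct c \<Longrightarrow> 3 \<le> length c \<Longrightarrow> length c \<le> g \<Longrightarrow>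
      (\<And>i. i < length c \<Longrightarrow> r (c ! i) (c ! (Suc i mod length c))) \<Longrightarrow> False"
begin

text \<open>A first return to the head encloses a cycle. Irreflexivity and non-backtracking exclude
  the lengths 1 and 2, and the girth excludes the others.\<close>

lemma nb_walk_distinct:
  assumes "nb_walk r p" "set p \<subseteq> V" "length p \<le> Suc g"
  shows "distinct p"
  using assms
proof (induction p)
  case (Cons x p)
  show ?case
  proof (cases "p = []")
    case False
    have dp: "distinct p" using Cons nb_walk_tl[OF Cons.prems(1) False] by auto
    show ?thesis
    proof (rule ccontr)
      assume "\<not> distinct (x # p)"
      then have "x \<in> set p" using dp by simp
      then obtain a b where p: "p = a @ x # b" "x \<notin> set a" by (metis split_list_first)
      let ?c = "x # a"
      have nth: "r ((x # p) ! i) ((x # p) ! Suc i)" if "Suc i < length (x # p)" for i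
        by (rule nb_walk_nth[OF Cons.prems(1) that])
      have "a \<noteq> []" using nth[of 0] p irrefl by auto
      moreover have "length a \<noteq> 1" using Cons.prems(1) p by (auto simp: length_Suc_conv)
      ultimately have len: "3 \<le> length ?c" by (cases a) (auto simp: Suc_le_eq)
      show False
      proof (rule girth[of ?c])
        show "set ?c \<subseteq> V" "distinct ?c" "3 \<le> length ?c" "length ?c \<le> g"
          using Cons.prems p dp len by auto
        fix i assume i: "i < length ?c"
        show "r (?c ! i) (?c ! (Suc i mod length ?c))"
        proof (cases "Suc i < length ?c")
          case True
          then show ?thesis using nth[of i] p by (cases i) (auto simp: nth_append)
        next
          case False
          then have "i = length a" using i by simp
          moreover have "x # p = (x # a) @ x # b" using p by simp
          ultimately show ?thesis using nth[of i] by (simp only: nth_append) simp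
        qed
      qed
    qed
  qed simp
qed simp

text \<open>After stripping the common final part, the two walks glue to a single non-backtracking
  walk of at most \<open>g\<close> edges that both starts and ends at the common first vertex, so it
  would not be distinct.\<close>

lemma nb_walk_unique:
  assumes "nb_walk r p" "nb_walk r q" "set p \<subseteq> V" "set q \<subseteq> V" "hd p = hd q" "last p = last q"
    "length p + length q \<le> g + 2"
  shows "p = q"
  using assms
proof (induction p arbitrary: q)
  case (Cons x p)
  obtain q' where q: "q = x # q'" using Cons.prems by (cases q) auto
  have lens: "length p + length q' \<le> g" using Cons.prems q by simp
  have dp: "distinct (x # p)" using nb_walk_distinct[OF Cons.prems(1,3)] lens by simp
  have dq: "distinct (x # q')" using nb_walk_distinct[OF Cons.prems(2,4)] lens q by simp
  consider "p = []" | "q' = []" | "p \<noteq> []" "q' \<noteq> []" by blast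
  then show ?case
  proof cases
    case 1
    then have "last (x # q') = x" using Cons.prems q by simp
    then have "q' = []" using dq last_in_set[of q'] by (auto split: if_splits)
    then show ?thesis using 1 q by simp
  next
    case 2
    then have "last (x # p) = x" using Cons.prems q by simp
    then have "p = []" using dp last_in_set[of p] by (auto split: if_splits)
    then show ?thesis using 2 q by simp
  next
    case 3
    show ?thesis
    proof (cases "hd p = hd q'")
      case True
      have "p = q'"
        using Cons.prems 3 True q nb_walk_tl[OF Cons.prems(1)] nb_walk_tl[of r x q'] by (intro Cons.IH) auto
      then show ?thesis using q by simp
    next
      case False
      have "nb_walk r (rev p @ x # q')"
        by (rule nb_walk_join, erule sym) (use Cons.prems q False in auto)
      then have "distinct (rev p @ x # q')"
        by (rule nb_walk_distinct) (use Cons.prems q lens in auto)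
      moreover have "last p \<in> set p \<inter> set q'"
        using 3 Cons.prems q last_in_set[of p] last_in_set[of q'] by simp
      ultimately show ?thesis by auto
    qed
  qed
qed simp

lemma nb_walks_unique:
  assumes "p \<in> nb_walks r V k u v" "q \<in> nb_walks r V l u v" "k + l \<le> g"
  shows "p = q"
  using assms by (intro nb_walk_unique) (auto simp: nb_walks_def)

lemma nb_walks_mono: "C \<subseteq> V \<Longrightarrow> nb_walks r C k u v \<subseteq> nb_walks r V k u v"
  by (auto simp: nb_walks_def)

lemma card_Union_nb_walks_le:
  assumes "2 * m \<le> g"
  shows "card (\<Union>k\<le>m. nb_walks r V k u v) \<le> 1"
proof -
  have "p = q" if "p \<in> (\<Union>k\<le>m. nb_walks r V k u v)" "q \<in> (\<Union>k\<le>m. nb_walks r V k u v)" for p q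
    using that nb_walks_unique assms by fastforce
  moreover have "finite (\<Union>k\<le>m. nb_walks r V k u v)" by (simp add: finite_nb_walks[OF fin])
  ultimately show ?thesis by (simp only: One_nat_def card_le_Suc0_iff_eq) blast
qed

lemma sum_nb_count_le:
  assumes "2 * m \<le> g" "C \<subseteq> V"
  shows "(\<Sum>k\<le>m. nb_count r C k u v) \<le> 1"
proof -
  have fC: "finite C" using assms fin by (auto intro: finite_subset)
  have "(\<Sum>k\<le>m. card (nb_walks r C k u v)) = card (\<Union>k\<le>m. nb_walks r C k u v)"
  proof (rule card_UN_disjoint[symmetric])
    show "\<forall>i\<in>{..m}. \<forall>j\<in>{..m}. i \<noteq> j \<longrightarrow> nb_walks r C i u v \<inter> nb_walks r C j u v = {}"
      by (auto simp: nb_walks_def)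
  qed (simp_all add: finite_nb_walks[OF fC])
  also have "\<dots> \<le> card (\<Union>k\<le>m. nb_walks r V k u v)"
    by (rule card_mono, simp add: finite_nb_walks[OF fin])
      (intro UN_mono nb_walks_mono[OF assms(2)] subset_refl)
  also have "\<dots> \<le> 1" by (rule card_Union_nb_walks_le[OF assms(1)])
  finally have le: "(\<Sum>k\<le>m. card (nb_walks r C k u v)) \<le> 1" .
  show ?thesis using of_nat_mono[OF le, where 'a = real] by (simp add: nb_count_def)
qed

text \<open>The closure of \<open>S\<close> under short walks sees every walk that contributes to the kernel on \<open>S\<close>, and
  is small because these walks are unique.\<close>

lemma local_kernel_psd:
  fixes f :: "'a \<Rightarrow> real"
  assumes \<theta>: "0 < \<theta>" "\<theta> < 1" and L: "1 \<le> L" "2 * Suc L \<le> g" and \<mu>: "0 \<le> \<mu>" "\<mu> \<le> 1"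
    and S: "S \<subseteq> V" "card S \<le> R"
    and small: "(1 + real (R\<^sup>2 * Suc L)) ^ 3 * \<theta> ^ L \<le> (1 - \<theta>\<^sup>2) * \<mu>"
  shows "- \<mu> * (\<Sum>u\<in>S. (f u)\<^sup>2) \<le> (\<Sum>u\<in>S. \<Sum>v\<in>S. finite_graph.nb_kernel r V (- \<theta>) L u v * f u * f v)"
proof -
  define W where "W x = (\<Union>k\<le>L. nb_walks r V k (fst x) (snd x))" for x
  define C where "C = (\<Union>x\<in>S\<times>S. \<Union>p\<in>W x. set p)"
  have fS: "finite S" using S fin by (auto intro: finite_subset)
  have fW: "finite (W x)" for x unfolding W_def by (auto simp: finite_nb_walks[OF fin])
  have CV: "C \<subseteq> V" unfolding C_def W_def by (auto simp: nb_walks_def)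
  then have fC: "finite C" using fin by (auto intro: finite_subset)
  have SC: "S \<subseteq> C"
  proof
    fix x assume "x \<in> S"
    then have "[x] \<in> W (x, x)" using S(1) by (auto simp: W_def nb_walks_0 intro!: exI[of _ 0] bexI[of _ 0])
    then show "x \<in> C" using \<open>x \<in> S\<close> unfolding C_def by force
  qed
  have "card C \<le> (\<Sum>x\<in>S\<times>S. card (\<Union>p\<in>W x. set p))"
    unfolding C_def by (rule card_UN_le) (use fS in auto)
  also have "\<dots> \<le> (\<Sum>x\<in>S\<times>S. Suc L)"
  proof (rule sum_mono)
    fix x
    have "card (\<Union>p\<in>W x. set p) \<le> (\<Sum>p\<in>W x. card (set p))" by (rule card_UN_le[OF fW])
    also have "\<dots> \<le> (\<Sum>p\<in>W x. Suc L)"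
      by (rule sum_mono) (auto simp: W_def nb_walks_def intro!: order_trans[OF card_length])
    also have "\<dots> \<le> 1 * Suc L"
      unfolding sum_constant using card_Union_nb_walks_le[of L "fst x" "snd x"] L
      by (intro mult_le_mono1) (simp add: W_def)
    finally show "card (\<Union>p\<in>W x. set p) \<le> Suc L" by simp
  qed
  also have "\<dots> = (card S)\<^sup>2 * Suc L" by (simp add: card_cartesian_product power2_eq_square)
  also have "\<dots> \<le> R\<^sup>2 * Suc L" using S(2) by (intro mult_le_mono1 power_mono) auto
  finally have cC: "real (card C) \<le> real (R\<^sup>2 * Suc L)" by (simp only: of_nat_le_iff)
  interpret GC: finite_graph r C using fC sym irrefl by unfold_locales
  interpret GV: finite_graph r V using fin sym irrefl by unfold_locales
  have ker: "GC.nb_kernel t L u v = GV.nb_kernel t L u v" if "u \<in> S" "v \<in> S" for t u v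
  proof -
    have "nb_walks r C k u v = nb_walks r V k u v" if k: "k \<le> L" for k
    proof
      show "nb_walks r C k u v \<subseteq> nb_walks r V k u v" by (rule nb_walks_mono[OF CV])
      show "nb_walks r V k u v \<subseteq> nb_walks r C k u v"
      proof
        fix p assume p: "p \<in> nb_walks r V k u v"
        then have "p \<in> W (u, v)" using k by (auto simp: W_def)
        then have "set p \<subseteq> C" using \<open>u \<in> S\<close> \<open>v \<in> S\<close> unfolding C_def by force
        then show "p \<in> nb_walks r C k u v" using p by (auto simp: nb_walks_def)
      qed
    qed
    then show ?thesis
      unfolding GC.nb_kernel_def GV.nb_kernel_def nb_count_def by (intro sum.cong) auto
  qed
  define f' where "f' u = (if u \<in> S then f u else 0)" for u
  have "- \<mu> * (\<Sum>u\<in>C. (f' u)\<^sup>2) \<le> (\<Sum>u\<in>C. \<Sum>v\<in>C. GC.nb_kernel (- \<theta>) L u v * f' u * f' v)"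
  proof (rule GC.nb_kernel_almost_psd[OF \<theta> L(1) \<mu>])
    show "(\<Sum>k\<le>Suc L. nb_count r C k u v) \<le> 1" for u v
      by (rule sum_nb_count_le[OF L(2) CV])
    have "(1 + real (card C)) ^ 3 * \<theta> ^ L \<le> (1 + real (R\<^sup>2 * Suc L)) ^ 3 * \<theta> ^ L"
      using cC \<theta> by (intro mult_right_mono power_mono) auto
    then show "(1 + real (card C)) ^ 3 * \<theta> ^ L \<le> (1 - \<theta>\<^sup>2) * \<mu>" using small by linarith
  qed
  also have "(\<Sum>u\<in>C. (f' u)\<^sup>2) = (\<Sum>u\<in>S. (f u)\<^sup>2)"
    unfolding f'_def using SC fC by (intro sum.mono_neutral_cong_right) auto
  also have "(\<Sum>u\<in>C. \<Sum>v\<in>C. GC.nb_kernel (- \<theta>) L u v * f' u * f' v) =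
     (\<Sum>u\<in>S. \<Sum>v\<in>S. GV.nb_kernel (- \<theta>) L u v * f u * f v)"
    unfolding f'_def using SC fC
    by (intro sum.mono_neutral_cong_right) (auto intro!: sum.mono_neutral_cong_right simp: ker)
  finally show ?thesis .
qed

lemma kernel_diag:
  assumes "1 \<le> L" "2 * Suc L \<le> g" "v \<in> V"
  shows "finite_graph.nb_kernel r V t L v v = 1"
proof -
  interpret GV: finite_graph r V using fin sym irrefl by unfold_locales
  have "nb_walks r V k v v = {}" if "k \<noteq> 0" "k \<le> L" for k
  proof (rule ccontr)
    assume "nb_walks r V k v v \<noteq> {}"
    then obtain p where p: "p \<in> nb_walks r V k v v" by auto
    have "[v] \<in> nb_walks r V 0 v v" using assms by (simp add: nb_walks_0)
    from nb_walks_unique[OF p this] have "p = [v]" using that assms by simp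
    then show False using p that by (simp add: nb_walks_def)
  qed
  then have "GV.nb_kernel t L v v = (\<Sum>k\<le>L. if k = 0 then 1 else 0)"
    unfolding GV.nb_kernel_def using assms by (intro sum.cong) (auto simp: nb_count_def nb_walks_0)
  then show ?thesis by simp
qed

text \<open>By uniqueness the edge itself is the only short walk between its ends, so the covariance
  along an edge is exactly the parameter.\<close>

lemma kernel_edge:
  assumes "1 \<le> L" "2 * Suc L \<le> g" "u \<in> V" "v \<in> V" "r u v"
  shows "finite_graph.nb_kernel r V t L u v = t"
proof -
  interpret GV: finite_graph r V using fin sym irrefl by unfold_locales
  have w: "[v, u] \<in> nb_walks r V 1 u v" using assms sym[OF assms(5)] by (simp add: nb_walks_1[unfolded One_nat_def])
  have "nb_walks r V k u v = {}" if "k \<noteq> 1" "k \<le> L" for k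
  proof (rule ccontr)
    assume "nb_walks r V k u v \<noteq> {}"
    then obtain p where p: "p \<in> nb_walks r V k u v" by auto
    from nb_walks_unique[OF p w] have "p = [v, u]" using that assms by simp
    then show False using p that by (simp add: nb_walks_def)
  qed
  then have "GV.nb_kernel t L u v = (\<Sum>k\<le>L. if k = 1 then t else 0)"
    unfolding GV.nb_kernel_def using assms sym[OF assms(5)]
    by (intro sum.cong) (auto simp: nb_count_def nb_walks_1[unfolded One_nat_def])
  then show ?thesis using assms by simp
qed

end

section \<open>Sparse random graphs\<close>

definition endpoints :: "nat \<times> nat \<Rightarrow> nat set" where
  "endpoints x = {fst x, snd x}"

definition crosses :: "nat set \<Rightarrow> nat \<times> nat \<Rightarrow> bool" where
  "crosses A x \<longleftrightarrow> (fst x \<in> A) \<noteq> (snd x \<in> A)"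

abbreviation all_pairs :: "nat \<Rightarrow> (nat \<times> nat) set" where
  "all_pairs n \<equiv> {..<n} \<times> {..<n}"

text \<open>The sample space of a random multigraph: \<open>m\<close> independent uniform ordered
  pairs, with loops and repetitions. Probabilities are expressed as cardinalities relative to
  \<open>(n\<^sup>2) ^ m\<close>.\<close>

abbreviation edge_samples :: "nat \<Rightarrow> nat \<Rightarrow> (nat \<Rightarrow> nat \<times> nat) set" where
  "edge_samples n m \<equiv> PiE {..<m} (\<lambda>_. all_pairs n)"

lemma card_crossing_pairs: "2 * real (card {x \<in> all_pairs n. crosses A x}) \<le> (real n)\<^sup>2"
proof -
  let ?a = "card ({..<n} \<inter> A)" and ?b = "card ({..<n} - A)"
  have "{x \<in> all_pairs n. crosses A x} = ({..<n} \<inter> A) \<times> ({..<n} - A) \<union> ({..<n} - A) \<times> ({..<n} \<inter> A)"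
    by (auto simp: crosses_def)
  then have "card {x \<in> all_pairs n. crosses A x} = ?a * ?b + ?b * ?a"
    by (simp add: card_Un_disjoint disjoint_iff card_cartesian_product)
  moreover have "?a + ?b = n"
    using card_Un_disjoint[of "{..<n} \<inter> A" "{..<n} - A"] by (simp add: Int_Diff_Un Int_Diff_disjoint)
  then have "real n = real ?a + real ?b" by linarith
  ultimately show ?thesis
    using sum_squares_bound[of "real ?a" "real ?b"] zero_le_power2[of "real ?a - real ?b"]
    by (simp add: power2_eq_square algebra_simps)
qed

lemma sum_prod_samples:
  fixes W :: "nat \<times> nat \<Rightarrow> real" and m :: nat
  shows "(\<Sum>e\<in>edge_samples n m. \<Prod>i<m. W (e i)) = (sum W (all_pairs n)) ^ m"
  using prod_sum_PiE[where f = "\<lambda>_. W" and A = "{..<m}" and B = "\<lambda>_. all_pairs n"] by simp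

text \<open>Chernoff's bound in counting form: the exponential moment of the number of crossing
  samples factorises, and a random pair crosses \<open>A\<close> with probability at most
  1/2.\<close>

lemma card_bad_cut:
  fixes s \<beta> :: real
  assumes s: "0 < s"
  shows "real (card {e \<in> edge_samples n m. \<beta> * m \<le> card {i \<in> {..<m}. crosses A (e i)}})
    \<le> (real n ^ 2) ^ m * ((1 + exp s) / 2 / exp (\<beta> * s)) ^ m"
proof -
  let ?W = "\<lambda>x. if crosses A x then exp s else 1"
  let ?B = "{e \<in> edge_samples n m. \<beta> * m \<le> card {i \<in> {..<m}. crosses A (e i)}}"
  have fin: "finite (edge_samples n m)" by (auto intro!: finite_PiE)
  have prod: "(\<Prod>i<m. ?W (e i)) = exp (s * card {i \<in> {..<m}. crosses A (e i)})" for e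
  proof -
    have "(\<Prod>i<m. ?W (e i)) = (\<Prod>i\<in>{i \<in> {..<m}. crosses A (e i)}. exp s)"
      by (simp add: prod.inter_filter[symmetric] del: prod_constant)
    then show ?thesis by (simp add: exp_of_nat_mult[symmetric] mult.commute)
  qed
  have sumW: "(\<Sum>x\<in>all_pairs n. ?W x) \<le> real n ^ 2 * ((1 + exp s) / 2)"
  proof -
    have "(\<Sum>x\<in>all_pairs n. ?W x) = (\<Sum>x\<in>all_pairs n. 1 + (if crosses A x then exp s - 1 else 0))"
      by (intro sum.cong) auto
    also have "\<dots> = real n ^ 2 + (exp s - 1) * card {x \<in> all_pairs n. crosses A x}"
      unfolding sum.distrib by (simp add: sum.inter_filter[symmetric] power2_eq_square)
    also have "\<dots> \<le> real n ^ 2 + (exp s - 1) * ((real n)\<^sup>2 / 2)"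
      using card_crossing_pairs[of n A] s by (intro add_left_mono mult_left_mono) auto
    finally show ?thesis by (simp add: field_simps)
  qed
  have 1: "real (card ?B) * exp (\<beta> * s) ^ m = (\<Sum>e\<in>?B. exp (s * (\<beta> * m)))"
    by (simp add: exp_of_nat_mult[symmetric] mult_ac)
  have 2: "(\<Sum>e\<in>?B. exp (s * (\<beta> * m))) \<le> (\<Sum>e\<in>?B. \<Prod>i<m. ?W (e i))"
    unfolding prod using s by (intro sum_mono) auto
  have 3: "(\<Sum>e\<in>?B. \<Prod>i<m. ?W (e i)) \<le> (\<Sum>e\<in>edge_samples n m. \<Prod>i<m. ?W (e i))"
  proof (rule sum_mono2[OF fin])
    show "0 \<le> (\<Prod>i<m. ?W (e i))" for e by (rule prod_nonneg) simp
  qed auto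
  have 4: "(\<Sum>e\<in>edge_samples n m. \<Prod>i<m. ?W (e i)) = (sum ?W (all_pairs n)) ^ m"
    by (rule sum_prod_samples)
  have 5: "(sum ?W (all_pairs n)) ^ m \<le> (real n ^ 2 * ((1 + exp s) / 2)) ^ m"
    by (rule power_mono[OF sumW]) (rule sum_nonneg, simp)
  have "real (card ?B) * exp (\<beta> * s) ^ m \<le> (real n ^ 2 * ((1 + exp s) / 2)) ^ m"
    using 1 2 3 4 5 by linarith
  then have "real (card ?B) \<le> (real n ^ 2 * ((1 + exp s) / 2)) ^ m / exp (\<beta> * s) ^ m"
    by (simp only: pos_le_divide_eq zero_less_power exp_gt_zero)
  then show ?thesis unfolding power_mult_distrib power_divide by simp
qed

text \<open>A prospective cycle together with the indices of the samples that form its edges. Only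
  the indices have to be distinct, so length 1 covers loops.\<close>

definition cycle_configs :: "nat \<Rightarrow> nat \<Rightarrow> nat \<Rightarrow> (nat list \<times> nat list) set" where
  "cycle_configs n m k = {(vs, js). length vs = k \<and> set vs \<subseteq> {..<n} \<and> length js = k \<and> set js \<subseteq> {..<m} \<and> distinct js}"

definition realises :: "(nat \<Rightarrow> nat \<times> nat) \<Rightarrow> nat list \<times> nat list \<Rightarrow> bool" where
  "realises e x = (\<forall>j<length (fst x). endpoints (e (snd x ! j)) = {fst x ! j, fst x ! (Suc j mod length (fst x))})"

lemma finite_cycle_configs: "finite (cycle_configs n m k)"
  by (rule finite_subset[of _ "{vs. set vs \<subseteq> {..<n} \<and> length vs = k} \<times> {js. set js \<subseteq> {..<m} \<and> length js = k}"])
    (auto simp: cycle_configs_def finite_lists_length_eq)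

lemma card_cycle_configs: "card (cycle_configs n m k) \<le> n ^ k * m ^ k"
proof -
  have "card (cycle_configs n m k) \<le> card ({vs. set vs \<subseteq> {..<n} \<and> length vs = k} \<times> {js. set js \<subseteq> {..<m} \<and> length js = k})"
    by (rule card_mono) (auto simp: cycle_configs_def finite_lists_length_eq)
  then show ?thesis by (simp add: card_cartesian_product card_lists_length_eq)
qed

text \<open>Each of the \<open>k\<close> prescribed samples is left with at most the two
  orientations of its edge out of \<open>n\<^sup>2\<close> pairs; the others stay free.\<close>

lemma card_realising_samples:
  assumes "x \<in> cycle_configs n m k"
  shows "real (card {e \<in> edge_samples n m. realises e x}) * (real n ^ 2) ^ k \<le> 2 ^ k * (real n ^ 2) ^ m"
proof -
  obtain vs js where x: "x = (vs, js)" "length vs = k" "length js = k" "set js \<subseteq> {..<m}" "distinct js"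
    using assms by (auto simp: cycle_configs_def)
  define idx where "idx i = (THE j. j < k \<and> js ! j = i)" for i
  have idx: "idx (js ! j) = j" if "j < k" for j
    unfolding idx_def using that x by (intro the_equality) (auto simp: nth_eq_iff_index_eq)
  define Q where "Q i = (if i \<in> set js then {(vs ! idx i, vs ! (Suc (idx i) mod k)), (vs ! (Suc (idx i) mod k), vs ! idx i)} else all_pairs n)" for i
  have "{e \<in> edge_samples n m. realises e x} \<subseteq> PiE {..<m} Q"
  proof
    fix e assume "e \<in> {e \<in> edge_samples n m. realises e x}"
    then have e: "e \<in> edge_samples n m" "realises e x" by auto
    have "e i \<in> Q i" if i: "i < m" for i
    proof (cases "i \<in> set js")
      case True
      then obtain j where j: "j < k" "js ! j = i" using x by (metis in_set_conv_nth)
      then have "endpoints (e i) = {vs ! j, vs ! (Suc j mod k)}"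
        using e(2) x by (auto simp: realises_def)
      then show ?thesis using True idx[OF j(1)] j(2)
        by (cases "e i") (auto simp: Q_def endpoints_def doubleton_eq_iff)
    next
      case False
      then show ?thesis using e(1) i by (auto simp: Q_def PiE_iff)
    qed
    then show "e \<in> PiE {..<m} Q" using e(1) by (auto simp: PiE_iff)
  qed
  then have "card {e \<in> edge_samples n m. realises e x} \<le> card (PiE {..<m} Q)"
    by (intro card_mono finite_PiE) (auto simp: Q_def)
  also have "\<dots> = (\<Prod>i<m. card (Q i))" by (simp add: card_PiE)
  also have "\<dots> = (\<Prod>i\<in>set js. card (Q i)) * (\<Prod>i\<in>{..<m} - set js. card (Q i))"
    using x by (subst prod.subset_diff[of "set js"]) (auto simp: mult.commute)
  also have "\<dots> \<le> 2 ^ k * (n\<^sup>2) ^ (m - k)"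
  proof (rule mult_le_mono)
    have "(\<Prod>i\<in>set js. card (Q i)) \<le> (\<Prod>i\<in>set js. 2)"
    proof (intro prod_mono conjI)
      fix i assume "i \<in> set js"
      have "card {a, b} \<le> 2" for a b :: "nat \<times> nat" by (simp add: card_insert_if)
      then show "card (Q i) \<le> 2" using \<open>i \<in> set js\<close> by (simp add: Q_def)
    qed simp
    also have "\<dots> = 2 ^ k" using x by (simp add: distinct_card)
    finally show "(\<Prod>i\<in>set js. card (Q i)) \<le> 2 ^ k" .
    have "(\<Prod>i\<in>{..<m} - set js. card (Q i)) = (\<Prod>i\<in>{..<m} - set js. n\<^sup>2)"
      by (intro prod.cong) (auto simp: Q_def card_cartesian_product power2_eq_square)
    also have "\<dots> = (n\<^sup>2) ^ (m - k)" using x by (simp add: card_Diff_subset distinct_card)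
    finally show "(\<Prod>i\<in>{..<m} - set js. card (Q i)) \<le> (n\<^sup>2) ^ (m - k)" by simp
  qed
  finally have "real (card {e \<in> edge_samples n m. realises e x}) \<le> real (2 ^ k * (n\<^sup>2) ^ (m - k))"
    by (simp only: of_nat_le_iff)
  then have "real (card {e \<in> edge_samples n m. realises e x}) * (real n ^ 2) ^ k \<le> (2 ^ k * (real n ^ 2) ^ (m - k)) * (real n ^ 2) ^ k"
    by (intro mult_right_mono) auto
  also have "\<dots> = 2 ^ k * (real n ^ 2) ^ m"
  proof -
    have "card (set js) \<le> card {..<m}" using x by (intro card_mono) auto
    then have "k \<le> m" using x by (simp add: distinct_card)
    then show ?thesis by (simp add: mult.assoc power_add[symmetric])
  qed
  finally show ?thesis .
qed

text \<open>First moment: there are at most \<open>(n * m) ^ k\<close> configurations of length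
  \<open>k\<close>, each realised with probability at most \<open>(2 / n\<^sup>2) ^ k\<close>, and
  \<open>m = d * n\<close> turns the product into \<open>(2 * d) ^ k\<close>.\<close>

lemma sum_cycle_configs:
  assumes n: "0 < n" and m: "m = d * n" and d: "1 \<le> d"
  shows "(\<Sum>e\<in>edge_samples n m. real (card {x \<in> (\<Union>k\<in>{1..g}. cycle_configs n m k). realises e x}))
    \<le> (real n ^ 2) ^ m * (g * (2 * real d) ^ g)"
proof -
  let ?X = "\<Union>k\<in>{1..g}. cycle_configs n m k"
  have fX: "finite ?X" by (auto simp: finite_cycle_configs)
  have fin: "finite (edge_samples n m)" by (auto intro!: finite_PiE)
  have "(\<Sum>e\<in>edge_samples n m. real (card {x \<in> ?X. realises e x})) = (\<Sum>e\<in>edge_samples n m. \<Sum>x\<in>{x \<in> ?X. realises e x}. 1)"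
    by simp
  also have "\<dots> = (\<Sum>x\<in>?X. \<Sum>e\<in>{e \<in> edge_samples n m. realises e x}. 1)"
    by (rule sum.swap_restrict[OF fin fX])
  also have "\<dots> = (\<Sum>x\<in>?X. real (card {e \<in> edge_samples n m. realises e x}))" by simp
  also have "\<dots> \<le> (\<Sum>k\<in>{1..g}. \<Sum>x\<in>cycle_configs n m k. real (card {e \<in> edge_samples n m. realises e x}))"
    by (subst sum.UNION_disjoint) (auto simp: finite_cycle_configs, auto simp: cycle_configs_def)
  also have "\<dots> \<le> (\<Sum>k\<in>{1..g}. (real n ^ 2) ^ m * (2 * real d) ^ g)"
  proof (rule sum_mono)
    fix k assume k: "k \<in> {1..g}"
    let ?N = "(real n ^ 2) ^ k"
    have N: "0 < ?N" using n by simp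
    have "(\<Sum>x\<in>cycle_configs n m k. real (card {e \<in> edge_samples n m. realises e x})) \<le>
       (\<Sum>x\<in>cycle_configs n m k. 2 ^ k * (real n ^ 2) ^ m / ?N)"
      using card_realising_samples N by (intro sum_mono) (simp only: pos_le_divide_eq)
    also have "\<dots> = real (card (cycle_configs n m k)) * (2 ^ k * (real n ^ 2) ^ m / ?N)" by simp
    also have "\<dots> \<le> real (n ^ k * m ^ k) * (2 ^ k * (real n ^ 2) ^ m / ?N)"
      using card_cycle_configs[of n m k] by (intro mult_right_mono) (auto simp only: of_nat_le_iff, auto)
    also have "\<dots> = (real n ^ 2) ^ m * (2 * real d) ^ k"
    proof -
      have "real (n ^ k * m ^ k) * 2 ^ k = ?N * (2 * real d) ^ k"
        by (simp add: m power_mult_distrib power2_eq_square mult_ac)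
      then have "real (n ^ k * m ^ k) * (2 ^ k * (real n ^ 2) ^ m / ?N) = ?N * (2 * real d) ^ k * (real n ^ 2) ^ m / ?N"
        by (simp add: mult.assoc[symmetric])
      then show ?thesis using n N by simp
    qed
    also have "\<dots> \<le> (real n ^ 2) ^ m * (2 * real d) ^ g"
      using k d by (intro mult_left_mono power_increasing) auto
    finally show "(\<Sum>x\<in>cycle_configs n m k. real (card {e \<in> edge_samples n m. realises e x})) \<le> \<dots>" .
  qed
  also have "\<dots> = (real n ^ 2) ^ m * (g * (2 * real d) ^ g)" by simp
  finally show ?thesis .
qed

text \<open>Two positions with the same edge would be successors of each other, forcing length 2.
  This yields the distinct sample indices of a configuration.\<close>

lemma cycle_edges_distinct:
  assumes "distinct c" "3 \<le> length c" "j < length c" "l < length c"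
    and eq: "{c ! j, c ! (Suc j mod length c)} = {c ! l, c ! (Suc l mod length c)}"
  shows "j = l"
proof (rule ccontr)
  assume ne: "j \<noteq> l"
  let ?k = "length c"
  have inj: "c ! a = c ! b \<longleftrightarrow> a = b" if "a < ?k" "b < ?k" for a b
    using assms(1) that by (simp add: nth_eq_iff_index_eq)
  have md: "Suc j mod ?k < ?k" "Suc l mod ?k < ?k" using assms(3) by (intro mod_less_divisor; linarith)+
  have "j = Suc l mod ?k" "l = Suc j mod ?k"
    using eq ne inj[OF assms(3,4)] inj[OF assms(3) md(2)] inj[OF md(1) assms(4)]
    by (auto simp: doubleton_eq_iff)
  moreover have "Suc a mod ?k = (if Suc a = ?k then 0 else Suc a)" if "a < ?k" for a
    using that by (simp add: mod_Suc)
  ultimately show False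
    using assms(2-4) by (simp split: if_splits)
qed

lemma boundary_iff_crosses:
  assumes "fst x \<noteq> snd x"
  shows "card (endpoints x \<inter> A) = 1 \<longleftrightarrow> crosses A x"
proof -
  have "endpoints x \<inter> A = (if fst x \<in> A then {fst x} else {}) \<union> (if snd x \<in> A then {snd x} else {})"
    by (auto simp: endpoints_def)
  then show ?thesis using assms by (auto simp: crosses_def)
qed

text \<open>Delete every sample that takes part in a short cycle. This removes at most
  \<open>\<eta> * m\<close> of them, so renormalising the weights raises the cuts by a factor of at
  most \<open>1 / (1 - \<eta>)\<close>.\<close>

lemma sample_to_graph:
  fixes e :: "nat \<Rightarrow> nat \<times> nat"
  assumes e: "e \<in> edge_samples n m" and m: "0 < m" and \<eta>: "0 < \<eta>" "\<eta> \<le> 1 / 2" and g: "1 \<le> g"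
    and cut: "\<And>A. card {i \<in> {..<m}. crosses A (e i)} \<le> (1 / 2 + \<eta>) * m"
    and few: "real g * card {x \<in> (\<Union>k\<in>{1..g}. cycle_configs n m k). realises e x} \<le> \<eta> * m"
  shows "\<exists>E w. simple_graph {..<n} E \<and> (\<forall>h\<in>E. 0 < w h) \<and> (\<Sum>h\<in>E. w h) = 1 \<and>
    (\<forall>A. (\<Sum>h\<in>edge_boundary E A. w h) \<le> (1 / 2 + \<eta>) / (1 - \<eta>)) \<and> (\<forall>c. is_cycle E c \<longrightarrow> g < length c)"
proof -
  let ?X = "{x \<in> (\<Union>k\<in>{1..g}. cycle_configs n m k). realises e x}"
  have fX: "finite ?X" by (auto simp: finite_cycle_configs)
  define bad where "bad = (\<Union>x\<in>?X. set (snd x))"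
  define I where "I = {..<m} - bad"
  have fI: "finite I" by (simp add: I_def)
  have "card bad \<le> (\<Sum>x\<in>?X. card (set (snd x)))" unfolding bad_def by (rule card_UN_le[OF fX])
  also have "\<dots> \<le> (\<Sum>x\<in>?X. g)"
    by (rule sum_mono) (auto simp: cycle_configs_def intro!: order_trans[OF card_length])
  finally have "real (card bad) \<le> real (card ?X * g)" by (simp only: of_nat_le_iff sum_constant of_nat_id)
  then have cb: "real (card bad) \<le> \<eta> * m" using few by (simp add: mult.commute)
  have "finite bad" using fX by (auto simp: bad_def)
  then have "m - card bad \<le> card I" unfolding I_def using diff_card_le_card_Diff[of bad "{..<m}"] by simp
  then have "real m - real (card bad) \<le> card I" by linarith
  then have cI: "(1 - \<eta>) * m \<le> card I" using cb by (simp add: algebra_simps)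
  have cI0: "0 < real (card I)"
    by (rule less_le_trans[OF _ cI]) (use \<eta> m in auto)
  have pairs: "fst (e i) < n \<and> snd (e i) < n" if "i \<in> I" for i
  proof -
    have "e i \<in> all_pairs n" using e that by (intro PiE_mem[of e "{..<m}"]) (auto simp: I_def)
    then show ?thesis by (auto simp: mem_Times_iff)
  qed
  have noloop: "fst (e i) \<noteq> snd (e i)" if i: "i \<in> I" for i
  proof
    assume "fst (e i) = snd (e i)"
    \<comment> \<open>A loop is a realised configuration of length 1, so it has been
      deleted.\<close>
    then have "([fst (e i)], [i]) \<in> ?X"
      using i pairs[OF i] g by (auto simp: cycle_configs_def realises_def endpoints_def I_def intro!: bexI[of _ 1])
    then have "i \<in> bad" unfolding bad_def by force
    then show False using i by (simp add: I_def)
  qed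
  define E where "E = (\<lambda>i. endpoints (e i)) ` I"
  define w where "w h = real (card {i \<in> I. endpoints (e i) = h}) / card I" for h
  have fE: "finite E" by (simp add: E_def fI)
  have sumw: "(\<Sum>h\<in>F. w h) = real (card {i \<in> I. endpoints (e i) \<in> F}) / card I" if "F \<subseteq> E" for F
  proof -
    have fF: "finite F" using that fE by (rule finite_subset)
    have "card {i \<in> I. endpoints (e i) \<in> F} = card (\<Union>h\<in>F. {i \<in> I. endpoints (e i) = h})"
      by (rule arg_cong[where f = card]) auto
    also have "\<dots> = (\<Sum>h\<in>F. card {i \<in> I. endpoints (e i) = h})"
      by (rule card_UN_disjoint) (use fF fI in auto)
    finally show ?thesis by (simp add: w_def sum_divide_distrib)
  qed
  have "simple_graph {..<n} E"
    unfolding simple_graph_def E_def endpoints_def using pairs noloop by auto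
  moreover have "0 < w h" if "h \<in> E" for h
  proof -
    have "{i \<in> I. endpoints (e i) = h} \<noteq> {}" using that by (auto simp: E_def)
    then show ?thesis unfolding w_def using cI0 fI by (intro divide_pos_pos) (auto simp: card_gt_0_iff)
  qed
  moreover have "(\<Sum>h\<in>E. w h) = 1"
  proof -
    have "{i \<in> I. endpoints (e i) \<in> E} = I" by (auto simp: E_def)
    then show ?thesis using sumw[of E] cI0 by simp
  qed
  moreover have "(\<Sum>h\<in>edge_boundary E A. w h) \<le> (1 / 2 + \<eta>) / (1 - \<eta>)" for A
  proof -
    have "{i \<in> I. endpoints (e i) \<in> edge_boundary E A} \<subseteq> {i \<in> {..<m}. crosses A (e i)}"
    proof
      fix i assume i: "i \<in> {i \<in> I. endpoints (e i) \<in> edge_boundary E A}"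
      then have "card (endpoints (e i) \<inter> A) = 1" by (simp add: edge_boundary_def)
      then have "crosses A (e i)" using boundary_iff_crosses[OF noloop, of i A] i by simp
      then show "i \<in> {i \<in> {..<m}. crosses A (e i)}" using i by (simp add: I_def)
    qed
    then have "card {i \<in> I. endpoints (e i) \<in> edge_boundary E A} \<le> card {i \<in> {..<m}. crosses A (e i)}"
      by (rule card_mono[rotated]) simp
    then have "real (card {i \<in> I. endpoints (e i) \<in> edge_boundary E A}) \<le> (1 / 2 + \<eta>) * m"
      using cut[of A] by linarith
    then have "(\<Sum>h\<in>edge_boundary E A. w h) \<le> (1 / 2 + \<eta>) * m / card I"
      using sumw[of "edge_boundary E A"] cI0 by (simp add: edge_boundary_def divide_right_mono)
    also have "\<dots> \<le> (1 / 2 + \<eta>) * m / ((1 - \<eta>) * m)"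
      using cI cI0 \<eta> m by (intro divide_left_mono mult_pos_pos) auto
    finally show ?thesis using m by simp
  qed
  moreover have "g < length c" if c: "is_cycle E c" for c
  proof (rule ccontr)
    let ?k = "length c"
    assume "\<not> g < ?k"
    then have kg: "?k \<le> g" by simp
    have k3: "3 \<le> ?k" and dc: "distinct c" and cE: "\<And>i. i < ?k \<Longrightarrow> {c ! i, c ! (Suc i mod ?k)} \<in> E"
      using c by (auto simp: is_cycle_def)
    have "\<exists>i. j < ?k \<longrightarrow> i \<in> I \<and> endpoints (e i) = {c ! j, c ! (Suc j mod ?k)}" for j
      using cE[of j] unfolding E_def by auto
    then obtain f where f: "\<And>j. j < ?k \<Longrightarrow> f j \<in> I \<and> endpoints (e (f j)) = {c ! j, c ! (Suc j mod ?k)}"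
      by metis
    have "inj_on f {..<?k}"
    proof (rule inj_onI)
      fix j l assume "j \<in> {..<?k}" "l \<in> {..<?k}" "f j = f l"
      then show "j = l" using f[of j] f[of l] by (intro cycle_edges_distinct[OF dc k3]) auto
    qed
    then have "distinct (map f [0..<?k])" by (simp add: distinct_map atLeast0LessThan)
    moreover have "set c \<subseteq> {..<n}"
    proof
      fix v assume "v \<in> set c"
      then obtain j where j: "j < ?k" "c ! j = v" by (auto simp: in_set_conv_nth)
      then have "v \<in> endpoints (e (f j))" using f[of j] by auto
      then show "v \<in> {..<n}" using pairs f[OF j(1)] by (auto simp: endpoints_def)
    qed
    moreover have "set (map f [0..<?k]) \<subseteq> {..<m}" using f by (auto simp: I_def)
    moreover have "realises e (c, map f [0..<?k])" using f by (simp add: realises_def)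
    ultimately have "(c, map f [0..<?k]) \<in> ?X"
      using k3 kg by (auto simp: cycle_configs_def)
    moreover have "f 0 \<in> set (snd (c, map f [0..<?k]))" using k3 by (auto intro!: image_eqI[of _ _ 0])
    ultimately have "f 0 \<in> bad" unfolding bad_def by blast
    moreover have "0 < ?k" using k3 by linarith
    from f[OF this] have "f 0 \<notin> bad" by (simp add: I_def)
    ultimately show False by simp
  qed
  ultimately show ?thesis by blast
qed

text \<open>Each of the \<open>2 ^ n\<close> cuts fails with probability at most
  \<open>(1 / 4) ^ n\<close>, in total at most 1/4, and by Markov's inequality too many short cycles
  also have probability at most 1/4.\<close>

lemma good_sample_exists:
  assumes s: "0 < s" and \<rho>: "((1 + exp s) / 2 / exp ((1 / 2 + \<eta>) * s)) ^ d \<le> 1 / 4"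
    and n: "2 \<le> n" and d: "1 \<le> d" and \<eta>: "0 < \<eta>"
    and g: "4 * (real g * (g * (2 * real d) ^ g)) \<le> \<eta> * real (d * n)"
  shows "\<exists>e\<in>edge_samples n (d * n). (\<forall>A. card {i \<in> {..<d * n}. crosses A (e i)} \<le> (1 / 2 + \<eta>) * real (d * n)) \<and>
    real g * card {x \<in> (\<Union>k\<in>{1..g}. cycle_configs n (d * n) k). realises e x} \<le> \<eta> * real (d * n)"
proof -
  define m where "m = d * n"
  let ?N = "(real n ^ 2) ^ m"
  let ?S = "edge_samples n m"
  have N: "0 < ?N" using n by simp
  have m: "0 < real m" using n d by (simp add: m_def)
  have fin: "finite ?S" by (auto intro!: finite_PiE)
  have cS: "real (card ?S) = ?N" by (simp add: card_PiE card_cartesian_product power2_eq_square)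
  define Bad1 where "Bad1 A = {e \<in> ?S. (1 / 2 + \<eta>) * m \<le> card {i \<in> {..<m}. crosses A (e i)}}" for A
  define X where "X e = real (card {x \<in> (\<Union>k\<in>{1..g}. cycle_configs n m k). realises e x})" for e
  define Bad2 where "Bad2 = {e \<in> ?S. \<eta> * m < real g * X e}"
  have b1: "real (card (Bad1 A)) \<le> ?N * (1 / 4) ^ n" for A
  proof -
    have "real (card (Bad1 A)) \<le> ?N * ((1 + exp s) / 2 / exp ((1 / 2 + \<eta>) * s)) ^ m"
      unfolding Bad1_def by (rule card_bad_cut[OF s])
    also have "\<dots> = ?N * (((1 + exp s) / 2 / exp ((1 / 2 + \<eta>) * s)) ^ d) ^ n"
      by (simp add: m_def power_mult)
    also have "\<dots> \<le> ?N * (1 / 4) ^ n"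
      using \<rho> N by (intro mult_left_mono power_mono) (auto intro!: divide_nonneg_nonneg add_nonneg_nonneg)
    finally show ?thesis .
  qed
  have "card (\<Union>A\<in>Pow {..<n}. Bad1 A) \<le> (\<Sum>A\<in>Pow {..<n}. card (Bad1 A))"
    by (rule card_UN_le) simp
  then have "real (card (\<Union>A\<in>Pow {..<n}. Bad1 A)) \<le> (\<Sum>A\<in>Pow {..<n}. real (card (Bad1 A)))"
    by (simp only: of_nat_sum[symmetric] of_nat_le_iff)
  also have "\<dots> \<le> (\<Sum>A\<in>Pow {..<n}. ?N * (1 / 4) ^ n)" by (intro sum_mono b1)
  also have "\<dots> = ?N * (1 / 2) ^ n"
    by (simp add: card_Pow power_mult_distrib[symmetric])
  also have "\<dots> \<le> ?N * (1 / 2) ^ 2" using N n by (intro mult_left_mono power_decreasing) auto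
  finally have B1: "real (card (\<Union>A\<in>Pow {..<n}. Bad1 A)) \<le> ?N / 4" by (simp add: power2_eq_square)
  have "real (card Bad2) * (\<eta> * m) = (\<Sum>e\<in>Bad2. \<eta> * m)" by simp
  also have "\<dots> \<le> (\<Sum>e\<in>Bad2. real g * X e)" by (intro sum_mono) (auto simp: Bad2_def)
  also have "\<dots> \<le> (\<Sum>e\<in>?S. real g * X e)"
    by (rule sum_mono2[OF fin]) (auto simp: Bad2_def X_def)
  also have "\<dots> \<le> real g * (?N * (g * (2 * real d) ^ g))"
    unfolding sum_distrib_left[symmetric] X_def using n d
    by (intro mult_left_mono sum_cycle_configs) (auto simp: m_def)
  also have "\<dots> = ?N / 4 * (4 * (real g * (g * (2 * real d) ^ g)))" by simp
  also have "\<dots> \<le> ?N / 4 * (\<eta> * m)"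
    using g N unfolding m_def by (intro mult_left_mono) auto
  finally have B2: "real (card Bad2) \<le> ?N / 4" using \<eta> m by simp
  have "\<not> ?S \<subseteq> (\<Union>A\<in>Pow {..<n}. Bad1 A) \<union> Bad2"
  proof
    assume "?S \<subseteq> (\<Union>A\<in>Pow {..<n}. Bad1 A) \<union> Bad2"
    then have "card ?S \<le> card ((\<Union>A\<in>Pow {..<n}. Bad1 A) \<union> Bad2)"
      by (rule card_mono[rotated]) (auto simp: Bad1_def Bad2_def intro: finite_subset[OF _ fin])
    also have "\<dots> \<le> card (\<Union>A\<in>Pow {..<n}. Bad1 A) + card Bad2" by (rule card_Un_le)
    finally have "?N \<le> ?N / 4 + ?N / 4" using cS B1 B2 by linarith
    then show False using N by simp
  qed
  then obtain e where e: "e \<in> ?S" "\<And>A. A \<subseteq> {..<n} \<Longrightarrow> e \<notin> Bad1 A" "e \<notin> Bad2" by blast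
  have "real (card {i \<in> {..<m}. crosses A (e i)}) \<le> (1 / 2 + \<eta>) * m" for A
  proof -
    have "crosses A (e i) \<longleftrightarrow> crosses (A \<inter> {..<n}) (e i)" if "i < m" for i
    proof -
      have "e i \<in> all_pairs n" using e(1) that by (intro PiE_mem[of e "{..<m}"]) auto
      then show ?thesis by (auto simp: mem_Times_iff crosses_def)
    qed
    then have "{i \<in> {..<m}. crosses A (e i)} = {i \<in> {..<m}. crosses (A \<inter> {..<n}) (e i)}" by auto
    then show ?thesis using e(1) e(2)[of "A \<inter> {..<n}"] by (simp add: Bad1_def)
  qed
  moreover have "real g * X e \<le> \<eta> * m" using e(1,3) by (simp add: Bad2_def)
  ultimately show ?thesis using e(1) unfolding m_def X_def by blast
qed

theorem sparse_gap_graph: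
  fixes \<eta> :: real
  assumes "0 < \<eta>"
  shows "\<exists>c>0. \<forall>N. \<exists>n\<ge>N. \<exists>E w. simple_graph {..<n} E \<and> (\<forall>h\<in>E. 0 < w h) \<and> (\<Sum>h\<in>E. w h) = 1 \<and>
    (\<forall>A. (\<Sum>h\<in>edge_boundary E A. w h) \<le> 1 / 2 + \<eta>) \<and> (\<forall>b. is_cycle E b \<longrightarrow> c * ln (real n) < length b)"
proof -
  \<comment> \<open>Renormalisation turns \<open>\<eta>'\<close> into at most
    \<open>4 * \<eta>'\<close>; the cap 1/4 controls the quadratic term.\<close>
  define \<eta>' where "\<eta>' = min (1 / 4) (\<eta> / 4)"
  have \<eta>': "0 < \<eta>'" "\<eta>' \<le> 1 / 2" using assms by (auto simp: \<eta>'_def)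
  have "(1 / 2 + \<eta>') \<le> (1 / 2 + 4 * \<eta>') * (1 - \<eta>')"
  proof -
    have "\<eta>' * \<eta>' \<le> \<eta>' * (1 / 4)" using \<eta>' by (intro mult_left_mono) (auto simp: \<eta>'_def)
    then have "(1 / 2 + 4 * \<eta>') * (1 - \<eta>') - (1 / 2 + \<eta>') \<ge> 5 / 2 * \<eta>' - \<eta>'"
      by (simp add: field_simps)
    then show ?thesis using \<eta>' by simp
  qed
  then have "(1 / 2 + \<eta>') / (1 - \<eta>') \<le> 1 / 2 + 4 * \<eta>'" using \<eta>' by (simp add: divide_le_eq)
  also have "\<dots> \<le> 1 / 2 + \<eta>" by (simp add: \<eta>'_def)
  finally have \<eta>'': "(1 / 2 + \<eta>') / (1 - \<eta>') \<le> 1 / 2 + \<eta>" .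
  \<comment> \<open>Both sides are 1 at \<open>s = 0\<close>, with slopes 1/2 and
    \<open>1 / 2 + \<eta>'\<close>.\<close>
  have "eventually (\<lambda>s. (1 + exp s) / 2 < exp ((1 / 2 + \<eta>') * s)) (at_right 0)"
    using \<eta>'(1) by real_asymp
  then have "eventually (\<lambda>s. 0 < s \<and> (1 + exp s) / 2 < exp ((1 / 2 + \<eta>') * s)) (at_right 0)"
    using eventually_at_right_less by eventually_elim auto
  then obtain s where s: "0 < s" "(1 + exp s) / 2 < exp ((1 / 2 + \<eta>') * s)"
    using eventually_happens'[OF trivial_limit_at_right_real] by blast
  let ?\<rho> = "(1 + exp s) / 2 / exp ((1 / 2 + \<eta>') * s)"
  have "?\<rho> < 1" using s by simp
  moreover have "0 \<le> ?\<rho>" by (intro divide_nonneg_nonneg add_nonneg_nonneg) auto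
  ultimately have "(\<lambda>d. ?\<rho> ^ d) \<longlonglongrightarrow> 0" by (intro LIMSEQ_power_zero) simp
  then have "eventually (\<lambda>d. ?\<rho> ^ d < 1 / 4) sequentially"
    by (rule order_tendstoD) simp
  then obtain d0 where d0: "\<And>d. d \<ge> d0 \<Longrightarrow> ?\<rho> ^ d < 1 / 4" unfolding eventually_sequentially by blast
  define d where "d = max 1 d0"
  have d: "1 \<le> d" "?\<rho> ^ d \<le> 1 / 4" using d0[of d] by (auto simp: d_def)
  define b where "b = ln (2 * real d)"
  have b: "0 < b" using d by (simp add: b_def)
  \<comment> \<open>This makes \<open>(2 * d) ^ g\<close> at most the square root of
    \<open>n\<close>, so that short cycles touch only a vanishing fraction of the samples.\<close>
  define c where "c = 1 / (2 * b)"
  have c: "0 < c" using b by (simp add: c_def)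
  have "eventually (\<lambda>n::nat. 4 * ((c * ln n) * (c * ln n) * exp (ln n / 2)) \<le> \<eta>' * n) sequentially"
    using \<eta>'(1) c by real_asymp
  moreover have "eventually (\<lambda>n::nat. 1 \<le> c * ln n) sequentially" using c by real_asymp
  ultimately have ev: "eventually (\<lambda>n::nat. (2::nat) \<le> n \<and> 1 \<le> c * ln n \<and> 4 * ((c * ln n) * (c * ln n) * exp (ln n / 2)) \<le> \<eta>' * n) sequentially"
    using eventually_ge_at_top[of 2] by eventually_elim auto
  show ?thesis
  proof (intro exI[of _ c] conjI allI c)
    fix N :: nat
    from eventually_happens'[OF sequentially_bot eventually_conj[OF ev eventually_ge_at_top[of N]]]
    obtain n where nn: "(2 \<le> n \<and> 1 \<le> c * ln n \<and> 4 * ((c * ln n) * (c * ln n) * exp (ln n / 2)) \<le> \<eta>' * n) \<and> N \<le> n"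
      by (rule exE)
    have n: "N \<le> n" "2 \<le> n" "1 \<le> c * ln n" "4 * ((c * ln n) * (c * ln n) * exp (ln n / 2)) \<le> \<eta>' * n"
      using nn by blast+
    define g where "g = nat \<lfloor>c * ln n\<rfloor>"
    have g: "real g \<le> c * ln n" "1 \<le> g" using n(3) unfolding g_def by (linarith, linarith)
    have "(2 * real d) ^ g = exp (b * g)"
      using d by (simp add: b_def exp_of_nat2_mult)
    also have "\<dots> \<le> exp (b * (c * ln n))" using g b by simp
    also have "b * (c * ln n) = ln n / 2" using b by (simp add: c_def)
    finally have p: "(2 * real d) ^ g \<le> exp (ln n / 2)" .
    have "4 * (real g * (g * (2 * real d) ^ g)) \<le> 4 * ((c * ln n) * ((c * ln n) * exp (ln n / 2)))"
      using g(1) p n(3) by (intro mult_left_mono mult_mono) auto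
    also have "\<dots> \<le> \<eta>' * real n" using n(4) by (simp only: mult.assoc)
    also have "\<eta>' * real n \<le> \<eta>' * real (d * n)"
    proof -
      have "n \<le> d * n" using d by simp
      then show ?thesis using \<eta>' by (intro mult_left_mono) (simp_all only: of_nat_le_iff less_imp_le)
    qed
    finally have "4 * (real g * (g * (2 * real d) ^ g)) \<le> \<eta>' * real (d * n)" .
    from good_sample_exists[OF s(1) d(2) n(2) d(1) \<eta>'(1) this]
    obtain e where e: "e \<in> edge_samples n (d * n)"
      "\<And>A. card {i \<in> {..<d * n}. crosses A (e i)} \<le> (1 / 2 + \<eta>') * real (d * n)"
      "real g * card {x \<in> (\<Union>k\<in>{1..g}. cycle_configs n (d * n) k). realises e x} \<le> \<eta>' * real (d * n)"
      by blast
    have "0 < d * n" using d n by simp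
    from sample_to_graph[OF e(1) this \<eta>' g(2) e(2,3)]
    obtain E w where E: "simple_graph {..<n} E" "\<forall>h\<in>E. 0 < w h" "(\<Sum>h\<in>E. w h) = 1"
      "\<And>A. (\<Sum>h\<in>edge_boundary E A. w h) \<le> (1 / 2 + \<eta>') / (1 - \<eta>')" "\<And>b. is_cycle E b \<Longrightarrow> g < length b"
      by blast
    have len: "c * ln (real n) < length b" if "is_cycle E b" for b
      using E(5)[OF that] n(3) unfolding g_def by linarith
    have cutb: "(\<Sum>h\<in>edge_boundary E A. w h) \<le> 1 / 2 + \<eta>" for A using E(4)[of A] \<eta>'' by linarith
    show "\<exists>n\<ge>N. \<exists>E w. simple_graph {..<n} E \<and> (\<forall>h\<in>E. 0 < w h) \<and> (\<Sum>h\<in>E. w h) = 1 \<and>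
      (\<forall>A. (\<Sum>h\<in>edge_boundary E A. w h) \<le> 1 / 2 + \<eta>) \<and> (\<forall>b. is_cycle E b \<longrightarrow> c * ln (real n) < length b)"
      using n(1) E(1-3) len cutb by blast
  qed
qed

section \<open>Iterated substitution\<close>

text \<open>Level \<open>j\<close> edges of the iterated \<open>K\<^sub>2\<^sub>,\<^sub>n\<close>-substitution are addressed by lists of length \<open>j\<close>:
  \<open>(v, False) # a\<close> joins the source of the edge \<open>a\<close> to its \<open>v\<close>-th subdivision vertex, and \<open>(v, True) # a\<close>
  joins that vertex to the sink of \<open>a\<close>.\<close>

type_synonym addr = "(nat \<times> bool) list"

text \<open>A subdivision vertex is named after the edge that it subdivides; 0 and 1 are kept free
  for the ends of the initial edge.\<close>

definition gvert :: "addr \<Rightarrow> nat \<Rightarrow> nat" where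
  "gvert a v = Suc (Suc (to_nat (a, v)))"

fun src :: "addr \<Rightarrow> nat" where
  "src [] = 0"
| "src ((v, b) # a) = (if b then gvert a v else src a)"

fun snk :: "addr \<Rightarrow> nat" where
  "snk [] = 1"
| "snk ((v, b) # a) = (if b then snk a else gvert a v)"

definition addrs :: "nat \<Rightarrow> nat \<Rightarrow> addr set" where
  "addrs n j = {a. set a \<subseteq> {..<n} \<times> UNIV \<and> length a = j}"

definition weight :: "(nat \<Rightarrow> real) \<Rightarrow> addr \<Rightarrow> real" where
  "weight p a = prod_list (map (\<lambda>x. p (fst x)) a)"

definition gverts :: "nat \<Rightarrow> nat \<Rightarrow> nat set" where
  "gverts n k = {0, 1} \<union> (\<lambda>(a, v). gvert a v) ` ((\<Union>j<k. addrs n j) \<times> {..<n})"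

definition supply_edge :: "addr \<Rightarrow> nat set" where
  "supply_edge a = {src a, snk a}"

lemma gvert_eq_iff [simp]: "gvert a v = gvert b w \<longleftrightarrow> a = b \<and> v = w"
  by (auto simp: gvert_def)

lemma gvert_neq [simp]: "gvert a v \<noteq> 0" "gvert a v \<noteq> 1" "gvert a v \<noteq> Suc 0" "0 \<noteq> gvert a v" "1 \<noteq> gvert a v" "Suc 0 \<noteq> gvert a v"
  by (auto simp: gvert_def)

lemma inj_gvert: "inj_on (gvert a) A" by (auto simp: inj_on_def)

text \<open>The ends of \<open>a\<close> other than 0 and 1 subdivide proper suffixes of
  \<open>a\<close>, which are shorter than \<open>b\<close>.\<close>

lemma src_neq_gvert: "length a \<le> length b \<Longrightarrow> src a \<noteq> gvert b v"
  by (induction a rule: src.induct) auto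

lemma snk_neq_gvert: "length a \<le> length b \<Longrightarrow> snk a \<noteq> gvert b v"
  by (induction a rule: snk.induct) auto

lemma src_neq_snk: "src a \<noteq> snk a"
  by (induction a rule: src.induct) (auto simp: src_neq_gvert snk_neq_gvert dest: sym)

lemma finite_addrs: "finite (addrs n j)"
  using finite_lists_length_eq[of "{..<n} \<times> (UNIV :: bool set)" j] by (simp add: addrs_def)

lemma addrs_0: "addrs n 0 = {[]}" by (auto simp: addrs_def)

lemma Cons_in_addrs: "(v, b) # a \<in> addrs n (Suc j) \<longleftrightarrow> v < n \<and> a \<in> addrs n j"
  by (auto simp: addrs_def)

lemma card_addrs: "card (addrs n j) = (2 * n) ^ j"
  unfolding addrs_def using card_lists_length_eq[of "{..<n} \<times> (UNIV :: bool set)" j]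
  by (simp add: card_cartesian_product mult.commute)

lemma sum_addrs_Suc:
  "(\<Sum>a\<in>addrs n (Suc j). F a) = (\<Sum>a\<in>addrs n j. \<Sum>v<n. F ((v, True) # a) + F ((v, False) # a) :: real)"
proof -
  have "(\<Sum>a\<in>addrs n (Suc j). F a) = (\<Sum>(a, v, b)\<in>addrs n j \<times> {..<n} \<times> UNIV. F ((v, b) # a))"
    by (rule sum.reindex_bij_witness[of _ "\<lambda>(a, v, b). (v, b) # a" "\<lambda>a. (tl a, fst (hd a), snd (hd a))"])
      (auto simp: addrs_def length_Suc_conv)
  also have "\<dots> = (\<Sum>a\<in>addrs n j. \<Sum>v<n. \<Sum>b\<in>UNIV. F ((v, b) # a))"
    unfolding sum.cartesian_product ..
  finally show ?thesis by (simp add: UNIV_bool add.commute)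
qed

lemma weight_Nil [simp]: "weight p [] = 1" by (simp add: weight_def)

lemma weight_Cons [simp]: "weight p ((v, b) # a) = p v * weight p a" by (simp add: weight_def)

lemma weight_pos: "a \<in> addrs n j \<Longrightarrow> (\<And>v. v < n \<Longrightarrow> 0 < p v) \<Longrightarrow> 0 < weight p a"
  by (induction a arbitrary: j) (auto simp: addrs_def)

lemma finite_gverts: "finite (gverts n k)"
  by (auto simp: gverts_def finite_addrs)

lemma gvert_in_gverts: "a \<in> addrs n j \<Longrightarrow> j < k \<Longrightarrow> v < n \<Longrightarrow> gvert a v \<in> gverts n k"
  unfolding gverts_def by force

lemma gverts_cases:
  assumes "x \<in> gverts n k"
  obtains "x = 0" | "x = 1" | a v j where "x = gvert a v" "a \<in> addrs n j" "j < k" "v < n"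
  using assms unfolding gverts_def by (elim UnE imageE) auto

lemma src_snk_in_gverts: "a \<in> addrs n j \<Longrightarrow> j \<le> k \<Longrightarrow> src a \<in> gverts n k \<and> snk a \<in> gverts n k"
proof (induction a arbitrary: j)
  case Nil
  then show ?case by (simp add: gverts_def)
next
  case (Cons x a)
  obtain v b where x: "x = (v, b)" by (cases x)
  obtain i where j: "j = Suc i" using Cons.prems(1) by (cases j) (auto simp: addrs_def)
  have a: "v < n" "a \<in> addrs n i" using Cons.prems(1) x j by (auto simp: Cons_in_addrs)
  then show ?case using Cons.IH[OF a(2)] Cons.prems(2) gvert_in_gverts[OF a(2) _ a(1), of k] x j by auto
qed

lemma card_gverts_ge: "0 < k \<Longrightarrow> n \<le> card (gverts n k)"
proof -
  assume "0 < k"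
  then have "gvert [] ` {..<n} \<subseteq> gverts n k" using gvert_in_gverts[of "[]" n 0 k] by (auto simp: addrs_0)
  then have "card (gvert [] ` {..<n}) \<le> card (gverts n k)" by (rule card_mono[OF finite_gverts])
  then show ?thesis by (simp add: card_image[OF inj_gvert])
qed

text \<open>For fixed \<open>k\<close> this is polynomial in \<open>n\<close>, so a small power of
  the vertex count is still a small power of \<open>n\<close>.\<close>

lemma card_gverts_le:
  assumes "1 \<le> n"
  shows "card (gverts n k) \<le> (2 * n + 2) ^ Suc k"
proof -
  have "card (gverts n k) \<le> card {0, 1 :: nat} + card ((\<lambda>(a, v). gvert a v) ` ((\<Union>j<k. addrs n j) \<times> {..<n}))"
    unfolding gverts_def by (rule card_Un_le)
  also have "\<dots> \<le> 2 + card ((\<Union>j<k. addrs n j) \<times> {..<n})"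
    by (intro add_mono card_image_le) (auto simp: finite_addrs)
  also have "\<dots> \<le> 2 + (\<Sum>j<k. card (addrs n j)) * n"
    unfolding card_cartesian_product card_lessThan by (intro add_left_mono mult_le_mono1 card_UN_le) auto
  also have "\<dots> \<le> (2 * n + 2) ^ Suc k"
  proof (induction k)
    case (Suc k)
    have "(2 * n) ^ k * n \<le> (2 * n + 2) ^ k * (2 * n + 2)" by (intro mult_le_mono power_mono) auto
    also have "\<dots> = (2 * n + 2) ^ Suc k" by simp
    finally have "(2 * n) ^ k * n \<le> (2 * n + 2) ^ Suc k" .
    moreover have "(\<Sum>j<Suc k. card (addrs n j)) * n = (\<Sum>j<k. card (addrs n j)) * n + (2 * n) ^ k * n"
      by (simp add: card_addrs distrib_right)
    ultimately have "2 + (\<Sum>j<Suc k. card (addrs n j)) * n \<le> (2 * n + 2) ^ Suc k + (2 * n + 2) ^ Suc k"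
      using Suc by linarith
    also have "\<dots> = 2 * (2 * n + 2) ^ Suc k" by simp
    also have "\<dots> \<le> (2 * n + 2) * (2 * n + 2) ^ Suc k" by (intro mult_le_mono1) auto
    finally show ?case by simp
  qed simp
  finally show ?thesis .
qed

text \<open>Capacities and demands collect the weights of all indices with the same edge. Sums over
  edges thus become sums over indices, whether or not different indices give the same edge.\<close>

lemma weighted_image_sum:
  fixes c :: "'i \<Rightarrow> real"
  assumes "finite A"
  shows "(\<Sum>e\<in>f ` A. (\<Sum>a\<in>{a \<in> A. f a = e}. c a) * y e) = (\<Sum>a\<in>A. c a * y (f a))"
  unfolding sum.image_gen[OF assms, of _ f] sum_distrib_right by (intro sum.cong) auto

lemma weighted_image_boundary:
  fixes c :: "'i \<Rightarrow> real"
  assumes "finite A"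
  shows "(\<Sum>e\<in>edge_boundary (f ` A) S. (\<Sum>a\<in>{a \<in> A. f a = e}. c a)) = (\<Sum>a\<in>A. c a * of_bool (card (f a \<inter> S) = 1))"
proof -
  have "(\<Sum>e\<in>edge_boundary (f ` A) S. (\<Sum>a\<in>{a \<in> A. f a = e}. c a)) =
     (\<Sum>e\<in>f ` A. (\<Sum>a\<in>{a \<in> A. f a = e}. c a) * of_bool (card (e \<inter> S) = 1))"
    unfolding edge_boundary_def using assms by (intro sum.mono_neutral_cong_left) auto
  then show ?thesis by (simp add: weighted_image_sum[OF assms])
qed

lemma card_pair_Int: "u \<noteq> v \<Longrightarrow> card ({u, v} \<inter> S) = 1 \<longleftrightarrow> (u \<in> S) \<noteq> (v \<in> S)"
  by (cases "u \<in> S"; cases "v \<in> S") auto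

definition level_cut :: "nat \<Rightarrow> (nat \<Rightarrow> real) \<Rightarrow> (nat \<Rightarrow> bool) \<Rightarrow> nat \<Rightarrow> real" where
  "level_cut n p f j = (\<Sum>a\<in>addrs n j. weight p a * of_bool (f (src a) \<noteq> f (snk a)))"

lemma level_cut_Suc:
  "level_cut n p f (Suc j) = (\<Sum>a\<in>addrs n j. weight p a *
     (\<Sum>v<n. p v * (of_bool (f (gvert a v) \<noteq> f (snk a)) + of_bool (f (src a) \<noteq> f (gvert a v)))))"
  unfolding level_cut_def sum_addrs_Suc sum_distrib_left
  by (intro sum.cong refl) (simp add: algebra_simps)

section \<open>Cuts of the iterated instance\<close>

locale base_graph =
  fixes n :: nat and EH :: "nat set set" and w :: "nat set \<Rightarrow> real" and \<eta> :: real
  assumes n: "2 \<le> n" and simple: "simple_graph {..<n} EH" and w: "\<And>h. h \<in> EH \<Longrightarrow> 0 < w h"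
    and w1: "(\<Sum>h\<in>EH. w h) = 1" and \<eta>: "0 < \<eta>"
    and cut: "\<And>A. (\<Sum>h\<in>edge_boundary EH A. w h) \<le> 1 / 2 + \<eta>"
begin

lemma finite_EH: "finite EH"
  using simple by (auto simp: simple_graph_def intro: finite_subset[of _ "Pow {..<n}"])

lemma edgeE:
  assumes "h \<in> EH"
  obtains u v where "h = {u, v}" "u \<noteq> v" "u < n" "v < n"
  using assms simple unfolding simple_graph_def by (metis card_2_iff insert_subset lessThan_iff)

text \<open>Half of the mass follows the weighted degrees in \<open>H\<close>, so that cuts of
  \<open>H\<close> are bounded by the mass of a side; the other half is uniform and keeps capacities
  positive at isolated vertices.\<close>

definition p :: "nat \<Rightarrow> real" where
  "p v = (\<Sum>h\<in>{h \<in> EH. v \<in> h}. w h) / 4 + 1 / (2 * n)"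

definition cutw :: "nat set \<Rightarrow> real" where
  "cutw A = (\<Sum>h\<in>edge_boundary EH A. w h)"

lemma p_pos: "0 < p v"
proof -
  have "0 \<le> (\<Sum>h\<in>{h \<in> EH. v \<in> h}. w h)" using w by (intro sum_nonneg) (auto intro: less_imp_le)
  then show ?thesis using n by (simp add: p_def add_nonneg_pos)
qed

lemma sum_degrees:
  assumes "A \<subseteq> {..<n}"
  shows "(\<Sum>v\<in>A. \<Sum>h\<in>{h \<in> EH. v \<in> h}. w h) = (\<Sum>h\<in>EH. w h * card (h \<inter> A))"
proof -
  have fA: "finite A" using assms by (rule finite_subset) simp
  have "(\<Sum>v\<in>A. \<Sum>h\<in>{h \<in> EH. v \<in> h}. w h) = (\<Sum>h\<in>EH. \<Sum>v\<in>{v \<in> A. v \<in> h}. w h)"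
    by (rule sum.swap_restrict[OF fA finite_EH])
  also have "\<dots> = (\<Sum>h\<in>EH. w h * card (h \<inter> A))"
    by (intro sum.cong refl) (simp add: mult.commute Int_def conj_commute)
  finally show ?thesis .
qed

lemma sum_p: "(\<Sum>v<n. p v) = 1"
proof -
  have "(\<Sum>v<n. p v) = (\<Sum>v<n. \<Sum>h\<in>{h \<in> EH. v \<in> h}. w h) / 4 + 1 / 2"
    unfolding p_def sum.distrib sum_divide_distrib[symmetric] using n by simp
  also have "(\<Sum>v<n. \<Sum>h\<in>{h \<in> EH. v \<in> h}. w h) = (\<Sum>h\<in>EH. w h * 2)"
    unfolding sum_degrees[OF subset_refl]
  proof (intro sum.cong refl)
    fix h assume "h \<in> EH"
    then have "h \<inter> {..<n} = h" "card h = 2" using simple by (auto simp: simple_graph_def)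
    then show "w h * card (h \<inter> {..<n}) = w h * 2" by simp
  qed
  also have "\<dots> = 2" by (simp add: sum_distrib_right[symmetric] w1)
  finally show ?thesis by simp
qed

lemma cutw_le_p:
  assumes "A \<subseteq> {..<n}"
  shows "cutw A \<le> 4 * (\<Sum>v\<in>A. p v)"
proof -
  have "cutw A \<le> (\<Sum>h\<in>EH. w h * card (h \<inter> A))"
  proof -
    have "cutw A = (\<Sum>h\<in>edge_boundary EH A. w h * card (h \<inter> A))"
      unfolding cutw_def edge_boundary_def by (intro sum.cong) auto
    also have "\<dots> \<le> (\<Sum>h\<in>EH. w h * card (h \<inter> A))"
      by (rule sum_mono2[OF finite_EH]) (auto simp: edge_boundary_def intro!: mult_nonneg_nonneg less_imp_le[OF w])
    finally show ?thesis .
  qed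
  also have "\<dots> \<le> 4 * (\<Sum>v\<in>A. p v)"
    unfolding sum_degrees[OF assms, symmetric] p_def sum.distrib sum_divide_distrib[symmetric] by simp
  finally show ?thesis .
qed

lemma cutw_compl: "cutw ({..<n} - A) = cutw A"
proof -
  have "card (h \<inter> ({..<n} - A)) = 1 \<longleftrightarrow> card (h \<inter> A) = 1" if hE: "h \<in> EH" for h
  proof -
    obtain u v where h: "h = {u, v}" "u \<noteq> v" "u < n" "v < n" using hE by (rule edgeE)
    show ?thesis unfolding h(1) card_pair_Int[OF h(2)] using h by auto
  qed
  then show ?thesis unfolding cutw_def edge_boundary_def by (intro sum.cong) auto
qed

lemma cutw_restrict: "cutw (A \<inter> {..<n}) = cutw A"
proof -
  have "h \<inter> (A \<inter> {..<n}) = h \<inter> A" if "h \<in> EH" for h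
    using that simple by (auto simp: simple_graph_def)
  then show ?thesis unfolding cutw_def edge_boundary_def by (intro sum.cong) auto
qed

definition cap :: "nat \<Rightarrow> nat set \<Rightarrow> real" where
  "cap k e = (\<Sum>a\<in>{a \<in> addrs n k. supply_edge a = e}. weight p a)"

definition dem_index :: "nat \<Rightarrow> (addr \<times> nat set) set" where
  "dem_index k = (\<Union>j<k. addrs n j) \<times> EH"

definition dem_edge :: "addr \<times> nat set \<Rightarrow> nat set" where
  "dem_edge x = gvert (fst x) ` snd x"

definition dem :: "nat \<Rightarrow> nat set \<Rightarrow> real" where
  "dem k e = (\<Sum>x\<in>{x \<in> dem_index k. dem_edge x = e}. weight p (fst x) * w (snd x))"

abbreviation EG :: "nat \<Rightarrow> nat set set" where "EG k \<equiv> supply_edge ` addrs n k"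
abbreviation ED :: "nat \<Rightarrow> nat set set" where "ED k \<equiv> dem_edge ` dem_index k"

lemma finite_dem_index: "finite (dem_index k)"
  by (auto simp: dem_index_def finite_addrs finite_EH)

lemma sum_dem_index: "(\<Sum>x\<in>dem_index k. F x) = (\<Sum>j<k. \<Sum>a\<in>addrs n j. \<Sum>h\<in>EH. F (a, h) :: real)"
proof -
  have "(\<Sum>x\<in>dem_index k. F x) = (\<Sum>a\<in>(\<Union>j<k. addrs n j). \<Sum>h\<in>EH. F (a, h))"
    unfolding dem_index_def sum.cartesian_product by simp
  also have "\<dots> = (\<Sum>j<k. \<Sum>a\<in>addrs n j. \<Sum>h\<in>EH. F (a, h))"
    by (rule sum.UNION_disjoint) (auto simp: finite_addrs, auto simp: addrs_def)
  finally show ?thesis .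
qed

lemma instance_ok:
  assumes "0 < k"
  shows "sparsest_cut_instance (gverts n k) (EG k) (cap k) (ED k) (dem k)"
  unfolding sparsest_cut_instance_def
proof (intro conjI ballI)
  show "simple_graph (gverts n k) (EG k)"
    unfolding simple_graph_def supply_edge_def
    using finite_gverts src_snk_in_gverts[of _ n k k] src_neq_snk by auto
  show "0 < cap k e" if "e \<in> EG k" for e
    unfolding cap_def using that
    by (intro sum_pos) (auto simp: finite_addrs intro!: weight_pos p_pos)
  show "simple_graph (gverts n k) (ED k)"
    unfolding simple_graph_def
  proof (intro conjI ballI finite_gverts)
    fix e assume "e \<in> ED k"
    then obtain a h j where e: "e = gvert a ` h" "a \<in> addrs n j" "j < k" "h \<in> EH"
      by (auto simp: dem_edge_def dem_index_def)
    then obtain u v where "h = {u, v}" "u \<noteq> v" "u < n" "v < n" by (auto elim: edgeE)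
    then show "e \<subseteq> gverts n k" "card e = 2" using e by (auto intro: gvert_in_gverts)
  qed
  show "0 < dem k e" if "e \<in> ED k" for e
    unfolding dem_def using that
    by (intro sum_pos) (auto simp: finite_dem_index, auto simp: dem_index_def intro!: mult_pos_pos weight_pos p_pos w)
  have "EH \<noteq> {}" using w1 by auto
  then show "ED k \<noteq> {}" using assms by (auto simp: dem_index_def addrs_0 intro!: bexI[of _ 0])
qed

lemma cap_boundary: "(\<Sum>e\<in>edge_boundary (EG k) S. cap k e) = level_cut n p (\<lambda>x. x \<in> S) k"
  unfolding cap_def weighted_image_boundary[OF finite_addrs] level_cut_def
  by (simp add: supply_edge_def card_pair_Int[OF src_neq_snk, unfolded One_nat_def])

lemma dem_boundary:
  "(\<Sum>e\<in>edge_boundary (ED k) S. dem k e) = (\<Sum>j<k. \<Sum>a\<in>addrs n j. weight p a * cutw {v. gvert a v \<in> S})"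
proof -
  have c: "card (gvert a ` h \<inter> S) = card (h \<inter> {v. gvert a v \<in> S})" for a h
  proof -
    have "gvert a ` h \<inter> S = gvert a ` (h \<inter> {v. gvert a v \<in> S})" by auto
    then show ?thesis by (simp add: card_image[OF inj_gvert])
  qed
  have "(\<Sum>h\<in>EH. w h * of_bool (card (h \<inter> A) = 1)) = cutw A" for A
    unfolding cutw_def edge_boundary_def using finite_EH by (intro sum.mono_neutral_cong_right) auto
  then show ?thesis
    unfolding dem_def weighted_image_boundary[OF finite_dem_index] sum_dem_index
    by (simp add: dem_edge_def c mult.assoc sum_distrib_left[symmetric])
qed

text \<open>If the ends are separated, each middle vertex cuts exactly one of its two edges, so the
  capacity stays 1 while at most \<open>1 / 2 + \<eta>\<close> of the demand is gained. If they are
  not, splitting off \<open>A\<close> costs twice its mass and gains at most four times its mass,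
  which \<open>2 * \<sigma> \<le> \<alpha>\<close> pays for.\<close>

lemma gadget_inequality:
  fixes f :: "nat \<Rightarrow> bool"
  assumes \<sigma>: "0 \<le> \<sigma>" and \<alpha>: "2 * \<sigma> \<le> \<alpha>"
  shows "(\<alpha> - \<sigma> * (1 / 2 + \<eta>)) * of_bool (f s \<noteq> f t) \<le>
    \<alpha> * (\<Sum>v<n. p v * (of_bool (f (gvert a v) \<noteq> f t) + of_bool (f s \<noteq> f (gvert a v)))) - \<sigma> * cutw {v. f (gvert a v)}"
proof (cases "f s = f t")
  case False
  have "(\<Sum>v<n. p v * (of_bool (f (gvert a v) \<noteq> f t) + of_bool (f s \<noteq> f (gvert a v)))) = (\<Sum>v<n. p v)"
    by (intro sum.cong refl) (use False in auto)
  moreover have "\<sigma> * cutw {v. f (gvert a v)} \<le> \<sigma> * (1 / 2 + \<eta>)"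
    using cut \<sigma> unfolding cutw_def by (intro mult_left_mono) auto
  ultimately show ?thesis using False by (simp add: sum_p)
next
  case True
  define A where "A = {v \<in> {..<n}. f (gvert a v) \<noteq> f t}"
  have "(\<Sum>v<n. p v * (of_bool (f (gvert a v) \<noteq> f t) + of_bool (f s \<noteq> f (gvert a v)))) = (\<Sum>v\<in>A. 2 * p v)"
    unfolding A_def by (rule sum.mono_neutral_cong_right) (use True in auto)
  then have s: "(\<Sum>v<n. p v * (of_bool (f (gvert a v) \<noteq> f t) + of_bool (f s \<noteq> f (gvert a v)))) = 2 * (\<Sum>v\<in>A. p v)"
    by (simp add: sum_distrib_left)
  have "cutw {v. f (gvert a v)} = cutw A"
  proof (cases "f t")
    case True
    then have "A = {..<n} - {v. f (gvert a v)}" by (auto simp: A_def)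
    then show ?thesis by (simp add: cutw_compl)
  next
    case False
    then have "A = {v. f (gvert a v)} \<inter> {..<n}" by (auto simp: A_def)
    then show ?thesis by (simp add: cutw_restrict)
  qed
  also have "\<dots> \<le> 4 * (\<Sum>v\<in>A. p v)" by (rule cutw_le_p) (auto simp: A_def)
  finally have "\<sigma> * cutw {v. f (gvert a v)} \<le> \<sigma> * (4 * (\<Sum>v\<in>A. p v))" using \<sigma> by (intro mult_left_mono) auto
  also have "\<dots> = 2 * \<sigma> * (2 * (\<Sum>v\<in>A. p v))" by simp
  also have "\<dots> \<le> \<alpha> * (2 * (\<Sum>v\<in>A. p v))"
    using \<alpha> p_pos by (intro mult_right_mono mult_nonneg_nonneg sum_nonneg) (auto intro: less_imp_le)
  finally show ?thesis unfolding s using True by simp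
qed

lemma level_inequality:
  assumes \<sigma>: "0 \<le> \<sigma>" and \<alpha>: "2 * \<sigma> \<le> \<alpha>"
  shows "(\<alpha> - \<sigma> * (1 / 2 + \<eta>)) * level_cut n p f j \<le>
    \<alpha> * level_cut n p f (Suc j) - \<sigma> * (\<Sum>a\<in>addrs n j. weight p a * cutw {v. f (gvert a v)})"
proof -
  let ?I = "\<lambda>a. \<Sum>v<n. p v * (of_bool (f (gvert a v) \<noteq> f (snk a)) + of_bool (f (src a) \<noteq> f (gvert a v)))"
  have "(\<alpha> - \<sigma> * (1 / 2 + \<eta>)) * level_cut n p f j =
      (\<Sum>a\<in>addrs n j. weight p a * ((\<alpha> - \<sigma> * (1 / 2 + \<eta>)) * of_bool (f (src a) \<noteq> f (snk a))))"
    unfolding level_cut_def sum_distrib_left by (intro sum.cong refl) (simp only: mult_ac)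
  also have "\<dots> \<le> (\<Sum>a\<in>addrs n j. weight p a * (\<alpha> * ?I a - \<sigma> * cutw {v. f (gvert a v)}))"
    by (intro sum_mono mult_left_mono gadget_inequality assms) (auto intro!: less_imp_le[OF weight_pos] p_pos)
  also have "\<dots> = (\<Sum>a\<in>addrs n j. \<alpha> * (weight p a * ?I a)) - (\<Sum>a\<in>addrs n j. \<sigma> * (weight p a * cutw {v. f (gvert a v)}))"
    unfolding sum_subtractf[symmetric] by (intro sum.cong refl) (simp only: right_diff_distrib mult.left_commute)
  finally show ?thesis unfolding level_cut_Suc sum_distrib_left[symmetric] .
qed

text \<open>Each level charges \<open>\<sigma> * (1 / 2 + \<eta>)\<close> to the coefficient of the
  cut. This \<open>\<sigma>\<close> exhausts the budget 1 in \<open>k\<close> levels except for the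
  reserve \<open>2 * \<sigma>\<close> that the gadget inequality demands, the source of the additive
  2.\<close>

lemma cut_inequality:
  assumes \<sigma>: "\<sigma> = 1 / (2 + k * (1 / 2 + \<eta>))"
  shows "\<sigma> * (\<Sum>j<k. \<Sum>a\<in>addrs n j. weight p a * cutw {v. f (gvert a v)}) \<le> level_cut n p f k"
proof -
  let ?\<beta> = "1 / 2 + \<eta>"
  define Dm where "Dm j = (\<Sum>a\<in>addrs n j. weight p a * cutw {v. f (gvert a v)})" for j
  have \<beta>: "0 < ?\<beta>" using \<eta> by simp
  have pos: "0 < 2 + k * ?\<beta>" using \<beta> by (intro add_pos_nonneg) auto
  have \<sigma>0: "0 < \<sigma>" unfolding \<sigma> using pos by simp
  have \<sigma>1: "\<sigma> * (2 + k * ?\<beta>) = 1" unfolding \<sigma> using pos by simp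
  \<comment> \<open>Backward induction from level \<open>k\<close>, where the coefficient is 1 and
    no demand has been counted yet.\<close>
  have "(1 - real (k - i) * (\<sigma> * ?\<beta>)) * level_cut n p f i + \<sigma> * (\<Sum>j\<in>{i..<k}. Dm j) \<le> level_cut n p f k" if "i \<le> k" for i
    using that
  proof (induction i rule: inc_induct)
    case base
    then show ?case by simp
  next
    case (step i)
    let ?\<alpha> = "1 - real (k - Suc i) * (\<sigma> * ?\<beta>)"
    have "real (k - Suc i) * (\<sigma> * ?\<beta>) \<le> k * (\<sigma> * ?\<beta>)" using \<sigma>0 \<beta> by (intro mult_right_mono) auto
    moreover have "k * (\<sigma> * ?\<beta>) = 1 - 2 * \<sigma>" using \<sigma>1 by (simp add: algebra_simps)
    ultimately have "2 * \<sigma> \<le> ?\<alpha>" by linarith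
    from level_inequality[OF less_imp_le[OF \<sigma>0] this, of f i]
    have 1: "(?\<alpha> - \<sigma> * ?\<beta>) * level_cut n p f i + \<sigma> * Dm i \<le> ?\<alpha> * level_cut n p f (Suc i)"
      unfolding Dm_def by linarith
    have "real (k - i) = real (k - Suc i) + 1" using step.hyps by (simp add: of_nat_diff)
    then have 2: "1 - real (k - i) * (\<sigma> * ?\<beta>) = ?\<alpha> - \<sigma> * ?\<beta>" by (simp only: distrib_right mult_1)
    have 3: "(\<Sum>j\<in>{i..<k}. Dm j) = Dm i + (\<Sum>j\<in>{Suc i..<k}. Dm j)"
      using step.hyps by (simp add: sum.atLeast_Suc_lessThan)
    have 4: "\<sigma> * (Dm i + (\<Sum>j\<in>{Suc i..<k}. Dm j)) = \<sigma> * Dm i + \<sigma> * (\<Sum>j\<in>{Suc i..<k}. Dm j)"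
      by (rule distrib_left)
    show ?case unfolding 2 3 4 using 1 step.IH by linarith
  qed
  from this[of 0] have "(1 - k * (\<sigma> * ?\<beta>)) * level_cut n p f 0 + \<sigma> * (\<Sum>j<k. Dm j) \<le> level_cut n p f k"
    by (simp add: atLeast0LessThan)
  moreover have "0 \<le> (1 - k * (\<sigma> * ?\<beta>)) * level_cut n p f 0"
  proof (rule mult_nonneg_nonneg)
    show "0 \<le> 1 - k * (\<sigma> * ?\<beta>)" using \<sigma>1 \<sigma>0 by (simp add: algebra_simps)
    show "0 \<le> level_cut n p f 0" by (simp add: level_cut_def addrs_0)
  qed
  ultimately show ?thesis unfolding Dm_def by linarith
qed

lemma min_sparsity_ge:
  assumes "0 < k"
  shows "1 / (2 + k * (1 / 2 + \<eta>)) \<le> min_sparsity (gverts n k) (EG k) (cap k) (ED k) (dem k)"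
proof -
  let ?M = "{sparsity (EG k) (cap k) (ED k) (dem k) S | S. S \<subseteq> gverts n k \<and> 0 < (\<Sum>e\<in>edge_boundary (ED k) S. dem k e)}"
  have "?M \<subseteq> sparsity (EG k) (cap k) (ED k) (dem k) ` Pow (gverts n k)" by auto
  then have fM: "finite ?M" by (rule finite_subset) (simp add: finite_gverts)
  have "EH \<noteq> {}" using w1 by auto
  then obtain h where h: "h \<in> EH" by blast
  obtain u v where uv: "h = {u, v}" "u \<noteq> v" "u < n" "v < n" using h by (rule edgeE)
  \<comment> \<open>A singleton that separates some demand shows that the minimum ranges over a
    nonempty set.\<close>
  have "gvert [] ` h \<in> edge_boundary (ED k) {gvert [] u}"
  proof -
    have "([], h) \<in> dem_index k" using h assms by (auto simp: dem_index_def addrs_0 intro!: bexI[of _ 0])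
    then have "gvert [] ` h \<in> ED k" by (force simp: dem_edge_def)
    moreover have "gvert [] ` h \<inter> {gvert [] u} = {gvert [] u}" using uv by auto
    ultimately show ?thesis by (simp add: edge_boundary_def)
  qed
  moreover have "finite (edge_boundary (ED k) {gvert [] u})" by (simp add: edge_boundary_def finite_dem_index)
  moreover have "0 < dem k e" if "e \<in> edge_boundary (ED k) {gvert [] u}" for e
    using that instance_ok[OF assms] by (auto simp: edge_boundary_def sparsest_cut_instance_def)
  ultimately have "0 < (\<Sum>e\<in>edge_boundary (ED k) {gvert [] u}. dem k e)"
    by (intro sum_pos) auto
  moreover have "{gvert [] u} \<subseteq> gverts n k"
    using assms uv gvert_in_gverts[of "[]" n 0 k u] by (simp add: addrs_0)
  ultimately have nM: "?M \<noteq> {}" by blast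
  show ?thesis
    unfolding min_sparsity_def
  proof (subst Min_ge_iff[OF fM nM], intro ballI)
    fix q assume "q \<in> ?M"
    then obtain S where q: "q = sparsity (EG k) (cap k) (ED k) (dem k) S" and S: "0 < (\<Sum>e\<in>edge_boundary (ED k) S. dem k e)" by auto
    have "1 / (2 + k * (1 / 2 + \<eta>)) * (\<Sum>e\<in>edge_boundary (ED k) S. dem k e) \<le> (\<Sum>e\<in>edge_boundary (EG k) S. cap k e)"
      unfolding cap_boundary dem_boundary using cut_inequality[OF refl, of k "\<lambda>x. x \<in> S"] by simp
    then show "1 / (2 + k * (1 / 2 + \<eta>)) \<le> q"
      unfolding q sparsity_def pos_le_divide_eq[OF S] .
  qed
qed

end

section \<open>Treewidth\<close>

text \<open>The first vertex of a longest path is a leaf: a further neighbour would either prolong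
  the path or close a cycle.\<close>

lemma tree_leaf:
  assumes T: "is_tree I F" and "1 < card I"
  shows "\<exists>l\<in>I. \<exists>q\<in>I. l \<noteq> q \<and> {l, q} \<in> F \<and> (\<forall>x. {l, x} \<in> F \<longrightarrow> x = q)"
proof -
  have finI: "finite I" and FI: "\<And>e. e \<in> F \<Longrightarrow> e \<subseteq> I \<and> card e = 2"
    and conn: "\<And>u v. u \<in> I \<Longrightarrow> v \<in> I \<Longrightarrow> (u, v) \<in> {(a, b). {a, b} \<in> F}\<^sup>*"
    and nocyc: "\<And>c. \<not> is_cycle F c"
    using T by (auto simp: is_tree_def simple_graph_def connected_graph_def)
  have ne: "x \<noteq> y \<and> x \<in> I \<and> y \<in> I" if "{x, y} \<in> F" for x y
    using FI[OF that] by (cases "x = y") auto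
  define path where "path p \<longleftrightarrow> p \<noteq> [] \<and> distinct p \<and> set p \<subseteq> I \<and> (\<forall>i. Suc i < length p \<longrightarrow> {p ! i, p ! Suc i} \<in> F)" for p
  obtain x where x: "x \<in> I" using assms(2) by fastforce
  have len: "length p < Suc (card I)" if "path p" for p
    using that card_mono[OF finI, of "set p"] by (simp add: path_def distinct_card less_Suc_eq_le)
  have "path [x]" using x by (simp add: path_def)
  then obtain p where p: "path p" "\<And>q. path q \<Longrightarrow> length q \<le> length p"
    using ex_has_greatest_nat[of path "[x]" length "Suc (card I)"] len by (metis less_imp_le)
  obtain l p' where p': "p = l # p'" using p(1) by (cases p) (auto simp: path_def)
  have l: "l \<in> I" using p(1) p' by (auto simp: path_def)
  have nbr_in: "y \<in> set p" if y: "{l, y} \<in> F" for y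
  proof (rule ccontr)
    assume "y \<notin> set p"
    moreover have "{(y # p) ! i, (y # p) ! Suc i} \<in> F" if "Suc i < length (y # p)" for i
      using that p(1) p' y by (cases i) (auto simp: path_def insert_commute)
    ultimately have "path (y # p)" using p(1) ne[OF y] by (auto simp: path_def)
    then show False using p(2) by fastforce
  qed
  have nbr_eq: "y = hd p' \<and> p' \<noteq> []" if y: "{l, y} \<in> F" for y
  proof -
    have "y \<in> set p'" using nbr_in[OF y] ne[OF y] p' by auto
    then obtain i where i: "i < length p'" "p' ! i = y" by (auto simp: in_set_conv_nth)
    have "i = 0"
    proof (rule ccontr)
      assume "i \<noteq> 0"
      let ?c = "take (Suc (Suc i)) p"
      have lc: "length ?c = Suc (Suc i)" using i p' by simp
      have "is_cycle F ?c"
        unfolding is_cycle_def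
      proof (intro conjI allI impI)
        show "3 \<le> length ?c" using lc \<open>i \<noteq> 0\<close> by simp
        show "distinct ?c" using p(1) by (simp add: path_def)
        fix j assume j: "j < length ?c"
        show "{?c ! j, ?c ! (Suc j mod length ?c)} \<in> F"
        proof (cases "j = Suc i")
          case True
          then have "?c ! j = y" "?c ! (Suc j mod length ?c) = l" using lc i p' by auto
          then show ?thesis using y by (simp add: insert_commute)
        next
          case False
          then have j': "Suc j < Suc (Suc i)" using j lc by simp
          then have "?c ! j = p ! j" "?c ! (Suc j mod length ?c) = p ! Suc j"
            unfolding lc by (simp_all only: mod_less nth_take Suc_lessD)
          moreover have "Suc j < length p" using j' i p' by simp
          ultimately show ?thesis using p(1) by (simp add: path_def)
        qed
      qed
      then show False using nocyc by blast
    qed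
    then show ?thesis using i by (cases p') auto
  qed
  obtain z where z: "z \<in> I" "z \<noteq> l"
    using assms(2) by (metis card_1_singleton_iff card_le_Suc0_iff_eq[OF finI] One_nat_def l not_le)
  from conn[OF l z(1)] z(2) obtain y where "{l, y} \<in> F"
    by (auto elim: converse_rtranclE)
  then show ?thesis using nbr_eq ne l by metis
qed

lemma connected_remove_leaf:
  assumes "(u, v) \<in> {(a, b). {a, b} \<in> F}\<^sup>*" "u \<noteq> l" "v \<noteq> l" and leaf: "\<And>x. {l, x} \<in> F \<Longrightarrow> x = q"
  shows "(u, v) \<in> {(a, b). {a, b} \<in> {e \<in> F. l \<notin> e}}\<^sup>*"
proof -
  let ?R = "{(a, b). {a, b} \<in> {e \<in> F. l \<notin> e}}\<^sup>*"
  \<comment> \<open>The walk enters and leaves \<open>l\<close> only through \<open>q\<close>; while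
    it is at \<open>l\<close>, the invariant therefore keeps track of \<open>q\<close>.\<close>
  have "(v \<noteq> l \<longrightarrow> (u, v) \<in> ?R) \<and> (v = l \<longrightarrow> (u, q) \<in> ?R)"
    using assms(1)
  proof (induction rule: rtrancl_induct)
    case base
    then show ?case using assms(2) by auto
  next
    case (step y z)
    show ?case
    proof (cases "y = l")
      case True
      then have "z = q" using step.hyps leaf by auto
      then show ?thesis using step.IH True by auto
    next
      case False
      show ?thesis
      proof (cases "z = l")
        case True
        then have "{l, y} \<in> F" using step.hyps by (simp add: insert_commute)
        then show ?thesis using leaf[of y] step.IH False True by auto
      next
        case z: False
        then have "(y, z) \<in> {(a, b). {a, b} \<in> {e \<in> F. l \<notin> e}}" using step.hyps False by auto
        then show ?thesis using step.IH False z by (auto intro: rtrancl_into_rtrancl)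
      qed
    qed
  qed
  then show ?thesis using assms(3) by blast
qed

lemma tree_remove_leaf:
  assumes T: "is_tree I F" and l: "l \<in> I" "q \<in> I" "l \<noteq> q" "\<And>x. {l, x} \<in> F \<Longrightarrow> x = q"
  shows "is_tree (I - {l}) {e \<in> F. l \<notin> e}"
  unfolding is_tree_def
proof (intro conjI)
  show "simple_graph (I - {l}) {e \<in> F. l \<notin> e}"
    using T by (auto simp: is_tree_def simple_graph_def)
  show "connected_graph (I - {l}) {e \<in> F. l \<notin> e}"
    unfolding connected_graph_def
  proof (intro conjI ballI)
    show "I - {l} \<noteq> {}" using l by auto
    fix u v assume "u \<in> I - {l}" "v \<in> I - {l}"
    then show "(u, v) \<in> {(a, b). {a, b} \<in> {e \<in> F. l \<notin> e}}\<^sup>*"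
      using T l by (intro connected_remove_leaf[of _ _ _ _ q]) (auto simp: is_tree_def connected_graph_def)
  qed
  show "\<nexists>c. is_cycle {e \<in> F. l \<notin> e} c"
    using T by (auto simp: is_tree_def is_cycle_def)
qed

text \<open>If no bag has more than two vertices, pruning leaf bags contained in their neighbour ends at a leaf
  bag owning a vertex all of whose edges lie in this bag.\<close>

lemma small_bags_low_degree:
  assumes "tree_decomposition V E I F B" "\<And>i. i \<in> I \<Longrightarrow> card (B i) \<le> 2 \<and> finite (B i)" "V \<noteq> {}"
    "\<And>e. e \<in> E \<Longrightarrow> card e = 2"
  shows "\<exists>v\<in>V. \<exists>x. \<forall>y. {v, y} \<in> E \<longrightarrow> y = x"
  using assms
proof (induction "card I" arbitrary: I F rule: less_induct)
  case less
  have T: "is_tree I F" and UB: "(\<Union>i\<in>I. B i) = V" and EB: "\<And>e. e \<in> E \<Longrightarrow> \<exists>i\<in>I. e \<subseteq> B i"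
    and CB: "\<And>v. v \<in> V \<Longrightarrow> connected_graph {i \<in> I. v \<in> B i} (induced_edges F {i \<in> I. v \<in> B i})"
    using less.prems(1) by (auto simp: tree_decomposition_def)
  have finI: "finite I" using T by (simp add: is_tree_def simple_graph_def)
  have owner: "\<exists>v\<in>V. \<exists>x. \<forall>y. {v, y} \<in> E \<longrightarrow> y = x" if l: "l \<in> I" "v \<in> B l" and own: "\<And>i. i \<in> I \<Longrightarrow> v \<in> B i \<Longrightarrow> i = l" for l v
  proof -
    have sub: "y \<in> B l - {v}" if y: "{v, y} \<in> E" for y
    proof -
      obtain i where "i \<in> I" "{v, y} \<subseteq> B i" using EB[OF y] by blast
      moreover have "y \<noteq> v" using less.prems(4)[OF y] by auto
      ultimately show ?thesis using own by blast
    qed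
    have "card (B l - {v}) \<le> Suc 0" using less.prems(2)[OF l(1)] by (subst card_Diff_singleton[OF l(2)]) linarith
    then have "\<And>x y. x \<in> B l - {v} \<Longrightarrow> y \<in> B l - {v} \<Longrightarrow> x = y"
      using less.prems(2)[OF l(1)] by (subst (asm) card_le_Suc0_iff_eq) auto
    then have "\<exists>x. \<forall>y. {v, y} \<in> E \<longrightarrow> y = x" using sub by metis
    then show ?thesis using l UB by blast
  qed
  obtain v where v: "v \<in> V" using less.prems(3) by blast
  show ?case
  proof (cases "1 < card I")
    case False
    obtain l where l: "l \<in> I" "v \<in> B l" using v UB by blast
    have "\<And>i. i \<in> I \<Longrightarrow> i = l" using False l(1) finI by (metis One_nat_def card_le_Suc0_iff_eq not_less)
    then show ?thesis using owner[OF l] by blast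
  next
    case True
    then obtain l q where lq: "l \<in> I" "q \<in> I" "l \<noteq> q" "{l, q} \<in> F" "\<And>x. {l, x} \<in> F \<Longrightarrow> x = q"
      using tree_leaf[OF T] by blast
    show ?thesis
    proof (cases "B l \<subseteq> B q")
      case True
      let ?I = "I - {l}" and ?F = "{e \<in> F. l \<notin> e}"
      have "tree_decomposition V E ?I ?F B"
        unfolding tree_decomposition_def
      proof (intro conjI ballI)
        show "is_tree ?I ?F" by (rule tree_remove_leaf[OF T lq(1-3,5)])
        show "(\<Union>i\<in>?I. B i) = V" using UB True lq(1-3) by blast
        fix e assume "e \<in> E"
        then obtain i where "i \<in> I" "e \<subseteq> B i" using EB by blast
        then show "\<exists>i\<in>?I. e \<subseteq> B i" using True lq(2,3) by (cases "i = l") auto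
      next
        fix u assume u: "u \<in> V"
        let ?J = "{i \<in> I. u \<in> B i}" and ?J' = "{i \<in> ?I. u \<in> B i}"
        have C: "connected_graph ?J (induced_edges F ?J)" by (rule CB[OF u])
        have eq: "{e \<in> induced_edges F ?J. l \<notin> e} = induced_edges ?F ?J'"
          by (auto simp: induced_edges_def)
        show "connected_graph ?J' (induced_edges ?F ?J')"
          unfolding connected_graph_def
        proof (intro conjI ballI)
          obtain i where "i \<in> ?J" using C by (auto simp: connected_graph_def)
          then show "?J' \<noteq> {}" using True lq(2,3) by (cases "i = l") auto
          fix a b assume ab: "a \<in> ?J'" "b \<in> ?J'"
          then have "(a, b) \<in> {(a, b). {a, b} \<in> induced_edges F ?J}\<^sup>*" using C by (simp add: connected_graph_def)
          then show "(a, b) \<in> {(a, b). {a, b} \<in> induced_edges ?F ?J'}\<^sup>*"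
            unfolding eq[symmetric]
            by (rule connected_remove_leaf[where q = q]) (use ab lq(5) in \<open>auto simp: induced_edges_def\<close>)
        qed
      qed
      moreover have "card ?I < card I" using finI lq(1) by (rule card_Diff1_less)
      ultimately show ?thesis using less.prems(2-4) by (intro less.hyps[of ?I ?F]) auto
    next
      case False
      then obtain u where u: "u \<in> B l" "u \<notin> B q" by blast
      have "i = l" if i: "i \<in> I" "u \<in> B i" for i
      proof (rule ccontr)
        assume "i \<noteq> l"
        let ?J = "{i \<in> I. u \<in> B i}"
        have "u \<in> V" using UB lq(1) u by blast
        then have "(l, i) \<in> {(a, b). {a, b} \<in> induced_edges F ?J}\<^sup>*"
          using CB[of u] lq(1) u i by (simp add: connected_graph_def)
        then obtain y where "{l, y} \<in> induced_edges F ?J"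
          using \<open>i \<noteq> l\<close> by (auto elim: converse_rtranclE)
        then have "{l, y} \<in> F" "u \<in> B y" by (auto simp: induced_edges_def)
        then show False using lq(5) u by blast
      qed
      then show ?thesis using owner[OF lq(1) u(1)] by blast
    qed
  qed
qed

text \<open>A forest of parent pointers decreasing a rank: on a cycle, a vertex of maximal rank would have its parent
  as both neighbours.\<close>

lemma parent_tree:
  fixes rank :: "'i \<Rightarrow> nat"
  assumes I: "finite I" "z \<in> I"
    and par: "\<And>i. i \<in> I \<Longrightarrow> i \<noteq> z \<Longrightarrow> par i \<in> I \<and> rank (par i) < rank i"
  shows "is_tree I ((\<lambda>i. {i, par i}) ` (I - {z}))" (is "is_tree I ?F")
proof -
  let ?R = "{(a, b). {a, b} \<in> ?F}"
  have symR: "(a, b) \<in> ?R \<longleftrightarrow> (b, a) \<in> ?R" for a b by (simp add: insert_commute)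
  have sym: "(a, b) \<in> ?R\<^sup>* \<Longrightarrow> (b, a) \<in> ?R\<^sup>*" for a b
    using symD[OF sym_rtrancl[of ?R]] symR by (simp add: sym_def)
  have root: "(i, z) \<in> ?R\<^sup>*" if "i \<in> I" for i
    using that
  proof (induction "rank i" arbitrary: i rule: less_induct)
    case less
    show ?case
    proof (cases "i = z")
      case False
      then have "(i, par i) \<in> ?R" using less.prems by auto
      moreover have "(par i, z) \<in> ?R\<^sup>*" using par[OF less.prems False] by (intro less.hyps) auto
      ultimately show ?thesis by (rule converse_rtrancl_into_rtrancl)
    qed simp
  qed
  have "\<not> is_cycle ?F c" for c
  proof
    assume c: "is_cycle ?F c"
    let ?k = "length c"
    have k3: "3 \<le> ?k" and dc: "distinct c" and cF: "\<And>i. i < ?k \<Longrightarrow> {c ! i, c ! (Suc i mod ?k)} \<in> ?F"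
      using c by (auto simp: is_cycle_def)
    obtain m where m: "m < ?k" "\<And>i. i < ?k \<Longrightarrow> rank (c ! i) \<le> rank (c ! m)"
    proof -
      have "0 < ?k" using k3 by linarith
      then have "finite ((\<lambda>i. rank (c ! i)) ` {..<?k})" "(\<lambda>i. rank (c ! i)) ` {..<?k} \<noteq> {}"
        by (simp_all add: lessThan_empty_iff)
      from Max_in[OF this] Max_ge[OF this(1)] obtain i where "i < ?k" "\<And>j. j < ?k \<Longrightarrow> rank (c ! j) \<le> rank (c ! i)"
        by fastforce
      then show thesis by (rule that)
    qed
    have nbr: "c ! i = par (c ! m)" if ik: "i < ?k" and ie: "{c ! m, c ! i} \<in> ?F" for i
    proof -
      obtain j where j: "j \<in> I" "j \<noteq> z" "{c ! m, c ! i} = {j, par j}" using ie by auto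
      then consider "c ! m = j" "c ! i = par j" | "c ! m = par j" "c ! i = j" by (auto simp: doubleton_eq_iff)
      then show ?thesis
      proof cases
        case 2
        then show ?thesis using par[OF j(1,2)] m(2)[OF ik] by simp
      qed simp
    qed
    define a b where "a = Suc m mod ?k" and "b = (if m = 0 then ?k - 1 else m - 1)"
    have ab: "a < ?k" "b < ?k" "Suc b mod ?k = m" "a \<noteq> b"
      using m(1) k3 unfolding a_def b_def by (auto simp: mod_Suc)
    have "c ! a = par (c ! m)" using nbr[OF ab(1)] cF[OF m(1)] by (simp add: a_def)
    moreover have "c ! b = par (c ! m)" using nbr[OF ab(2)] cF[OF ab(2)] ab(3) by (simp add: insert_commute)
    ultimately show False using nth_eq_iff_index_eq[OF dc ab(1,2)] ab(4) by simp
  qed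
  moreover have "simple_graph I ?F"
    unfolding simple_graph_def
  proof (intro conjI ballI I(1))
    fix e assume "e \<in> ?F"
    then obtain i where i: "i \<in> I" "i \<noteq> z" "e = {i, par i}" by auto
    then have "par i \<in> I" "par i \<noteq> i" using par[OF i(1,2)] by auto
    then show "e \<subseteq> I" "card e = 2" using i by auto
  qed
  moreover have "connected_graph I ?F"
    unfolding connected_graph_def using I(2) root sym by (auto intro: rtrancl_trans)
  ultimately show ?thesis by (simp add: is_tree_def)
qed

definition bag :: "addr \<Rightarrow> nat \<Rightarrow> nat set" where
  "bag a v = {gvert a v, src a, snk a}"

text \<open>Upper bound: each subdivision vertex is a node whose bag also holds the ends of the edge
  it subdivides. Lower bound: every vertex has two neighbours, contrary to
  \<open>small_bags_low_degree\<close> if bags had at most two vertices.\<close>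

lemma treewidth_supply:
  assumes n: "2 \<le> n" and k: "0 < k"
  shows "treewidth (gverts n k) (supply_edge ` addrs n k) = 2"
proof -
  let ?V = "gverts n k" and ?E = "supply_edge ` addrs n k"
  define dec where "dec i = (from_nat (i - 2) :: addr \<times> nat)" for i
  have dec: "dec (gvert a v) = (a, v)" for a v by (simp add: dec_def gvert_def)
  define B where "B i = (if i < 2 then {0, 1} else case dec i of (a, v) \<Rightarrow> bag a v)" for i
  have B0: "B 0 = {0, 1}" by (simp add: B_def)
  have Bg: "B (gvert a v) = bag a v" for a v by (simp add: B_def dec) (simp add: gvert_def)
  \<comment> \<open>The edge \<open>a\<close> arose from the subdivision vertex addressed by its
    head and tail, whose bag contains both ends of \<open>a\<close>. The initial edge belongs to the
    root 0 with bag \<open>{0, 1}\<close>.\<close>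
  define par where "par i = (case fst (dec i) of [] \<Rightarrow> 0 | (x # a) \<Rightarrow> gvert a (fst x))" for i
  define rank where "rank i = (if i < 2 then 0 else Suc (length (fst (dec i))))" for i
  have rankg: "rank (gvert a v) = Suc (length a)" for a v by (simp add: rank_def dec) (simp add: gvert_def)
  have parg: "par (gvert [] v) = 0" "par (gvert ((v', b) # a) v) = gvert a v'" for a v v' b by (simp_all add: par_def dec)
  let ?I = "?V - {1}"
  let ?F = "(\<lambda>i. {i, par i}) ` (?I - {0})"
  have I0: "0 \<in> ?I" by (simp add: gverts_def)
  have Icases: "(\<exists>a v j. i = gvert a v \<and> a \<in> addrs n j \<and> j < k \<and> v < n) \<or> i = 0" if "i \<in> ?I" for i
  proof -
    have "i \<in> ?V" "i \<noteq> 1" using that by auto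
    from this(1) show ?thesis
    proof (cases rule: gverts_cases)
      case 2
      then show ?thesis using \<open>i \<noteq> 1\<close> by simp
    qed blast+
  qed
  have gI: "gvert a v \<in> ?I" if "a \<in> addrs n j" "j < k" "v < n" for a v j
    using gvert_in_gverts[OF that] by simp
  have par_ok: "par i \<in> ?I \<and> rank (par i) < rank i" if i: "i \<in> ?I" "i \<noteq> 0" for i
  proof -
    obtain a v j where a: "i = gvert a v" "a \<in> addrs n j" "j < k" "v < n" using Icases[OF i(1)] i(2) by blast
    show ?thesis
    proof (cases a)
      case Nil
      then show ?thesis using I0 a(1) by (simp add: parg rankg) (simp add: rank_def)
    next
      case (Cons x a')
      obtain v' b where x: "x = (v', b)" by (cases x)
      obtain j' where j': "j = Suc j'" using a(2) Cons by (cases j) (auto simp: addrs_def)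
      have "v' < n" "a' \<in> addrs n j'" using a(2) Cons x j' by (auto simp: Cons_in_addrs)
      then have "gvert a' v' \<in> ?I" using gI[of a' j' v'] a(3) j' by simp
      then show ?thesis using a(1) Cons x by (simp add: parg rankg)
    qed
  qed
  have tree: "is_tree ?I ?F"
    by (rule parent_tree[OF _ I0 par_ok]) (use finite_gverts in auto)
  have parent_has: "y \<in> B (par (gvert a v))" if "y = src a \<or> y = snk a" for y a v
  proof (cases a)
    case Nil
    then show ?thesis using that by (auto simp: parg B0)
  next
    case (Cons x a')
    obtain v' b where x: "x = (v', b)" by (cases x)
    show ?thesis using that unfolding Cons x parg Bg bag_def by (auto split: if_splits)
  qed
  have BV: "B i \<subseteq> ?V" if i: "i \<in> ?I" for i
  proof -
    consider "i = 0" | a v j where "i = gvert a v" "a \<in> addrs n j" "j < k" "v < n" using Icases[OF i] by blast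
    then show ?thesis
    proof cases
      case 1
      then show ?thesis by (simp add: B0 gverts_def)
    next
      case 2
      then show ?thesis
        using src_snk_in_gverts[of a n j k] gvert_in_gverts[of a n j k v] by (simp add: Bg bag_def)
    qed
  qed
  \<comment> \<open>The topmost node whose bag holds \<open>y\<close>: all other such bags reach it
    along parents. Vertex 1 is no node itself and lives in the root.\<close>
  define home where "home y = (if y = 1 then 0 else y)" for y :: nat
  have home: "home y \<in> ?I" "y \<in> B (home y)" if "y \<in> ?V" for y
  proof -
    show "home y \<in> ?I" using that I0 by (cases "y = 1") (simp_all add: home_def)
    from that show "y \<in> B (home y)"
    proof (cases rule: gverts_cases)
      case (3 a v j)
      then show ?thesis unfolding 3(1) home_def by (simp add: Bg bag_def)
    qed (simp_all add: home_def B0)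
  qed
  have conn: "(i, home y) \<in> {(a, b). {a, b} \<in> induced_edges ?F {i \<in> ?I. y \<in> B i}}\<^sup>*" if "i \<in> ?I" "y \<in> B i" for i y
    using that
  proof (induction "rank i" arbitrary: i rule: less_induct)
    case less
    let ?R = "{(a, b). {a, b} \<in> induced_edges ?F {i \<in> ?I. y \<in> B i}}"
    consider "i = 0" | a v j where "i = gvert a v" "a \<in> addrs n j" "j < k" "v < n" using Icases[OF less.prems(1)] by blast
    then show ?case
    proof cases
      case 1
      then have "home y = i" using less.prems by (auto simp: B0 home_def)
      then show ?thesis by simp
    next
      case 2
      show ?thesis
      proof (cases "y = i")
        case True
        then have "home y = i" using 2 by (simp add: home_def)
        then show ?thesis by simp
      next
        case False
        then have y: "y = src a \<or> y = snk a" using less.prems(2) 2 by (auto simp: Bg bag_def)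
        have i0: "i \<noteq> 0" using 2 by simp
        have P: "par i \<in> ?I" "rank (par i) < rank i"
          using par_ok[OF less.prems(1) i0] by blast+
        have P': "y \<in> B (par i)" using parent_has[OF y, of v] unfolding 2(1) .
        have "{i, par i} \<in> ?F" using less.prems(1) i0 by auto
        then have "(i, par i) \<in> ?R"
          using less.prems P(1) P'
          by (simp only: induced_edges_def mem_Collect_eq case_prod_conv insert_subset empty_subsetI simp_thms)
        moreover have "(par i, home y) \<in> ?R\<^sup>*" by (rule less.hyps[OF P(2,1) P'])
        ultimately show ?thesis by (rule converse_rtrancl_into_rtrancl)
      qed
    qed
  qed
  have td: "tree_decomposition ?V ?E ?I ?F B"
    unfolding tree_decomposition_def
  proof (intro conjI ballI tree)
    show "(\<Union>i\<in>?I. B i) = ?V"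
    proof (rule subset_antisym)
      show "(\<Union>i\<in>?I. B i) \<subseteq> ?V" by (rule UN_least) (rule BV)
      show "?V \<subseteq> (\<Union>i\<in>?I. B i)" by (rule subsetI) (rule UN_I, rule home(1), assumption, rule home(2))
    qed
    fix e assume "e \<in> ?E"
    then obtain a where a: "a \<in> addrs n k" "e = {src a, snk a}" by (auto simp: supply_edge_def)
    obtain x a' where xa: "a = x # a'" using a(1) k by (cases a) (auto simp: addrs_def)
    obtain v b where x: "x = (v, b)" by (cases x)
    obtain k' where k': "k = Suc k'" using k by (cases k) auto
    have "v < n" "a' \<in> addrs n k'" using a(1) xa x k' by (auto simp: Cons_in_addrs)
    then have "gvert a' v \<in> ?I" using gI[of a' k' v] k' by simp
    moreover have "e \<subseteq> B (gvert a' v)" using a(2) xa x by (auto simp: Bg bag_def)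
    ultimately show "\<exists>i\<in>?I. e \<subseteq> B i" by blast
  next
    fix y assume y: "y \<in> ?V"
    let ?J = "{i \<in> ?I. y \<in> B i}"
    let ?R = "{(a, b). {a, b} \<in> induced_edges ?F ?J}"
    have sym: "(a, b) \<in> ?R\<^sup>* \<Longrightarrow> (b, a) \<in> ?R\<^sup>*" for a b
    proof -
      have "(b, a) \<in> ?R" if "(a, b) \<in> ?R" for a b using that by (simp add: insert_commute)
      then have "sym ?R" by (rule symI)
      then show "(a, b) \<in> ?R\<^sup>* \<Longrightarrow> (b, a) \<in> ?R\<^sup>*" by (rule symD[OF sym_rtrancl])
    qed
    show "connected_graph ?J (induced_edges ?F ?J)"
      unfolding connected_graph_def
    proof (intro conjI ballI)
      have "home y \<in> ?J" using home[OF y] by simp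
      then show "?J \<noteq> {}" by auto
      fix i j assume "i \<in> ?J" "j \<in> ?J"
      then have ij: "i \<in> ?I" "y \<in> B i" "j \<in> ?I" "y \<in> B j" by simp_all
      show "(i, j) \<in> ?R\<^sup>*" by (rule rtrancl_trans[OF conn[OF ij(1,2)] sym[OF conn[OF ij(3,4)]]])
    qed
  qed
  have cardB: "card (B i) \<le> 3" for i
    unfolding B_def bag_def by (auto simp: card_insert_if split: prod.split)
  have card3: "card (B (gvert [] 0)) = 3"
    unfolding Bg bag_def by simp
  have width: "decomposition_width ?I B = 2"
  proof -
    have "gvert [] 0 \<in> ?I" using gI[of "[]" 0 0] n k by (simp add: addrs_0)
    then have "Max ((\<lambda>i. card (B i)) ` ?I) = 3"
      using cardB finite_gverts by (intro Max_eqI) (auto simp: card3[symmetric])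
    then show ?thesis by (simp add: decomposition_width_def)
  qed
  have lower: "2 \<le> decomposition_width I B'"
    if "tree_decomposition ?V ?E (I :: nat set) F B'" for I F B'
  proof (rule ccontr)
    assume "\<not> 2 \<le> decomposition_width I B'"
    have finI: "finite I" and UB: "(\<Union>i\<in>I. B' i) = ?V"
      using that by (auto simp: tree_decomposition_def is_tree_def simple_graph_def)
    have "card (B' i) \<le> 2 \<and> finite (B' i)" if "i \<in> I" for i
    proof
      have "card (B' i) \<le> Max ((\<lambda>i. card (B' i)) ` I)" using finI that by (intro Max_ge) auto
      then show "card (B' i) \<le> 2" using \<open>\<not> 2 \<le> decomposition_width I B'\<close> by (simp add: decomposition_width_def)
      show "finite (B' i)" using UB that finite_gverts[of n k] by (auto intro: finite_subset)
    qed
    moreover have "?V \<noteq> {}" by (simp add: gverts_def)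
    moreover have "card e = 2" if "e \<in> ?E" for e using that src_neq_snk by (auto simp: supply_edge_def)
    ultimately have "\<exists>x\<in>?V. \<exists>z. \<forall>y. {x, y} \<in> ?E \<longrightarrow> y = z"
      by (rule small_bags_low_degree[OF that])
    then obtain x z where x: "x \<in> ?V" "\<And>y. {x, y} \<in> ?E \<Longrightarrow> y = z" by blast
    obtain k' where k': "k = Suc k'" using k by (cases k) auto
    \<comment> \<open>An end of an edge stays an end of some edge at every later level, so it
      suffices to find two neighbours in the last subdivision.\<close>
    have extend: "\<exists>a\<in>addrs n (j + d). x = src a \<or> x = snk a" if "a \<in> addrs n j" "x = src a \<or> x = snk a" for a j d
      using that
    proof (induction d arbitrary: a j)
      case 0
      then show ?case by auto
    next
      case (Suc d)
      have c: "(0, False) # a \<in> addrs n (Suc j)" "(0, True) # a \<in> addrs n (Suc j)"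
        using Suc.prems n by (auto simp: Cons_in_addrs)
      have "x = src ((0, False) # a) \<or> x = snk ((0, True) # a)" using Suc.prems(2) by auto
      then show ?case using Suc.IH[OF c(1)] Suc.IH[OF c(2)] by auto
    qed
    have two: "\<exists>y1 y2. y1 \<noteq> y2 \<and> {x, y1} \<in> ?E \<and> {x, y2} \<in> ?E" if a: "a \<in> addrs n k'" "x = src a \<or> x = snk a" for a
    proof -
      have "\<exists>b. {x, gvert a v} \<in> ?E" if v: "v < n" for v
      proof -
        have "(v, False) # a \<in> addrs n k" "(v, True) # a \<in> addrs n k" using a v k' by (auto simp: Cons_in_addrs)
        moreover have "supply_edge ((v, False) # a) = {src a, gvert a v}" "supply_edge ((v, True) # a) = {snk a, gvert a v}"
          by (auto simp: supply_edge_def)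
        ultimately show ?thesis using a(2) by (metis imageI)
      qed
      then have "{x, gvert a 0} \<in> ?E" "{x, gvert a 1} \<in> ?E" using n by auto
      then show ?thesis by (intro exI[of _ "gvert a 0"] exI[of _ "gvert a 1"]) auto
    qed
    have "\<exists>y1 y2. y1 \<noteq> y2 \<and> {x, y1} \<in> ?E \<and> {x, y2} \<in> ?E"
      using x(1)
    proof (cases rule: gverts_cases)
      case 1
      then show ?thesis using extend[of "[]" 0 k'] two by (auto simp: addrs_0)
    next
      case 2
      then show ?thesis using extend[of "[]" 0 k'] two by (auto simp: addrs_0)
    next
      case (3 a v j)
      have c: "(v, True) # a \<in> addrs n (Suc j)" "(v, False) # a \<in> addrs n (Suc j)" using 3 by (auto simp: Cons_in_addrs)
      show ?thesis
      proof (cases "j = k'")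
        case True
        have "supply_edge ((v, False) # a) = {x, src a}" "supply_edge ((v, True) # a) = {x, snk a}"
          using 3 by (auto simp: supply_edge_def)
        then have "{x, src a} \<in> ?E" "{x, snk a} \<in> ?E" using c True k' by (metis imageI)+
        then show ?thesis using src_neq_snk by blast
      next
        case False
        then have "Suc j + (k' - Suc j) = k'" using 3 k' by simp
        moreover have "x = src ((v, True) # a)" using 3 by simp
        ultimately show ?thesis using extend[OF c(1), of "k' - Suc j"] two by auto
      qed
    qed
    then obtain y1 y2 where y: "y1 \<noteq> y2" "{x, y1} \<in> ?E" "{x, y2} \<in> ?E" by (elim exE conjE)
    show False using x(2)[OF y(2)] x(2)[OF y(3)] y(1) by simp
  qed
  show ?thesis
    unfolding treewidth_def
  proof (rule Least_equality)
    show "\<exists>(I :: nat set) F B. tree_decomposition ?V ?E I F B \<and> decomposition_width I B = 2"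
      by (intro exI conjI) (rule td, rule width)
    show "2 \<le> m" if "\<exists>(I :: nat set) F B. tree_decomposition ?V ?E I F B \<and> decomposition_width I B = m" for m
      using that by (elim exE conjE) (auto dest: lower)
  qed
qed

section \<open>The Sherali-Adams relaxation\<close>

text \<open>From three rounds on, \<open>x\<close> restricted to a triple is a nonnegative
  combination of cuts, and cut distances obey the triangle inequality.\<close>

lemma sherali_adams_metric:
  assumes y: "y \<in> sherali_adams V r" and r: "3 \<le> r"
  shows "u \<in> V \<Longrightarrow> v \<in> V \<Longrightarrow> u \<noteq> v \<Longrightarrow> 0 \<le> y {u, v}"
    and "u \<in> V \<Longrightarrow> v \<in> V \<Longrightarrow> t \<in> V \<Longrightarrow> u \<noteq> v \<Longrightarrow> v \<noteq> t \<Longrightarrow> u \<noteq> t \<Longrightarrow> y {u, t} \<le> y {u, v} + y {v, t}"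
proof -
  from y[unfolded sherali_adams_def mem_Collect_eq] obtain x where
    X1: "\<forall>u\<in>V. \<forall>v\<in>V. y {u, v} = x {u, v} {u} + x {u, v} {v}"
    and X3: "\<forall>S\<subseteq>V. card S + 1 \<le> r \<longrightarrow> (\<forall>T\<subseteq>S. \<forall>u\<in>V - S. x S T = x (S \<union> {u}) T + x (S \<union> {u}) (T \<union> {u}))"
    and X4: "\<forall>S\<subseteq>V. card S \<le> r \<longrightarrow> (\<forall>T\<subseteq>S. 0 \<le> x S T)"
    by (elim exE conjE)
  have x: "\<And>u v. u \<in> V \<Longrightarrow> v \<in> V \<Longrightarrow> y {u, v} = x {u, v} {u} + x {u, v} {v}"
    "\<And>S T u. S \<subseteq> V \<Longrightarrow> card S + 1 \<le> r \<Longrightarrow> T \<subseteq> S \<Longrightarrow> u \<in> V - S \<Longrightarrow> x S T = x (S \<union> {u}) T + x (S \<union> {u}) (T \<union> {u})"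
    "\<And>S T. S \<subseteq> V \<Longrightarrow> card S \<le> r \<Longrightarrow> T \<subseteq> S \<Longrightarrow> 0 \<le> x S T"
    using X1 X3 X4 by blast+
  show "0 \<le> y {u, v}" if "u \<in> V" "v \<in> V" "u \<noteq> v"
    using that r x(1)[OF that(1,2)] x(3)[of "{u, v}" "{u}"] x(3)[of "{u, v}" "{v}"] by simp
  show "y {u, t} \<le> y {u, v} + y {v, t}"
    if V: "u \<in> V" "v \<in> V" "t \<in> V" and ne: "u \<noteq> v" "v \<noteq> t" "u \<noteq> t"
  proof -
    let ?S = "{u, v, t}"
    have C: "x {a, b} {a} = x ?S {a} + x ?S {a, c}" if "{a, b} \<union> {c} = ?S" "a \<noteq> b" "a \<noteq> c" "b \<noteq> c" "a \<in> V" "b \<in> V" "c \<in> V" for a b c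
      using x(2)[of "{a, b}" "{a}" c] that r by (simp add: insert_commute)
    have nn: "0 \<le> x ?S T" if "T \<subseteq> ?S" for T
      using x(3)[of ?S T] that r V ne by simp
    have 1: "x {u, t} {u} = x ?S {u} + x ?S {u, v}" using ne V by (intro C) auto
    have 2: "x {t, u} {t} = x ?S {t} + x ?S {t, v}" using ne V by (intro C) auto
    have 3: "x {u, v} {u} = x ?S {u} + x ?S {u, t}" using ne V by (intro C) auto
    have 4: "x {v, u} {v} = x ?S {v} + x ?S {v, t}" using ne V by (intro C) auto
    have 5: "x {v, t} {v} = x ?S {v} + x ?S {v, u}" using ne V by (intro C) auto
    have 6: "x {t, v} {t} = x ?S {t} + x ?S {t, u}" using ne V by (intro C) auto
    have sw: "{t, u} = {u, t}" "{v, u} = {u, v}" "{t, v} = {v, t}" by auto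
    show ?thesis
      using x(1)[OF V(1,3)] x(1)[OF V(1,2)] x(1)[OF V(2,3)] 1 2 3 4 5 6
        nn[of "{v}"] nn[of "{u, t}"] unfolding sw by simp
  qed
qed

text \<open>Along paths of the connected supply graph the triangle inequality bounds every demand
  distance by a multiple of the cost, uniformly in \<open>y\<close>. Thus the relaxation has
  positive value, without which the quotient in the gap would be 0.\<close>

lemma sherali_adams_lower_bound:
  assumes inst: "sparsest_cut_instance V EG cap ED dem" and conn: "connected_graph V EG" and r: "3 \<le> r"
  shows "\<exists>C>0. \<forall>y\<in>sherali_adams V r. (\<Sum>e\<in>ED. dem e * y e) \<le> C * (\<Sum>e\<in>EG. cap e * y e)"
proof -
  have sG: "\<And>e. e \<in> EG \<Longrightarrow> e \<subseteq> V \<and> card e = 2" and sD: "\<And>e. e \<in> ED \<Longrightarrow> e \<subseteq> V \<and> card e = 2"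
    and cap: "\<And>e. e \<in> EG \<Longrightarrow> 0 < cap e" and dem: "\<And>e. e \<in> ED \<Longrightarrow> 0 < dem e" and fV: "finite V" and ne: "ED \<noteq> {}"
    using inst by (auto simp: sparsest_cut_instance_def simple_graph_def)
  have "EG \<subseteq> Pow V" using sG by auto
  then have fG: "finite EG" using fV by (auto intro: finite_subset)
  have "ED \<subseteq> Pow V" using sD by auto
  then have fD: "finite ED" using fV by (auto intro: finite_subset)
  have ynn: "0 \<le> y e" if y: "y \<in> sherali_adams V r" and e: "e \<subseteq> V" "card e = 2" for y e
  proof -
    obtain a b where "e = {a, b}" "a \<noteq> b" using e(2) by (auto simp: card_2_iff)
    then show ?thesis using sherali_adams_metric(1)[OF y r, of a b] e(1) by simp
  qed
  have reach: "\<exists>N::real. 0 \<le> N \<and> (\<forall>y\<in>sherali_adams V r. u \<noteq> v \<longrightarrow> y {u, v} \<le> N * (\<Sum>e\<in>EG. y e))"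
    if "(u, v) \<in> {(a, b). {a, b} \<in> EG}\<^sup>*" and uV: "u \<in> V" for u v
    using that(1)
  proof (induction rule: rtrancl_induct)
    case base
    then show ?case by (intro exI[of _ 0]) simp
  next
    case (step v t)
    obtain N :: real where N: "0 \<le> N" "\<And>y. y \<in> sherali_adams V r \<Longrightarrow> u \<noteq> v \<Longrightarrow> y {u, v} \<le> N * (\<Sum>e\<in>EG. y e)"
      using step.IH by blast
    have vt: "{v, t} \<in> EG" using step.hyps by simp
    then have vt': "v \<in> V" "t \<in> V" "v \<noteq> t" using sG[OF vt] by (auto simp: card_insert_if split: if_splits)
    have "y {u, t} \<le> (N + 1) * (\<Sum>e\<in>EG. y e)" if y: "y \<in> sherali_adams V r" and "u \<noteq> t" for y
    proof -
      have Y0: "0 \<le> (\<Sum>e\<in>EG. y e)" using ynn[OF y] sG by (intro sum_nonneg) auto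
      have e1: "y {v, t} \<le> (\<Sum>e\<in>EG. y e)" using vt fG ynn[OF y] sG by (intro member_le_sum) auto
      show ?thesis
      proof (cases "u = v")
        case True
        have "0 \<le> N * (\<Sum>e\<in>EG. y e)" using N(1) Y0 by simp
        then show ?thesis using e1 True by (simp add: distrib_right)
      next
        case False
        then show ?thesis
          using sherali_adams_metric(2)[OF y r uV vt'(1,2) False vt'(3) \<open>u \<noteq> t\<close>] N(2)[OF y False] e1
          by (simp add: distrib_right)
      qed
    qed
    then show ?case using N(1) by (intro exI[of _ "N + 1"]) auto
  qed
  have "\<exists>N::real. e \<in> ED \<longrightarrow> 0 \<le> N \<and> (\<forall>y\<in>sherali_adams V r. y e \<le> N * (\<Sum>e\<in>EG. y e))" for e
  proof (cases "e \<in> ED")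
    case True
    then obtain a b where ab: "e = {a, b}" "a \<noteq> b" "a \<in> V" "b \<in> V" using sD[OF True] by (auto simp: card_2_iff)
    then have "(a, b) \<in> {(a, b). {a, b} \<in> EG}\<^sup>*" using conn by (simp add: connected_graph_def)
    from reach[OF this ab(3)] show ?thesis using ab(1,2) by auto
  qed simp
  then obtain f :: "'a set \<Rightarrow> real" where f: "\<And>e. e \<in> ED \<Longrightarrow> 0 \<le> f e" "\<And>e y. e \<in> ED \<Longrightarrow> y \<in> sherali_adams V r \<Longrightarrow> y e \<le> f e * (\<Sum>e\<in>EG. y e)"
    by metis
  have neG: "EG \<noteq> {}"
  proof
    assume "EG = {}"
    obtain e where e: "e \<in> ED" using ne by blast
    then obtain a b where ab: "a \<noteq> b" "a \<in> V" "b \<in> V" using sD[OF e] by (auto simp: card_2_iff)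
    then have "(a, b) \<in> {(a, b). {a, b} \<in> EG}\<^sup>*" using conn by (simp add: connected_graph_def)
    then show False using \<open>EG = {}\<close> ab(1) by simp
  qed
  define m where "m = Min (cap ` EG)"
  have m: "0 < m" "\<And>e. e \<in> EG \<Longrightarrow> m \<le> cap e"
    unfolding m_def using fG neG cap by (auto simp: Min_gr_iff)
  define C where "C = (\<Sum>e\<in>ED. dem e * f e) / m + 1"
  have F0: "0 \<le> (\<Sum>e\<in>ED. dem e * f e)" using dem f(1) by (intro sum_nonneg mult_nonneg_nonneg) (auto intro: less_imp_le)
  have "(\<Sum>e\<in>ED. dem e * y e) \<le> C * (\<Sum>e\<in>EG. cap e * y e)" if y: "y \<in> sherali_adams V r" for y
  proof -
    have c0: "0 \<le> (\<Sum>e\<in>EG. cap e * y e)"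
      using cap ynn[OF y] sG by (intro sum_nonneg mult_nonneg_nonneg) (auto intro: less_imp_le)
    have "m * (\<Sum>e\<in>EG. y e) \<le> (\<Sum>e\<in>EG. cap e * y e)"
      unfolding sum_distrib_left using m(2) ynn[OF y] sG by (intro sum_mono mult_right_mono) auto
    then have Y: "(\<Sum>e\<in>EG. y e) \<le> (\<Sum>e\<in>EG. cap e * y e) / m" using m(1) by (simp add: pos_le_divide_eq mult.commute)
    have "(\<Sum>e\<in>ED. dem e * y e) \<le> (\<Sum>e\<in>ED. dem e * (f e * (\<Sum>e\<in>EG. y e)))"
      using f(2)[OF _ y] dem by (intro sum_mono mult_left_mono) (auto intro: less_imp_le)
    also have "\<dots> = (\<Sum>e\<in>ED. dem e * f e) * (\<Sum>e\<in>EG. y e)" by (simp add: sum_distrib_right mult.assoc)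
    also have "\<dots> \<le> (\<Sum>e\<in>ED. dem e * f e) * ((\<Sum>e\<in>EG. cap e * y e) / m)"
      by (rule mult_left_mono[OF Y F0])
    also have "\<dots> = (\<Sum>e\<in>ED. dem e * f e) / m * (\<Sum>e\<in>EG. cap e * y e)" by simp
    also have "\<dots> \<le> C * (\<Sum>e\<in>EG. cap e * y e)" unfolding C_def using c0 by (intro mult_right_mono) auto
    finally show ?thesis .
  qed
  moreover have "0 < C" unfolding C_def using F0 m(1) by (intro add_nonneg_pos) auto
  ultimately show ?thesis by blast
qed

lemma sa_value_bounds:
  assumes inst: "sparsest_cut_instance V EG cap ED dem" and conn: "connected_graph V EG" and r: "3 \<le> r"
    and y0: "y0 \<in> sherali_adams V r" "0 < (\<Sum>e\<in>ED. dem e * y0 e)"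
  shows "0 < sa_value V EG cap ED dem r"
    and "sa_value V EG cap ED dem r \<le> (\<Sum>e\<in>EG. cap e * y0 e) / (\<Sum>e\<in>ED. dem e * y0 e)"
proof -
  let ?M = "{(\<Sum>e\<in>EG. cap e * y e) / (\<Sum>e\<in>ED. dem e * y e) | y. y \<in> sherali_adams V r \<and> 0 < (\<Sum>e\<in>ED. dem e * y e)}"
  obtain C where C: "0 < C" "\<And>y. y \<in> sherali_adams V r \<Longrightarrow> (\<Sum>e\<in>ED. dem e * y e) \<le> C * (\<Sum>e\<in>EG. cap e * y e)"
    using sherali_adams_lower_bound[OF inst conn r] by blast
  have lb: "1 / C \<le> q" if "q \<in> ?M" for q
  proof -
    obtain y where y: "q = (\<Sum>e\<in>EG. cap e * y e) / (\<Sum>e\<in>ED. dem e * y e)" "y \<in> sherali_adams V r" "0 < (\<Sum>e\<in>ED. dem e * y e)"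
      using \<open>q \<in> ?M\<close> by blast
    have "1 / C * (\<Sum>e\<in>ED. dem e * y e) \<le> (\<Sum>e\<in>EG. cap e * y e)"
      using C(2)[OF y(2)] C(1) by (simp add: divide_le_eq mult.commute)
    then show ?thesis unfolding y(1) using y(3) by (simp add: pos_le_divide_eq)
  qed
  have mem: "(\<Sum>e\<in>EG. cap e * y0 e) / (\<Sum>e\<in>ED. dem e * y0 e) \<in> ?M" using y0 by blast
  have "1 / C \<le> Inf ?M" by (rule cInf_greatest) (use mem lb in blast)+
  then show "0 < sa_value V EG cap ED dem r" unfolding sa_value_def using C(1) by (smt (verit) divide_pos_pos)
  show "sa_value V EG cap ED dem r \<le> (\<Sum>e\<in>EG. cap e * y0 e) / (\<Sum>e\<in>ED. dem e * y0 e)"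
    unfolding sa_value_def by (rule cInf_lower[OF mem]) (rule bdd_belowI[of _ "1 / C"], rule lb)
qed

lemma connected_gverts:
  assumes n: "1 \<le> n"
  shows "connected_graph (gverts n k) (supply_edge ` addrs n k)"
proof -
  let ?R = "{(a, b). {a, b} \<in> supply_edge ` addrs n k}"
  have sym: "(b, a) \<in> ?R\<^sup>*" if "(a, b) \<in> ?R\<^sup>*" for a b
  proof -
    have "(b, a) \<in> ?R" if "(a, b) \<in> ?R" for a b using that by (simp add: insert_commute)
    then have "sym ?R" by (rule symI)
    then show ?thesis using that by (metis sym_rtrancl symD)
  qed
  \<comment> \<open>Induction from level \<open>k\<close> downwards: an edge of an earlier level is
    replaced by the path of length two through its subdivision vertex number 0.\<close>
  have st: "(src a, snk a) \<in> ?R\<^sup>*" if "a \<in> addrs n (k - d)" for a d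
    using that
  proof (induction d arbitrary: a)
    case 0
    then have "{src a, snk a} \<in> supply_edge ` addrs n k" unfolding supply_edge_def by auto
    then show ?case by auto
  next
    case (Suc d)
    show ?case
    proof (cases "d < k")
      case True
      then have e: "k - d = Suc (k - Suc d)" by simp
      have "(0, False) # a \<in> addrs n (k - d)" "(0, True) # a \<in> addrs n (k - d)"
        using Suc.prems n unfolding e by (auto simp: Cons_in_addrs)
      from this[THEN Suc.IH] show ?thesis by (auto intro: rtrancl_trans)
    next
      case False
      then have "k - d = k - Suc d" by simp
      then show ?thesis using Suc by simp
    qed
  qed
  have st': "(src a, snk a) \<in> ?R\<^sup>*" if "a \<in> addrs n j" "j \<le> k" for a j
    using st[of a "k - j"] that by simp
  have s0: "(0, src a) \<in> ?R\<^sup>*" if "a \<in> addrs n j" "j \<le> k" for a j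
    using that
  proof (induction a arbitrary: j)
    case (Cons x a)
    obtain v b where x: "x = (v, b)" by (cases x)
    obtain i where j: "j = Suc i" using Cons.prems(1) by (cases j) (auto simp: addrs_def)
    have a: "v < n" "a \<in> addrs n i" using Cons.prems(1) x j by (auto simp: Cons_in_addrs)
    have "(0, src a) \<in> ?R\<^sup>*" using Cons.IH[OF a(2)] Cons.prems(2) j by simp
    moreover have "(src a, gvert a v) \<in> ?R\<^sup>*"
      using st'[of "(v, False) # a" "Suc i"] a Cons.prems(2) j by (simp add: Cons_in_addrs)
    ultimately show ?case using x by (auto intro: rtrancl_trans)
  qed simp
  have z: "(0, x) \<in> ?R\<^sup>*" if "x \<in> gverts n k" for x
    using that
  proof (cases rule: gverts_cases)
    case 2
    then show ?thesis using st'[of "[]" 0] by (simp add: addrs_0)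
  next
    case (3 a v j)
    then show ?thesis using s0[of "(v, True) # a" "Suc j"] by (simp add: Cons_in_addrs)
  qed simp
  show ?thesis
    unfolding connected_graph_def
  proof (intro conjI ballI)
    show "gverts n k \<noteq> {}" by (simp add: gverts_def)
    fix u v assume "u \<in> gverts n k" "v \<in> gverts n k"
    then show "(u, v) \<in> ?R\<^sup>*" using rtrancl_trans[OF sym[OF z] z] by blast
  qed
qed

text \<open>A consistent family of signed weights with total 1. Keeping nonnegativity out allows
  expectations over sets of any size, where the weights may be negative.\<close>

locale pseudo_distribution =
  fixes \<pi> :: "'b set \<Rightarrow> 'b set \<Rightarrow> real"
  assumes pi_empty: "\<pi> {} {} = 1"
    and pi_marginal: "\<And>U u T. finite U \<Longrightarrow> u \<notin> U \<Longrightarrow> T \<subseteq> U \<Longrightarrow> \<pi> (insert u U) T + \<pi> (insert u U) (insert u T) = \<pi> U T"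
begin

definition expect :: "'b set \<Rightarrow> ('b set \<Rightarrow> real) \<Rightarrow> real" where
  "expect U F = (\<Sum>T\<in>Pow U. \<pi> U T * F T)"

lemma expect_insert:
  assumes "finite U" "u \<notin> U" "\<And>T. T \<subseteq> U \<Longrightarrow> F (insert u T) = F T"
  shows "expect (insert u U) F = expect U F"
proof -
  have "expect (insert u U) F = (\<Sum>T\<in>Pow U. \<pi> (insert u U) T * F T) + (\<Sum>T\<in>insert u ` Pow U. \<pi> (insert u U) T * F T)"
    unfolding expect_def Pow_insert using assms by (intro sum.union_disjoint) auto
  also have "(\<Sum>T\<in>insert u ` Pow U. \<pi> (insert u U) T * F T) = (\<Sum>T\<in>Pow U. \<pi> (insert u U) (insert u T) * F (insert u T))"
    using assms(2) by (subst sum.reindex) (auto simp: inj_on_def comp_def)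
  also have "(\<Sum>T\<in>Pow U. \<pi> (insert u U) T * F T) + \<dots> = (\<Sum>T\<in>Pow U. (\<pi> (insert u U) T + \<pi> (insert u U) (insert u T)) * F T)"
    unfolding sum.distrib[symmetric] using assms(3) by (intro sum.cong) (auto simp: distrib_right)
  also have "\<dots> = expect U F"
    unfolding expect_def using assms(1,2) by (intro sum.cong) (auto simp: pi_marginal)
  finally show ?thesis .
qed

text \<open>Observables living on different sets can thus be compared on one common larger
  set.\<close>

lemma expect_mono:
  assumes "finite U'" "U \<subseteq> U'" "\<And>T. F (T \<inter> U) = F T"
  shows "expect U' F = expect U F"
proof -
  have "expect (U \<union> W) F = expect U F" if "finite W" "U \<inter> W = {}" for W
    using that
  proof (induction W rule: finite_induct)
    case (insert u W)
    have "expect (insert u (U \<union> W)) F = expect (U \<union> W) F"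
    proof (rule expect_insert)
      show "finite (U \<union> W)" using insert assms(1,2) by (auto intro: finite_subset)
      show "u \<notin> U \<union> W" using insert by auto
      fix T
      have "insert u T \<inter> U = T \<inter> U" using insert by auto
      then show "F (insert u T) = F T" using assms(3) by metis
    qed
    then show ?case using insert by simp
  qed simp
  from this[of "U' - U"] show ?thesis using assms by (simp add: Un_absorb1)
qed

lemma expect_const:
  assumes "finite U"
  shows "expect U (\<lambda>_. c) = c"
  using expect_mono[of U "{}" "\<lambda>_. c"] assms by (simp add: expect_def pi_empty)

lemma expect_add: "expect U (\<lambda>T. F T + G T) = expect U F + expect U G"
  by (simp add: expect_def distrib_left sum.distrib)

lemma expect_sum: "expect U (\<lambda>T. \<Sum>i\<in>I. c i * F i T) = (\<Sum>i\<in>I. c i * expect U (F i))"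
  unfolding expect_def sum_distrib_left by (subst sum.swap) (simp only: mult.left_commute)

lemma expect_nonneg:
  assumes "\<And>T. T \<subseteq> U \<Longrightarrow> 0 \<le> \<pi> U T" "\<And>T. 0 \<le> F T"
  shows "0 \<le> expect U F"
  unfolding expect_def using assms by (intro sum_nonneg mult_nonneg_nonneg) auto

lemma expect_cong: "(\<And>T. T \<subseteq> U \<Longrightarrow> F T = G T) \<Longrightarrow> expect U F = expect U G"
  by (simp add: expect_def)

lemma expect_mult:
  assumes "U \<inter> U' = {}" "\<And>T T'. T \<subseteq> U \<Longrightarrow> T' \<subseteq> U' \<Longrightarrow> \<pi> (U \<union> U') (T \<union> T') = \<pi> U T * \<pi> U' T'"
    and "\<And>T. F (T \<inter> U) = F T" "\<And>T. G (T \<inter> U') = G T"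
  shows "expect (U \<union> U') (\<lambda>T. F T * G T) = expect U F * expect U' G"
proof -
  have "expect (U \<union> U') (\<lambda>T. F T * G T) = (\<Sum>(T, T')\<in>Pow U \<times> Pow U'. (\<pi> U T * F T) * (\<pi> U' T' * G T'))"
    unfolding expect_def
  proof (rule sum.reindex_bij_witness[of _ "\<lambda>(T, T'). T \<union> T'" "\<lambda>T. (T \<inter> U, T \<inter> U')"], goal_cases)
    case (5 T)
    then have "T = (T \<inter> U) \<union> (T \<inter> U')" by auto
    then have "\<pi> (U \<union> U') T = \<pi> U (T \<inter> U) * \<pi> U' (T \<inter> U')"
      using assms(2)[of "T \<inter> U" "T \<inter> U'"] by auto
    then show ?case by (simp add: assms(3,4) mult_ac)
  qed (use assms(1) in auto)
  then show ?thesis by (simp add: expect_def sum_product sum.cartesian_product)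
qed

end

section \<open>Random cuts of the iterated graph and the fractional solution\<close>

fun deps :: "addr \<Rightarrow> (addr \<times> nat) set" where
  "deps [] = {}"
| "deps ((v, b) # a) = insert (a, v) (deps a)"

text \<open>A subset \<open>\<tau>\<close> of the subdivision vertices describes a random cut: source and sink are separated, and a
  subdivision vertex takes the side of its source if it lies in \<open>\<tau>\<close>, that of its sink otherwise.\<close>

fun ends_val :: "(addr \<times> nat) set \<Rightarrow> addr \<Rightarrow> bool \<times> bool" where
  "ends_val \<tau> [] = (True, False)"
| "ends_val \<tau> ((v, b) # a) = (let m = (if (a, v) \<in> \<tau> then fst (ends_val \<tau> a) else snd (ends_val \<tau> a)) in
     if b then (m, snd (ends_val \<tau> a)) else (fst (ends_val \<tau> a), m))"

definition vert_val :: "(addr \<times> nat) set \<Rightarrow> nat \<Rightarrow> bool" where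
  "vert_val \<tau> x = (if x = 0 then True else if x = 1 then False else
     case from_nat (x - 2) of (a, v) \<Rightarrow> if (a, v) \<in> \<tau> then fst (ends_val \<tau> a) else snd (ends_val \<tau> a))"

definition vert_deps :: "nat \<Rightarrow> (addr \<times> nat) set" where
  "vert_deps x = (if x < 2 then {} else case from_nat (x - 2) of (a, v) \<Rightarrow> insert (a, v) (deps a))"

lemma vert_val_simps [simp]:
  "vert_val \<tau> 0 = True" "vert_val \<tau> 1 = False" "vert_val \<tau> (Suc 0) = False"
  "vert_val \<tau> (gvert a v) = (if (a, v) \<in> \<tau> then fst (ends_val \<tau> a) else snd (ends_val \<tau> a))"
  by (simp_all add: vert_val_def gvert_def)

lemma vert_deps_gvert [simp]: "vert_deps (gvert a v) = insert (a, v) (deps a)"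
  by (simp add: vert_deps_def gvert_def)

lemma vert_deps_01 [simp]: "vert_deps 0 = {}" "vert_deps 1 = {}" "vert_deps (Suc 0) = {}"
  by (simp_all add: vert_deps_def)

lemma vert_val_src: "vert_val \<tau> (src a) = fst (ends_val \<tau> a)"
  by (induction a rule: src.induct) (simp_all add: Let_def)

lemma vert_val_snk: "vert_val \<tau> (snk a) = snd (ends_val \<tau> a)"
  by (induction a rule: snk.induct) (simp_all add: Let_def)

lemma finite_deps: "finite (deps a)"
  by (induction a rule: deps.induct) auto

lemma card_deps: "card (deps a) \<le> length a"
  by (induction a rule: deps.induct) (auto simp: card_insert_if finite_deps)

lemma deps_shorter: "x \<in> deps a \<Longrightarrow> length (fst x) < length a"
  by (induction a rule: deps.induct) auto

lemma finite_vert_deps: "finite (vert_deps x)"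
  by (simp add: vert_deps_def finite_deps split: prod.split)

text \<open>The side of a vertex is decided by at most one coordinate per level, so \<open>r\<close>
  vertices involve at most \<open>k * r\<close> coordinates; this fixes how large \<open>R\<close>
  must be.\<close>

lemma card_vert_deps:
  assumes "x \<in> gverts n k"
  shows "card (vert_deps x) \<le> k"
  using assms
proof (cases rule: gverts_cases)
  case (3 a v j)
  have "card (vert_deps x) \<le> Suc (card (deps a))" unfolding 3 by (simp add: card_insert_if finite_deps)
  also have "\<dots> \<le> k" using card_deps[of a] 3 by (simp add: addrs_def)
  finally show ?thesis .
qed simp_all

lemma ends_val_Int: "deps a \<subseteq> U \<Longrightarrow> ends_val (\<tau> \<inter> U) a = ends_val \<tau> a"
  by (induction a rule: deps.induct) (simp_all add: Let_def)

lemma vert_val_Int: "vert_deps x \<subseteq> U \<Longrightarrow> vert_val (\<tau> \<inter> U) x = vert_val \<tau> x"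
  by (auto simp: vert_val_def vert_deps_def ends_val_Int split: prod.splits if_splits)

text \<open>A subdivision vertex copies one of its ends. Hence exactly one of its two edges is cut
  if the ends differ, and none otherwise; as the weights \<open>p\<close> sum to 1, capacity 1 is
  passed on from level to level.\<close>

lemma (in base_graph) level_cut_vert_val: "level_cut n p (vert_val \<tau>) j = 1"
proof (induction j)
  case 0
  show ?case by (simp add: level_cut_def addrs_0)
next
  case (Suc j)
  have "(\<Sum>v<n. p v * (of_bool (vert_val \<tau> (gvert a v) \<noteq> vert_val \<tau> (snk a)) + of_bool (vert_val \<tau> (src a) \<noteq> vert_val \<tau> (gvert a v))))
     = of_bool (vert_val \<tau> (src a) \<noteq> vert_val \<tau> (snk a))" for a
  proof -
    have "(\<Sum>v<n. p v * (of_bool (vert_val \<tau> (gvert a v) \<noteq> vert_val \<tau> (snk a)) + of_bool (vert_val \<tau> (src a) \<noteq> vert_val \<tau> (gvert a v))))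
      = (\<Sum>v<n. p v * of_bool (vert_val \<tau> (src a) \<noteq> vert_val \<tau> (snk a)))"
      by (intro sum.cong refl arg_cong2[where f = "(*)"]) (simp add: vert_val_src vert_val_snk)
    then show ?thesis by (simp only: sum_distrib_right[symmetric] sum_p mult_1)
  qed
  then show ?case unfolding level_cut_Suc using Suc.IH by (simp add: level_cut_def)
qed

locale gap_instance = base_graph n EH w \<eta> + pseudo_distribution \<pi>
  for n EH w \<eta> and \<pi> :: "(addr \<times> nat) set \<Rightarrow> (addr \<times> nat) set \<Rightarrow> real" +
  fixes R :: nat
  assumes pi_nonneg: "\<And>U T. finite U \<Longrightarrow> U \<subseteq> UNIV \<times> {..<n} \<Longrightarrow> card U \<le> R \<Longrightarrow> T \<subseteq> U \<Longrightarrow> 0 \<le> \<pi> U T"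
    and pi_mult: "\<And>U U' T T'. finite U \<Longrightarrow> finite U' \<Longrightarrow> (\<And>x y. x \<in> U \<Longrightarrow> y \<in> U' \<Longrightarrow> fst x \<noteq> fst y) \<Longrightarrow>
      T \<subseteq> U \<Longrightarrow> T' \<subseteq> U' \<Longrightarrow> \<pi> (U \<union> U') (T \<union> T') = \<pi> U T * \<pi> U' T'"
    and pi_edge: "\<And>a u v. {u, v} \<in> EH \<Longrightarrow> u \<noteq> v \<Longrightarrow>
      1 - \<eta> \<le> \<pi> {(a, u), (a, v)} {(a, u)} + \<pi> {(a, u), (a, v)} {(a, v)}"
begin

definition set_deps :: "nat set \<Rightarrow> (addr \<times> nat) set" where
  "set_deps S = (\<Union>x\<in>S. vert_deps x)"

definition sa_dist :: "nat set \<Rightarrow> nat set \<Rightarrow> real" where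
  "sa_dist S T = expect (set_deps S) (\<lambda>\<tau>. of_bool (\<forall>u\<in>S. vert_val \<tau> u \<longleftrightarrow> u \<in> T))"

text \<open>On the diagonal the defining equation of the polytope reads
  \<open>y {u} = 2 * x {u} {u}\<close>, which the singleton case reproduces.\<close>

definition sa_sol :: "nat set \<Rightarrow> real" where
  "sa_sol e = (if card e = 1 then 2 * sa_dist e e else (\<Sum>u\<in>e. sa_dist e {u}))"

lemma finite_set_deps: "finite S \<Longrightarrow> finite (set_deps S)"
  by (simp add: set_deps_def finite_vert_deps)

lemma sa_dist_eq:
  assumes "finite U" "set_deps S \<subseteq> U"
  shows "sa_dist S T = expect U (\<lambda>\<tau>. of_bool (\<forall>u\<in>S. vert_val \<tau> u \<longleftrightarrow> u \<in> T))"
  unfolding sa_dist_def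
proof (rule expect_mono[symmetric, OF assms])
  fix \<tau>
  have "vert_val (\<tau> \<inter> set_deps S) u = vert_val \<tau> u" if "u \<in> S" for u
    using that by (intro vert_val_Int) (auto simp: set_deps_def)
  then show "of_bool (\<forall>u\<in>S. vert_val (\<tau> \<inter> set_deps S) u \<longleftrightarrow> u \<in> T) = (of_bool (\<forall>u\<in>S. vert_val \<tau> u \<longleftrightarrow> u \<in> T) :: real)"
    by simp
qed

lemma sa_sol_pair:
  assumes "u \<noteq> v" "finite U" "vert_deps u \<union> vert_deps v \<subseteq> U"
  shows "sa_sol {u, v} = expect U (\<lambda>\<tau>. of_bool (vert_val \<tau> u \<noteq> vert_val \<tau> v))"
proof -
  have "sa_sol {u, v} = sa_dist {u, v} {u} + sa_dist {u, v} {v}"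
    using assms(1) by (simp add: sa_sol_def)
  also have "\<dots> = expect U (\<lambda>\<tau>. of_bool (\<forall>x\<in>{u, v}. vert_val \<tau> x \<longleftrightarrow> x \<in> {u}) + of_bool (\<forall>x\<in>{u, v}. vert_val \<tau> x \<longleftrightarrow> x \<in> {v}))"
    using assms by (simp add: sa_dist_eq[of U] set_deps_def expect_add)
  also have "\<dots> = expect U (\<lambda>\<tau>. of_bool (vert_val \<tau> u \<noteq> vert_val \<tau> v))"
    using assms(1) by (intro expect_cong) auto
  finally show ?thesis .
qed

lemma set_deps_subset: "S \<subseteq> gverts n k \<Longrightarrow> set_deps S \<subseteq> UNIV \<times> {..<n}"
proof -
  have d: "deps a \<subseteq> UNIV \<times> {..<n}" if "a \<in> addrs n j" for a j
    using that
  proof (induction a arbitrary: j)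
    case (Cons x a)
    obtain i where "j = Suc i" using Cons.prems(1) by (cases j) (auto simp: addrs_def)
    then show ?case using Cons by (cases x) (auto simp: Cons_in_addrs)
  qed simp
  have "vert_deps x \<subseteq> UNIV \<times> {..<n}" if "x \<in> gverts n k" for x
    using that
  proof (cases rule: gverts_cases)
    case (3 a v j)
    then show ?thesis using d[of a j] by simp
  qed simp_all
  then show "S \<subseteq> gverts n k \<Longrightarrow> set_deps S \<subseteq> UNIV \<times> {..<n}" unfolding set_deps_def by blast
qed

lemma sa_sol_feasible:
  assumes "k * r \<le> R"
  shows "sa_sol \<in> sherali_adams (gverts n k) r"
  unfolding sherali_adams_def mem_Collect_eq
proof (intro exI[of _ sa_dist] conjI ballI allI impI)
  fix u v
  show "sa_sol {u, v} = sa_dist {u, v} {u} + sa_dist {u, v} {v}"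
    by (cases "u = v") (simp_all add: sa_sol_def)
next
  fix S assume S: "S \<subseteq> gverts n k"
  then have fS: "finite S" using finite_gverts by (rule finite_subset)
  have one: "(\<Sum>T\<in>Pow S. 1 * of_bool (\<forall>u\<in>S. vert_val \<tau> u \<longleftrightarrow> u \<in> T) :: real) = 1" for \<tau>
  proof -
    have "(\<Sum>T\<in>Pow S. 1 * of_bool (\<forall>u\<in>S. vert_val \<tau> u \<longleftrightarrow> u \<in> T) :: real) =
        (\<Sum>T\<in>Pow S. if T = {u \<in> S. vert_val \<tau> u} then 1 else 0)"
      by (intro sum.cong refl) auto
    also have "\<dots> = 1" using fS by (subst sum.delta) auto
    finally show ?thesis .
  qed
  have "(\<Sum>T\<in>Pow S. 1 * sa_dist S T) = 1"
    unfolding sa_dist_def expect_sum[symmetric] one by (rule expect_const[OF finite_set_deps[OF fS]])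
  then show "(\<Sum>T\<in>Pow S. sa_dist S T) = 1" by simp
next
  fix S T u assume S: "S \<subseteq> gverts n k" "T \<subseteq> S" "u \<in> gverts n k - S"
  then have fS: "finite (S \<union> {u})" using finite_gverts[of n k] by (auto intro: finite_subset)
  let ?U = "set_deps (S \<union> {u})"
  have fU: "finite ?U" by (rule finite_set_deps[OF fS])
  have "sa_dist S T = expect ?U (\<lambda>\<tau>. of_bool (\<forall>u\<in>S. vert_val \<tau> u \<longleftrightarrow> u \<in> T))"
    by (rule sa_dist_eq[OF fU]) (auto simp: set_deps_def)
  also have "\<dots> = expect ?U (\<lambda>\<tau>. of_bool (\<forall>x\<in>S \<union> {u}. vert_val \<tau> x \<longleftrightarrow> x \<in> T) + of_bool (\<forall>x\<in>S \<union> {u}. vert_val \<tau> x \<longleftrightarrow> x \<in> T \<union> {u}))"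
  proof (rule expect_cong)
    fix \<tau>
    have 1: "(\<forall>x\<in>S \<union> {u}. vert_val \<tau> x \<longleftrightarrow> x \<in> T) \<longleftrightarrow> (\<forall>x\<in>S. vert_val \<tau> x \<longleftrightarrow> x \<in> T) \<and> \<not> vert_val \<tau> u"
      using S by auto
    have 2: "(\<forall>x\<in>S \<union> {u}. vert_val \<tau> x \<longleftrightarrow> x \<in> T \<union> {u}) \<longleftrightarrow> (\<forall>x\<in>S. vert_val \<tau> x \<longleftrightarrow> x \<in> T) \<and> vert_val \<tau> u"
      using S by auto
    show "(of_bool (\<forall>u\<in>S. vert_val \<tau> u \<longleftrightarrow> u \<in> T) :: real) =
       of_bool (\<forall>x\<in>S \<union> {u}. vert_val \<tau> x \<longleftrightarrow> x \<in> T) + of_bool (\<forall>x\<in>S \<union> {u}. vert_val \<tau> x \<longleftrightarrow> x \<in> T \<union> {u})"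
      unfolding 1 2 by simp
  qed
  also have "\<dots> = sa_dist (S \<union> {u}) T + sa_dist (S \<union> {u}) (T \<union> {u})"
    unfolding expect_add sa_dist_def ..
  finally show "sa_dist S T = sa_dist (S \<union> {u}) T + sa_dist (S \<union> {u}) (T \<union> {u})" .
next
  fix S T assume S: "S \<subseteq> gverts n k" "card S \<le> r"
  then have fS: "finite S" using finite_gverts[of n k] by (auto intro: finite_subset)
  have "card (set_deps S) \<le> (\<Sum>x\<in>S. card (vert_deps x))"
    unfolding set_deps_def by (rule card_UN_le[OF fS])
  also have "\<dots> \<le> (\<Sum>x\<in>S. k)" using S by (intro sum_mono card_vert_deps) auto
  also have "\<dots> \<le> k * r" using S(2) by simp
  finally have "card (set_deps S) \<le> R" using assms by simp
  then show "0 \<le> sa_dist S T"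
    unfolding sa_dist_def using finite_set_deps[OF fS] set_deps_subset[OF S(1)]
    by (intro expect_nonneg pi_nonneg) auto
qed

text \<open>Every \<open>\<tau>\<close> gives a cut of capacity exactly 1, so linearity and total
  weight 1 suffice, even on sets where the weights are signed.\<close>

lemma expect_level_cut:
  assumes "finite U"
  shows "(\<Sum>a\<in>addrs n j. weight p a * expect U (\<lambda>\<tau>. of_bool (vert_val \<tau> (src a) \<noteq> vert_val \<tau> (snk a)))) = 1"
  unfolding expect_sum[symmetric] level_cut_def[symmetric] level_cut_vert_val by (rule expect_const[OF assms])

lemma sa_sol_cost: "(\<Sum>e\<in>EG k. cap k e * sa_sol e) = 1"
proof -
  let ?U = "set_deps (gverts n k)"
  have fU: "finite ?U" by (rule finite_set_deps[OF finite_gverts])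
  have "(\<Sum>e\<in>EG k. cap k e * sa_sol e) = (\<Sum>a\<in>addrs n k. weight p a * sa_sol (supply_edge a))"
    unfolding cap_def by (rule weighted_image_sum[OF finite_addrs])
  also have "\<dots> = (\<Sum>a\<in>addrs n k. weight p a * expect ?U (\<lambda>\<tau>. of_bool (vert_val \<tau> (src a) \<noteq> vert_val \<tau> (snk a))))"
  proof (intro sum.cong refl arg_cong2[where f = "(*)"])
    fix a assume a: "a \<in> addrs n k"
    show "sa_sol (supply_edge a) = expect ?U (\<lambda>\<tau>. of_bool (vert_val \<tau> (src a) \<noteq> vert_val \<tau> (snk a)))"
      unfolding supply_edge_def using src_snk_in_gverts[OF a order_refl]
      by (intro sa_sol_pair src_neq_snk fU) (auto simp: set_deps_def)
  qed
  also have "\<dots> = 1" by (rule expect_level_cut[OF fU])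
  finally show ?thesis .
qed

text \<open>The demand is separated exactly if the ends of \<open>a\<close> are separated and the
  coordinates of \<open>u\<close> and \<open>v\<close> differ. The former depends on strictly
  shorter addresses only, so the two events are independent.\<close>

lemma sa_sol_demand_edge:
  assumes h: "h \<in> EH" and a: "a \<in> addrs n j" "j < k" and k: "k \<le> R"
    and U: "finite U" "deps a \<subseteq> U"
  shows "(1 - \<eta>) * expect U (\<lambda>\<tau>. of_bool (vert_val \<tau> (src a) \<noteq> vert_val \<tau> (snk a))) \<le> sa_sol (gvert a ` h)"
proof -
  obtain u v where uv: "h = {u, v}" "u \<noteq> v" "u < n" "v < n" using h by (rule edgeE)
  let ?A = "deps a" and ?B = "{(a, u), (a, v)}"
  let ?F = "\<lambda>\<tau>. of_bool (fst (ends_val \<tau> a) \<noteq> snd (ends_val \<tau> a)) :: real"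
  let ?G = "\<lambda>\<tau>. of_bool (((a, u) \<in> \<tau>) \<noteq> ((a, v) \<in> \<tau>)) :: real"
  have FA: "?F (\<tau> \<inter> ?A) = ?F \<tau>" for \<tau> by (simp add: ends_val_Int)
  \<comment> \<open>Multiplying the edge bound by this factor requires its sign;
    \<open>deps a\<close> has fewer than \<open>k\<close> elements, so the weights on it are
    nonnegative.\<close>
  have F0: "0 \<le> expect ?A ?F"
  proof (rule expect_nonneg)
    fix T assume T: "T \<subseteq> ?A"
    have "?A \<subseteq> vert_deps (gvert a u)" by auto
    also have "\<dots> \<subseteq> UNIV \<times> {..<n}"
      using set_deps_subset[of "{gvert a u}" k] gvert_in_gverts[OF a uv(3)] by (simp add: set_deps_def)
    finally have "?A \<subseteq> UNIV \<times> {..<n}" .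
    moreover have "card ?A \<le> R" using card_deps[of a] a k by (simp add: addrs_def)
    ultimately show "0 \<le> \<pi> ?A T" using T by (intro pi_nonneg finite_deps)
  qed simp
  have "sa_sol (gvert a ` h) = sa_sol {gvert a u, gvert a v}" by (simp add: uv)
  also have "\<dots> = expect (?A \<union> ?B) (\<lambda>\<tau>. of_bool (vert_val \<tau> (gvert a u) \<noteq> vert_val \<tau> (gvert a v)))"
    using uv(2) by (intro sa_sol_pair) (auto simp: finite_deps)
  also have "\<dots> = expect (?A \<union> ?B) (\<lambda>\<tau>. ?F \<tau> * ?G \<tau>)"
    by (intro expect_cong) auto
  also have "\<dots> = expect ?A ?F * expect ?B ?G"
  proof (rule expect_mult)
    show "?A \<inter> ?B = {}" using deps_shorter[of _ a] by fastforce
    show "\<pi> (?A \<union> ?B) (T \<union> T') = \<pi> ?A T * \<pi> ?B T'" if "T \<subseteq> ?A" "T' \<subseteq> ?B" for T T'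
    proof (rule pi_mult[OF finite_deps _ _ that])
      show "fst x \<noteq> fst y" if "x \<in> ?A" "y \<in> ?B" for x y using deps_shorter[OF that(1)] that(2) by auto
    qed simp
    show "?F (T \<inter> ?A) = ?F T" for T by (rule FA)
    show "?G (T \<inter> ?B) = ?G T" for T by simp
  qed
  also have "expect ?B ?G = \<pi> ?B {(a, u)} + \<pi> ?B {(a, v)}"
  proof -
    have P: "Pow ?B = {{}, {(a, u)}, {(a, v)}, {(a, u), (a, v)}}" by (auto simp: Pow_insert)
    show ?thesis unfolding expect_def P using uv(2) by (simp add: doubleton_eq_iff)
  qed
  finally have "sa_sol (gvert a ` h) = expect ?A ?F * (\<pi> ?B {(a, u)} + \<pi> ?B {(a, v)})" .
  moreover have "expect ?A ?F * (1 - \<eta>) \<le> expect ?A ?F * (\<pi> ?B {(a, u)} + \<pi> ?B {(a, v)})"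
    using pi_edge[of u v a] h uv F0 by (intro mult_left_mono) auto
  moreover have "expect U ?F = expect ?A ?F" by (rule expect_mono[OF U]) (rule FA)
  ultimately show ?thesis by (simp add: vert_val_src vert_val_snk mult.commute)
qed

lemma sa_sol_demand:
  assumes "k \<le> R"
  shows "k * (1 - \<eta>) \<le> (\<Sum>e\<in>ED k. dem k e * sa_sol e)"
proof -
  let ?U = "set_deps (gverts n k)"
  have fU: "finite ?U" by (rule finite_set_deps[OF finite_gverts])
  let ?C = "\<lambda>a. expect ?U (\<lambda>\<tau>. of_bool (vert_val \<tau> (src a) \<noteq> vert_val \<tau> (snk a)))"
  have "k * (1 - \<eta>) = (\<Sum>j<k. (\<Sum>a\<in>addrs n j. weight p a * ?C a) * (1 - \<eta>))"
    unfolding expect_level_cut[OF fU] by simp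
  also have "\<dots> = (\<Sum>j<k. \<Sum>a\<in>addrs n j. \<Sum>h\<in>EH. (weight p a * w h) * ((1 - \<eta>) * ?C a))"
  proof (intro sum.cong refl)
    fix j
    have "(\<Sum>h\<in>EH. (weight p a * w h) * ((1 - \<eta>) * ?C a)) = weight p a * ?C a * (1 - \<eta>)" for a
    proof -
      have "(\<Sum>h\<in>EH. (weight p a * w h) * ((1 - \<eta>) * ?C a)) = (\<Sum>h\<in>EH. w h) * (weight p a * ((1 - \<eta>) * ?C a))"
        unfolding sum_distrib_right by (intro sum.cong refl) (simp only: mult_ac)
      then show ?thesis by (simp add: w1)
    qed
    then show "(\<Sum>a\<in>addrs n j. weight p a * ?C a) * (1 - \<eta>) = (\<Sum>a\<in>addrs n j. \<Sum>h\<in>EH. (weight p a * w h) * ((1 - \<eta>) * ?C a))"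
      by (simp only: sum_distrib_right)
  qed
  also have "\<dots> \<le> (\<Sum>j<k. \<Sum>a\<in>addrs n j. \<Sum>h\<in>EH. (weight p a * w h) * sa_sol (gvert a ` h))"
  proof (intro sum_mono mult_left_mono)
    fix j a h assume j: "j \<in> {..<k}" and a: "a \<in> addrs n j" and h: "h \<in> EH"
    have "deps a \<subseteq> ?U"
    proof -
      have "deps a \<subseteq> vert_deps (gvert a 0)" by auto
      also have "\<dots> \<subseteq> ?U" unfolding set_deps_def using gvert_in_gverts[OF a, of k 0] j n by (intro UN_upper) auto
      finally show ?thesis .
    qed
    then show "(1 - \<eta>) * ?C a \<le> sa_sol (gvert a ` h)"
      using j by (intro sa_sol_demand_edge[OF h a _ assms fU]) auto
    show "0 \<le> weight p a * w h"
      using weight_pos[OF a] p_pos w[OF h] by (intro mult_nonneg_nonneg less_imp_le) auto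
  qed
  also have "\<dots> = (\<Sum>e\<in>ED k. dem k e * sa_sol e)"
    unfolding dem_def weighted_image_sum[OF finite_dem_index] sum_dem_index by (simp add: dem_edge_def)
  finally show ?thesis .
qed

theorem integrality_gap_ge:
  assumes k: "0 < k" and r: "3 \<le> r" "k * r \<le> R" and \<eta>1: "\<eta> < 1"
  shows "k * (1 - \<eta>) / (2 + k * (1 / 2 + \<eta>)) \<le> integrality_gap (gverts n k) (EG k) (cap k) (ED k) (dem k) r"
proof -
  have "k * 1 \<le> k * r" using r by (intro mult_le_mono2) simp
  then have kR: "k \<le> R" using r(2) by linarith
  have d: "0 < k * (1 - \<eta>)" using k \<eta>1 by simp
  have dem: "k * (1 - \<eta>) \<le> (\<Sum>e\<in>ED k. dem k e * sa_sol e)" by (rule sa_sol_demand[OF kR])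
  then have dem0: "0 < (\<Sum>e\<in>ED k. dem k e * sa_sol e)" using d by linarith
  have conn: "connected_graph (gverts n k) (EG k)" by (rule connected_gverts) (use n in simp)
  note bounds = sa_value_bounds[OF instance_ok[OF k] conn r(1) sa_sol_feasible[OF r(2)] dem0]
  let ?v = "sa_value (gverts n k) (EG k) (cap k) (ED k) (dem k) r"
  have "?v \<le> 1 / (\<Sum>e\<in>ED k. dem k e * sa_sol e)" using bounds(2) unfolding sa_sol_cost .
  also have "\<dots> \<le> 1 / (k * (1 - \<eta>))" using dem d dem0 by (intro divide_left_mono) auto
  finally have v: "?v \<le> 1 / (k * (1 - \<eta>))" .
  let ?l = "1 / (2 + k * (1 / 2 + \<eta>))"
  have l0: "0 < ?l" using \<eta> by (intro divide_pos_pos add_pos_nonneg) auto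
  have "k * (1 - \<eta>) * ?v \<le> 1" using v d by (simp add: pos_le_divide_eq mult.commute)
  then have "(k * (1 - \<eta>) * ?v) * ?l \<le> 1 * ?l" using l0 by (intro mult_right_mono) auto
  moreover have "(k * (1 - \<eta>) * ?v) * ?l = k * (1 - \<eta>) * ?l * ?v" by (simp only: mult_ac)
  ultimately have "k * (1 - \<eta>) * ?l * ?v \<le> ?l" by linarith
  also have "\<dots> \<le> min_sparsity (gverts n k) (EG k) (cap k) (ED k) (dem k)" by (rule min_sparsity_ge[OF k])
  finally have "k * (1 - \<eta>) * ?l \<le> min_sparsity (gverts n k) (EG k) (cap k) (ED k) (dem k) / ?v"
    using bounds(1) by (simp only: pos_le_divide_eq)
  then show ?thesis unfolding integrality_gap_def by simp
qed

end

section \<open>Parameters\<close>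

text \<open>The covariance of independent copies of one vector, indexed by the first
  component.\<close>

definition block_kernel :: "('b \<Rightarrow> 'b \<Rightarrow> real) \<Rightarrow> 'a \<times> 'b \<Rightarrow> 'a \<times> 'b \<Rightarrow> real" where
  "block_kernel \<kappa> x y = (if fst x = fst y then \<kappa> (snd x) (snd y) else 0)"

lemma quad_block_kernel:
  assumes "finite U"
  shows "quad (block_kernel \<kappa>) U z = (\<Sum>b\<in>fst ` U. quad \<kappa> {v. (b, v) \<in> U} (\<lambda>v. z (b, v)))"
proof -
  let ?B = "\<lambda>b. {v. (b, v) \<in> U}"
  have fB: "finite (?B b)" for b
    by (rule finite_subset[of _ "snd ` U"]) (use assms in force)+
  have U: "U = Sigma (fst ` U) ?B" by force
  have S: "(\<Sum>x\<in>U. F x) = (\<Sum>b\<in>fst ` U. \<Sum>v\<in>?B b. F (b, v))" for F :: "'a \<times> 'b \<Rightarrow> real"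
    using sum.Sigma[of "fst ` U" ?B "\<lambda>b v. F (b, v)"] assms fB U by simp
  have "(\<Sum>y\<in>U. block_kernel \<kappa> (b, v) y * z (b, v) * z y) = (\<Sum>v'\<in>?B b. \<kappa> v v' * z (b, v) * z (b, v'))"
    if b: "b \<in> fst ` U" for b v
  proof -
    have "(\<Sum>y\<in>U. block_kernel \<kappa> (b, v) y * z (b, v) * z y) =
        (\<Sum>b'\<in>fst ` U. if b' = b then (\<Sum>v'\<in>?B b. \<kappa> v v' * z (b, v) * z (b, v')) else 0)"
      unfolding S by (intro sum.cong refl) (auto simp: block_kernel_def)
    also have "\<dots> = (\<Sum>v'\<in>?B b. \<kappa> v v' * z (b, v) * z (b, v'))"
      using assms b by (subst sum.delta) auto
    finally show ?thesis .
  qed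
  then show ?thesis unfolding quad_def S by simp
qed

lemma gap_instance_pseudo_prob:
  fixes E :: "nat set set" and a \<theta> \<eta> :: real
  assumes base: "base_graph n E w \<eta>" and sine: "sine_rounding s D"
    and cyc: "\<And>c. is_cycle E c \<Longrightarrow> g < length c"
    and \<theta>: "0 < \<theta>" "\<theta> < 1" and L: "1 \<le> L" "2 * Suc L \<le> g"
    and small: "(1 + real (R\<^sup>2 * Suc L)) ^ 3 * \<theta> ^ L \<le> (1 - \<theta>\<^sup>2) * (1 - \<theta>)"
    and edge: "1 - \<eta> \<le> (1 + (\<Sum>k\<in>{-D..D}. (s k)\<^sup>2) * exp (- (a\<^sup>2 * (real_of_int D)\<^sup>2 * (1 - \<theta>\<^sup>2)))
       - (\<Sum>k\<in>{-D..D}. \<bar>s k\<bar>)\<^sup>2 * exp (- (a\<^sup>2 / 2))) / 2"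
  shows "\<exists>\<pi>. gap_instance n E w \<eta> \<pi> R"
proof -
  interpret base_graph n E w \<eta> by (rule base)
  interpret sine_rounding s D by (rule sine)
  let ?r = "\<lambda>u v. {u, v} \<in> E"
  have irr: "{x} \<notin> E" for x using simple by (auto simp: simple_graph_def)
  interpret H: high_girth_graph ?r "{..<n}" g
  proof
    show "\<not> {x, x} \<in> E" for x using irr by simp
    show False if "set c \<subseteq> {..<n}" "distinct c" "3 \<le> length c" "length c \<le> g"
      "\<And>i. i < length c \<Longrightarrow> {c ! i, c ! (Suc i mod length c)} \<in> E" for c
      using cyc[of c] that by (auto simp: is_cycle_def)
  qed (auto simp: insert_commute)
  define M where "M = finite_graph.nb_kernel ?r {..<n} (- \<theta>) L"
  \<comment> \<open>Averaging with the transpose makes symmetry evident. The identity has weight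
    \<open>1 - \<theta>\<close>, enough to absorb the kernel's defect \<open>1 - \<theta>\<close>
    scaled by \<open>\<theta>\<close>; variances become \<open>a\<^sup>2\<close> and edge
    covariances \<open>- (a\<^sup>2 * \<theta>\<^sup>2)\<close>.\<close>
  define \<kappa> where "\<kappa> u v = a\<^sup>2 * (\<theta> * ((M u v + M v u) / 2) + (1 - \<theta>) * of_bool (u = v))" for u v
  define K where "K = (block_kernel \<kappa> :: addr \<times> nat \<Rightarrow> addr \<times> nat \<Rightarrow> real)"
  have \<kappa>_sym: "\<kappa> u v = \<kappa> v u" for u v by (auto simp: \<kappa>_def add.commute)
  have K_sym: "K x y = K y x" for x y by (auto simp: K_def block_kernel_def \<kappa>_sym)
  have \<kappa>_psd: "0 \<le> quad \<kappa> S f" if S: "S \<subseteq> {..<n}" "card S \<le> R" for S f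
  proof -
    have fS: "finite S" using S(1) by (rule finite_subset) simp
    have M0: "- (1 - \<theta>) * (\<Sum>u\<in>S. (f u)\<^sup>2) \<le> (\<Sum>u\<in>S. \<Sum>v\<in>S. M u v * f u * f v)"
      unfolding M_def using \<theta> L S small by (intro H.local_kernel_psd[where R = R]) auto
    have sw: "(\<Sum>u\<in>S. \<Sum>v\<in>S. M v u * f u * f v) = (\<Sum>u\<in>S. \<Sum>v\<in>S. M u v * f u * f v)"
      by (subst sum.swap) (simp add: mult_ac)
    have diag: "(\<Sum>u\<in>S. \<Sum>v\<in>S. of_bool (u = v) * f u * f v) = (\<Sum>u\<in>S. (f u)\<^sup>2)"
    proof (intro sum.cong refl)
      fix u assume u: "u \<in> S"
      have "(\<Sum>v\<in>S. of_bool (u = v) * f u * f v) = (\<Sum>v\<in>S. if v = u then (f u)\<^sup>2 else 0)"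
        by (intro sum.cong) (auto simp: power2_eq_square)
      then show "(\<Sum>v\<in>S. of_bool (u = v) * f u * f v) = (f u)\<^sup>2" using fS u by simp
    qed
    let ?Q = "\<Sum>u\<in>S. \<Sum>v\<in>S. M u v * f u * f v" and ?N = "\<Sum>u\<in>S. (f u)\<^sup>2"
    have "quad \<kappa> S f = (\<Sum>u\<in>S. \<Sum>v\<in>S. a\<^sup>2 * (\<theta> / 2) * (M u v * f u * f v) + a\<^sup>2 * (\<theta> / 2) * (M v u * f u * f v)
        + a\<^sup>2 * (1 - \<theta>) * (of_bool (u = v) * f u * f v))"
      unfolding quad_def \<kappa>_def by (intro sum.cong refl) (simp add: field_simps)
    also have "\<dots> = a\<^sup>2 * (\<theta> / 2) * ?Q + a\<^sup>2 * (\<theta> / 2) * ?Q + a\<^sup>2 * (1 - \<theta>) * ?N"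
      unfolding sum.distrib sum_distrib_left[symmetric] sw diag ..
    also have "\<dots> = a\<^sup>2 * (\<theta> * ?Q + (1 - \<theta>) * ?N)" by (simp add: field_simps)
    also have "\<dots> \<ge> 0"
    proof (rule mult_nonneg_nonneg[OF zero_le_power2])
      have "\<theta> * (- (1 - \<theta>) * ?N) \<le> \<theta> * ?Q" using M0 \<theta> by (intro mult_left_mono) auto
      moreover have "0 \<le> (1 - \<theta>) * (1 - \<theta>) * ?N" by (intro mult_nonneg_nonneg sum_nonneg) (use \<theta> in auto)
      ultimately show "0 \<le> \<theta> * ?Q + (1 - \<theta>) * ?N" by (simp add: algebra_simps)
    qed
    finally show ?thesis .
  qed
  have K_psd: "0 \<le> quad K U z" if U: "finite U" "U \<subseteq> UNIV \<times> {..<n}" "card U \<le> R" for U z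
    unfolding K_def quad_block_kernel[OF U(1)]
  proof (intro sum_nonneg \<kappa>_psd)
    fix b
    show "{v. (b, v) \<in> U} \<subseteq> {..<n}" using U(2) by auto
    have "{v. (b, v) \<in> U} \<subseteq> snd ` U" by force
    then have "card {v. (b, v) \<in> U} \<le> card (snd ` U)" using U(1) by (intro card_mono) auto
    also have "\<dots> \<le> card U" using U(1) by (rule card_image_le)
    finally show "card {v. (b, v) \<in> U} \<le> R" using U(3) by simp
  qed
  have "gap_instance n E w \<eta> (pseudo_prob s D K) R"
  proof
    show "pseudo_prob s D K {} {} = 1" by (rule pseudo_prob_empty)
    show "pseudo_prob s D K (insert u U) T + pseudo_prob s D K (insert u U) (insert u T) = pseudo_prob s D K U T"
      if "finite U" "u \<notin> U" "T \<subseteq> U" for U u T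
      by (rule pseudo_prob_marginal[OF that K_sym])
    show "0 \<le> pseudo_prob s D K U T" if "finite U" "U \<subseteq> UNIV \<times> {..<n}" "card U \<le> R" "T \<subseteq> U" for U T
      by (rule pseudo_prob_nonneg[OF that(1) K_sym K_psd[OF that(1-3)]])
    show "pseudo_prob s D K (U \<union> U') (T \<union> T') = pseudo_prob s D K U T * pseudo_prob s D K U' T'"
      if "finite U" "finite U'" "\<And>x y. x \<in> U \<Longrightarrow> y \<in> U' \<Longrightarrow> fst x \<noteq> fst y" "T \<subseteq> U" "T' \<subseteq> U'" for U U' T T'
    proof (rule pseudo_prob_mult[OF that(1,2) _ that(4,5)])
      show "U \<inter> U' = {}" using that(3) by blast
      show "K u v = 0" "K v u = 0" if "u \<in> U" "v \<in> U'" for u v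
        using \<open>\<And>x y. x \<in> U \<Longrightarrow> y \<in> U' \<Longrightarrow> fst x \<noteq> fst y\<close>[OF that] by (auto simp: K_def block_kernel_def)
    qed
    show "1 - \<eta> \<le> pseudo_prob s D K {(b, u), (b, v)} {(b, u)} + pseudo_prob s D K {(b, u), (b, v)} {(b, v)}"
      if uv: "{u, v} \<in> E" "u \<noteq> v" for b u v
    proof -
      have V: "u < n" "v < n" using uv simple by (auto simp: simple_graph_def)
      have vu: "{v, u} \<in> E" using uv by (simp add: insert_commute)
      have d: "M x x = 1" if "x < n" for x unfolding M_def using L that by (intro H.kernel_diag) auto
      have e: "M u v = - \<theta>" "M v u = - \<theta>" unfolding M_def using L V uv vu by (intro H.kernel_edge; simp)+
      have "\<kappa> x x = a\<^sup>2" if "x < n" for x using d[OF that] by (simp add: \<kappa>_def)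
      then have Kd: "K (b, u) (b, u) = a\<^sup>2" "K (b, v) (b, v) = a\<^sup>2" using V by (auto simp: K_def block_kernel_def)
      have Ke: "K (b, u) (b, v) = - (a\<^sup>2 * \<theta>\<^sup>2)"
        using uv(2) by (simp add: K_def block_kernel_def \<kappa>_def e power2_eq_square)
      have "\<theta>\<^sup>2 \<le> 1" using \<theta> by (simp add: power_le_one)
      with pseudo_prob_cut_ge[of "(b, u)" "(b, v)" K a "\<theta>\<^sup>2", OF _ Kd Ke K_sym] uv(2) edge
      show ?thesis by auto
    qed
  qed
  then show ?thesis by blast
qed

text \<open>After clearing the denominator, \<open>5 / 16 * (k * \<epsilon>)\<close> has to outweigh
  4, and \<open>k * \<epsilon>\<close> is at least 16.\<close>

lemma gap_ratio_ge:
  fixes \<epsilon> :: real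
  assumes \<epsilon>: "0 < \<epsilon>" "\<epsilon> \<le> 1" and k: "16 / \<epsilon> \<le> real k"
  shows "2 - \<epsilon> \<le> real k * (1 - \<epsilon> / 16) / (2 + real k * (1 / 2 + \<epsilon> / 16))"
proof -
  have k0: "16 \<le> real k * \<epsilon>" using k \<epsilon> by (simp add: divide_le_eq)
  have ke: "0 \<le> real k * (\<epsilon> * \<epsilon>)" by simp
  have pos: "0 < 2 + real k * (1 / 2 + \<epsilon> / 16)" using \<epsilon> by (intro add_pos_nonneg) auto
  have "real k * (1 - \<epsilon> / 16) - (2 - \<epsilon>) * (2 + real k * (1 / 2 + \<epsilon> / 16)) =
      5 / 16 * (real k * \<epsilon>) + 1 / 16 * (real k * (\<epsilon> * \<epsilon>)) + 2 * \<epsilon> - 4"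
    by (simp add: field_simps)
  then have "(2 - \<epsilon>) * (2 + real k * (1 / 2 + \<epsilon> / 16)) \<le> real k * (1 - \<epsilon> / 16)"
    using k0 ke \<epsilon> by linarith
  then show ?thesis using pos by (simp add: pos_le_divide_eq)
qed

text \<open>The order of choices matters: the polynomial fixes \<open>D\<close> and the sum of the
  absolute values of \<open>s\<close>, then \<open>a\<close> is taken large enough to damp the mixed
  frequencies, and only then \<open>\<theta>\<close> close enough to 1 for \<open>a\<close> and
  \<open>D\<close>.\<close>

lemma rounding_parameters:
  fixes \<eta> :: real
  assumes \<eta>: "0 < \<eta>" "\<eta> \<le> 1"
  shows "\<exists>s D (a::real) \<theta>. sine_rounding s D \<and> 0 < \<theta> \<and> \<theta> < 1 \<and>
    1 - \<eta> \<le> (1 + (\<Sum>k\<in>{-D..D}. (s k)\<^sup>2) * exp (- (a\<^sup>2 * (real_of_int D)\<^sup>2 * (1 - \<theta>\<^sup>2))) - (\<Sum>k\<in>{-D..D}. \<bar>s k\<bar>)\<^sup>2 * exp (- (a\<^sup>2 / 2))) / 2"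
proof -
  obtain D s where D: "0 \<le> D" and odd: "\<And>k. s (- k) = - s k"
    and bound: "\<And>x. \<bar>\<Sum>k\<in>{-D..D}. s k * sin (real_of_int k * x)\<bar> \<le> 1" and sq: "(\<Sum>k\<in>{-D..D}. (s k)\<^sup>2) \<ge> 1 - \<eta> / 2"
    using sine_poly_exists[of "\<eta> / 2"] \<eta> by auto
  have sine: "sine_rounding s D" using D odd bound by unfold_locales
  define B where "B = (\<Sum>k\<in>{-D..D}. \<bar>s k\<bar>)\<^sup>2"
  have "((\<lambda>a::real. B * exp (- (a\<^sup>2 / 2))) \<longlongrightarrow> 0) at_top" by real_asymp
  then have "eventually (\<lambda>a::real. B * exp (- (a\<^sup>2 / 2)) < \<eta>) at_top"
    using \<eta>(1) by (rule order_tendstoD)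
  then obtain a :: real where a: "B * exp (- (a\<^sup>2 / 2)) < \<eta>"
    using eventually_happens'[OF trivial_limit_at_top_linorder] by blast
  define m where "m = a\<^sup>2 * (real_of_int D)\<^sup>2"
  have m: "0 \<le> m" by (simp add: m_def)
  define \<nu> where "\<nu> = min (1 / 2) (\<eta> / (2 * (m + 1)))"
  have \<nu>: "0 < \<nu>" "\<nu> \<le> 1 / 2" using \<eta> m by (auto simp: \<nu>_def)
  have "\<nu> * (m + 1) \<le> \<eta> / (2 * (m + 1)) * (m + 1)"
    using m by (intro mult_right_mono) (auto simp: \<nu>_def)
  also have "\<dots> = \<eta> / 2" using m by (simp add: field_simps)
  finally have m\<nu>: "m * \<nu> \<le> \<eta> / 2" using \<nu> by (simp add: algebra_simps)
  define \<theta> where "\<theta> = sqrt (1 - \<nu>)"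
  have \<theta>: "0 < \<theta>" "\<theta> < 1" "1 - \<theta>\<^sup>2 = \<nu>" using \<nu> by (auto simp: \<theta>_def)
  have "1 - \<eta> / 2 \<le> 1 + - (m * \<nu>)" using m\<nu> by simp
  also have "\<dots> \<le> exp (- (m * \<nu>))" by (rule exp_ge_add_one_self)
  finally have e: "1 - \<eta> / 2 \<le> exp (- (m * \<nu>))" .
  have "(1 - \<eta> / 2) * (1 - \<eta> / 2) \<le> (\<Sum>k\<in>{-D..D}. (s k)\<^sup>2) * exp (- (m * \<nu>))"
    using sq e \<eta> by (intro mult_mono) (auto intro: sum_nonneg)
  moreover have "1 - \<eta> \<le> (1 - \<eta> / 2) * (1 - \<eta> / 2)" by (simp add: algebra_simps)
  ultimately have "1 - \<eta> \<le> (1 + (\<Sum>k\<in>{-D..D}. (s k)\<^sup>2) * exp (- (m * \<nu>)) - B * exp (- (a\<^sup>2 / 2))) / 2"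
    using a by simp
  then have "1 - \<eta> \<le> (1 + (\<Sum>k\<in>{-D..D}. (s k)\<^sup>2) * exp (- (a\<^sup>2 * (real_of_int D)\<^sup>2 * (1 - \<theta>\<^sup>2))) - (\<Sum>k\<in>{-D..D}. \<bar>s k\<bar>)\<^sup>2 * exp (- (a\<^sup>2 / 2))) / 2"
    unfolding \<theta>(3) m_def B_def .
  then show ?thesis using sine \<theta>(1,2) by blast
qed

text \<open>Take \<open>L\<close> about \<open>c / 4 * ln n\<close>, so that
  \<open>\<theta> ^ L\<close> is about \<open>n\<close> to the power \<open>- \<beta>\<close>, and
  \<open>R\<close> about \<open>X\<close>, the power \<open>\<beta> / 12\<close>. The left side of
  the smallness condition is then \<open>X ^ 6\<close> times logarithms against
  \<open>X ^ 12\<close>. The bound covers all \<open>N\<close> in a range because the rounds are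
  measured by the size of the whole instance, not of \<open>H\<close>.\<close>

lemma walk_length_parameters:
  fixes c \<theta> :: real
  assumes c: "0 < c" and \<theta>: "0 < \<theta>" "\<theta> < 1" and k: "0 < k"
  shows "\<exists>\<delta>>0. \<forall>\<^sub>F n in sequentially. \<exists>L R. 1 \<le> L \<and> real (2 * Suc L) \<le> c * ln (real n) \<and>
    (1 + real (R\<^sup>2 * Suc L)) ^ 3 * \<theta> ^ L \<le> (1 - \<theta>\<^sup>2) * (1 - \<theta>) \<and>
    (\<forall>N\<ge>n. N \<le> (2 * n + 2) ^ Suc k \<longrightarrow> 3 \<le> nat \<lfloor>real N powr \<delta>\<rfloor> \<and> k * nat \<lfloor>real N powr \<delta>\<rfloor> \<le> R)"
proof -
  define \<beta> where "\<beta> = c / 4 * - ln \<theta>"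
  have \<beta>: "0 < \<beta>" using c \<theta> by (simp add: \<beta>_def mult_pos_neg)
  \<comment> \<open>This rewrites \<open>c / 4 * ln n\<close> as \<open>C * ln X\<close>, so that
    the estimate involves the single variable \<open>X\<close>.\<close>
  define C where "C = 3 * c / \<beta>"
  have C: "0 < C" using c \<beta> by (simp add: C_def)
  define \<gamma> where "\<gamma> = (1 - \<theta>\<^sup>2) * (1 - \<theta>)"
  have \<gamma>: "0 < \<gamma>" using \<theta> by (simp add: \<gamma>_def power_less_one_iff)
  \<comment> \<open>The instance has at most \<open>n ^ (3 * Suc k)\<close> vertices; the resulting
    exponent \<open>\<beta> / 24\<close> leaves room for the factor \<open>k\<close> and the
    rounding down of \<open>R\<close>.\<close>
  define \<delta> where "\<delta> = \<beta> / 12 / (6 * real (Suc k))"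
  have \<delta>: "0 < \<delta>" using \<beta> by (simp add: \<delta>_def)
  have "((\<lambda>x::real. (1 + x * x * (C * ln x + 1)) ^ 3 / (\<theta> * x ^ 12)) \<longlongrightarrow> 0) at_top"
    using \<theta>(1) C by real_asymp
  then have ev1: "\<forall>\<^sub>F x in at_top. (1 + x * x * (C * ln x + 1)) ^ 3 / (\<theta> * x ^ 12) < \<gamma>"
    using \<gamma> by (rule order_tendstoD)
  have lim: "filterlim (\<lambda>n::nat. real n powr (\<beta> / 12)) at_top sequentially"
    using \<beta> by real_asymp
  have E1: "\<forall>\<^sub>F n in sequentially. (1 + real n powr (\<beta> / 12) * real n powr (\<beta> / 12) *
      (C * ln (real n powr (\<beta> / 12)) + 1)) ^ 3 / (\<theta> * (real n powr (\<beta> / 12)) ^ 12) < \<gamma>"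
    using filterlim_iff[THEN iffD1, OF lim, rule_format, OF ev1] .
  have E2: "\<forall>\<^sub>F n::nat in sequentially. 8 \<le> c * ln (real n)" using c by real_asymp
  have E3: "\<forall>\<^sub>F n::nat in sequentially. 3 \<le> real n powr \<delta>" using \<delta> by real_asymp
  have E4: "\<forall>\<^sub>F n::nat in sequentially. real k * real n powr (\<beta> / 24) \<le> real n powr (\<beta> / 12) - 1" using \<beta> by real_asymp
  have "\<forall>\<^sub>F n in sequentially. \<exists>L R. 1 \<le> L \<and> real (2 * Suc L) \<le> c * ln (real n) \<and>
    (1 + real (R\<^sup>2 * Suc L)) ^ 3 * \<theta> ^ L \<le> (1 - \<theta>\<^sup>2) * (1 - \<theta>) \<and>
    (\<forall>N\<ge>n. N \<le> (2 * n + 2) ^ Suc k \<longrightarrow> 3 \<le> nat \<lfloor>real N powr \<delta>\<rfloor> \<and> k * nat \<lfloor>real N powr \<delta>\<rfloor> \<le> R)"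
    using E1 E2 E3 E4 eventually_ge_at_top[of "2::nat"]
  proof eventually_elim
    case (elim n)
    define X where "X = real n powr (\<beta> / 12)"
    define L where "L = nat \<lfloor>c / 4 * ln (real n)\<rfloor>"
    define R where "R = nat \<lfloor>X\<rfloor>"
    have n0: "0 < real n" using elim(5) by simp
    have cl: "2 \<le> c / 4 * ln (real n)" using elim(2) by simp
    have L: "c / 4 * ln (real n) - 1 \<le> real L" "real L \<le> c / 4 * ln (real n)" "1 \<le> L"
      using cl unfolding L_def by linarith+
    have X0: "0 < X" using n0 by (simp add: X_def)
    have R: "real R \<le> X" "X - 1 \<le> real R" using X0 unfolding R_def by linarith+
    have lnX: "ln X = \<beta> / 12 * ln (real n)" using n0 by (simp add: X_def ln_powr)
    have X12: "X ^ 12 = exp (\<beta> * ln (real n))"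
      using n0 by (simp add: X_def powr_def exp_of_nat_mult[symmetric])
    have "\<theta> ^ L = exp (real L * ln \<theta>)" using \<theta> by (simp add: exp_of_nat_mult)
    also have "\<dots> \<le> exp ((c / 4 * ln (real n) - 1) * ln \<theta>)"
      using L(1) \<theta> by (simp add: mult_right_mono_neg)
    also have "(c / 4 * ln (real n) - 1) * ln \<theta> = - (\<beta> * ln (real n)) - ln \<theta>"
      by (simp add: \<beta>_def algebra_simps)
    also have "exp \<dots> = 1 / (\<theta> * X ^ 12)"
      using \<theta> unfolding X12 by (simp add: exp_diff exp_minus field_simps)
    finally have \<theta>L: "\<theta> ^ L \<le> 1 / (\<theta> * X ^ 12)" .
    have "real (R\<^sup>2 * Suc L) = real R * real R * (real L + 1)" by (simp add: power2_eq_square algebra_simps)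
    also have "\<dots> \<le> X * X * (c / 4 * ln (real n) + 1)"
      using R(1) L(2) X0 by (intro mult_mono) auto
    also have "c / 4 * ln (real n) = C * ln X"
      using \<beta> by (simp add: lnX C_def)
    finally have up: "real (R\<^sup>2 * Suc L) \<le> X * X * (C * ln X + 1)" .
    have up0: "0 \<le> X * X * (C * ln X + 1)" by (rule order_trans[OF of_nat_0_le_iff up])
    have "(1 + real (R\<^sup>2 * Suc L)) ^ 3 * \<theta> ^ L \<le> (1 + X * X * (C * ln X + 1)) ^ 3 * (1 / (\<theta> * X ^ 12))"
    proof (rule mult_mono[OF power_mono \<theta>L])
      show "1 + real (R\<^sup>2 * Suc L) \<le> 1 + X * X * (C * ln X + 1)" using up by (rule add_left_mono)
      show "0 \<le> (1 + X * X * (C * ln X + 1)) ^ 3" using up0 by (intro zero_le_power add_nonneg_nonneg) auto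
    qed (use \<theta> in simp_all)
    also have "\<dots> \<le> \<gamma>" using elim(1) unfolding X_def by simp
    finally have small: "(1 + real (R\<^sup>2 * Suc L)) ^ 3 * \<theta> ^ L \<le> (1 - \<theta>\<^sup>2) * (1 - \<theta>)" unfolding \<gamma>_def .
    have "3 \<le> nat \<lfloor>real N powr \<delta>\<rfloor> \<and> k * nat \<lfloor>real N powr \<delta>\<rfloor> \<le> R" if N: "n \<le> N" "N \<le> (2 * n + 2) ^ Suc k" for N
    proof
      have "real n powr \<delta> \<le> real N powr \<delta>" using N(1) \<delta> by (intro powr_mono2) auto
      then have "3 \<le> real N powr \<delta>" using elim(3) by linarith
      then show "3 \<le> nat \<lfloor>real N powr \<delta>\<rfloor>" by linarith
      have "2 * n + 2 \<le> n ^ 3"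
      proof -
        have "2 * 2 \<le> n * n" using elim(5) by (intro mult_le_mono)
        then have "n * 4 \<le> n * (n * n)" by (intro mult_le_mono2) simp
        moreover have "n ^ 3 = n * (n * n)" by (simp add: power3_eq_cube mult.assoc)
        ultimately show ?thesis using elim(5) by linarith
      qed
      then have "(2 * n + 2) ^ Suc k \<le> (n ^ 3) ^ Suc k" by (rule power_mono) simp
      then have "N \<le> n ^ (3 * Suc k)" unfolding power_mult by (rule order_trans[OF N(2)])
      then have "real N \<le> real (n ^ (3 * Suc k))" by (simp only: of_nat_le_iff)
      then have "real N \<le> real n ^ (3 * Suc k)" by (simp only: of_nat_power)
      also have "\<dots> = real n powr (real (3 * Suc k))" using n0 by (simp only: powr_realpow)
      finally have "real N powr \<delta> \<le> (real n powr (real (3 * Suc k))) powr \<delta>"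
        using \<delta> by (intro powr_mono2) auto
      also have "\<dots> = real n powr (\<beta> / 24)"
        unfolding powr_powr by (rule arg_cong[where f = "\<lambda>t. real n powr t"]) (simp add: \<delta>_def field_simps)
      finally have "real k * real N powr \<delta> \<le> real k * real n powr (\<beta> / 24)" by (intro mult_left_mono) auto
      also have "\<dots> \<le> X - 1" using elim(4) by (simp add: X_def)
      finally have le: "real k * real N powr \<delta> \<le> real R" using R(2) by linarith
      have "real (nat \<lfloor>real N powr \<delta>\<rfloor>) \<le> real N powr \<delta>" by (simp add: of_nat_nat)
      then have "real k * real (nat \<lfloor>real N powr \<delta>\<rfloor>) \<le> real k * real N powr \<delta>" by (intro mult_left_mono) auto
      then have "real (k * nat \<lfloor>real N powr \<delta>\<rfloor>) \<le> real R" using le by simp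
      then show "k * nat \<lfloor>real N powr \<delta>\<rfloor> \<le> R" by (simp only: of_nat_le_iff)
    qed
    moreover have "real (2 * Suc L) \<le> c * ln (real n)" using L(2) elim(2) by simp
    ultimately show ?case using L(3) small by blast
  qed
  then show ?thesis using \<delta> by blast
qed

theorem theorem1p2:
  fixes \<epsilon> :: real
  assumes "\<epsilon> > 0"
  shows "\<exists>\<delta>>0. \<forall>N. \<exists>n\<ge>N. \<exists>(V :: nat set) EG cap ED dem.
           sparsest_cut_instance V EG cap ED dem \<and> card V = n \<and> treewidth V EG = 2 \<and>
           integrality_gap V EG cap ED dem (nat \<lfloor>real n powr \<delta>\<rfloor>) \<ge> 2 - \<epsilon>"
proof -
  \<comment> \<open>The ratio estimate assumes \<open>\<epsilon> \<le> 1\<close>; a smaller value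
    only strengthens the claim.\<close>
  define \<epsilon>' where "\<epsilon>' = min \<epsilon> 1"
  have \<epsilon>': "0 < \<epsilon>'" "\<epsilon>' \<le> 1" "\<epsilon>' \<le> \<epsilon>" using assms by (auto simp: \<epsilon>'_def)
  define \<eta> where "\<eta> = \<epsilon>' / 16"
  have \<eta>01: "0 < \<eta>" "\<eta> < 1" using \<epsilon>' by (auto simp: \<eta>_def)
  define k where "k = nat \<lceil>16 / \<epsilon>'\<rceil>"
  have k16: "16 / \<epsilon>' \<le> real k" unfolding k_def by (rule real_nat_ceiling_ge)
  have "0 < 16 / \<epsilon>'" using \<epsilon>' by simp
  then have k: "0 < k" using k16 by (metis gr0I not_le of_nat_0)
  obtain s D and a \<theta> :: real where sine: "sine_rounding s D" and \<theta>: "0 < \<theta>" "\<theta> < 1"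
    and edge: "1 - \<eta> \<le> (1 + (\<Sum>k\<in>{-D..D}. (s k)\<^sup>2) * exp (- (a\<^sup>2 * (real_of_int D)\<^sup>2 * (1 - \<theta>\<^sup>2))) - (\<Sum>k\<in>{-D..D}. \<bar>s k\<bar>)\<^sup>2 * exp (- (a\<^sup>2 / 2))) / 2"
    using rounding_parameters[of \<eta>] \<eta>01 by auto
  obtain c where c: "0 < c" and graphs: "\<And>N. \<exists>n\<ge>N. \<exists>E w. simple_graph {..<n} E \<and> (\<forall>h\<in>E. 0 < w h) \<and> (\<Sum>h\<in>E. w h) = 1 \<and>
    (\<forall>A. (\<Sum>h\<in>edge_boundary E A. w h) \<le> 1 / 2 + \<eta>) \<and> (\<forall>b. is_cycle E b \<longrightarrow> c * ln (real n) < length b)"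
    using sparse_gap_graph[OF \<eta>01(1)] by blast
  obtain \<delta> N0 where \<delta>: "0 < \<delta>" and params: "\<And>n. N0 \<le> n \<Longrightarrow> \<exists>L R. 1 \<le> L \<and> real (2 * Suc L) \<le> c * ln (real n) \<and>
    (1 + real (R\<^sup>2 * Suc L)) ^ 3 * \<theta> ^ L \<le> (1 - \<theta>\<^sup>2) * (1 - \<theta>) \<and>
    (\<forall>N\<ge>n. N \<le> (2 * n + 2) ^ Suc k \<longrightarrow> 3 \<le> nat \<lfloor>real N powr \<delta>\<rfloor> \<and> k * nat \<lfloor>real N powr \<delta>\<rfloor> \<le> R)"
    using walk_length_parameters[OF c \<theta> k] unfolding eventually_sequentially by blast
  show ?thesis
  proof (intro exI[of _ \<delta>] conjI allI \<delta>)
    fix N :: nat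
    obtain n E w where n: "max (max N N0) 2 \<le> n" and E: "simple_graph {..<n} E" "\<And>h. h \<in> E \<Longrightarrow> 0 < w h" "(\<Sum>h\<in>E. w h) = 1"
      "\<And>A. (\<Sum>h\<in>edge_boundary E A. w h) \<le> 1 / 2 + \<eta>" "\<And>b. is_cycle E b \<Longrightarrow> c * ln (real n) < length b"
      using graphs[of "max (max N N0) 2"] by blast
    have n': "N \<le> n" "N0 \<le> n" "2 \<le> n" using n by auto
    obtain L R where L: "1 \<le> L" "real (2 * Suc L) \<le> c * ln (real n)"
      and small: "(1 + real (R\<^sup>2 * Suc L)) ^ 3 * \<theta> ^ L \<le> (1 - \<theta>\<^sup>2) * (1 - \<theta>)"
      and rounds: "\<And>M. n \<le> M \<Longrightarrow> M \<le> (2 * n + 2) ^ Suc k \<Longrightarrow> 3 \<le> nat \<lfloor>real M powr \<delta>\<rfloor> \<and> k * nat \<lfloor>real M powr \<delta>\<rfloor> \<le> R"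
      using params[OF n'(2)] by blast
    have base: "base_graph n E w \<eta>" using n'(3) E(1-4) \<eta>01(1) by unfold_locales
    have cyc: "2 * Suc L < length b" if "is_cycle E b" for b
    proof -
      have "real (2 * Suc L) < real (length b)" using L(2) E(5)[OF that] by linarith
      then show ?thesis by (simp only: of_nat_less_iff)
    qed
    \<comment> \<open>The girth enters exactly at \<open>2 * Suc L\<close>, the threshold at which
      walks of up to \<open>Suc L\<close> edges are unique.\<close>
    obtain \<pi> where "gap_instance n E w \<eta> \<pi> R"
      using gap_instance_pseudo_prob[OF base sine cyc \<theta> L(1) order_refl small edge] by blast
    then interpret gap_instance n E w \<eta> \<pi> R .
    \<comment> \<open>The \<open>n\<close> of the claim is the vertex count of the whole instance,
      whereas \<open>n\<close> here is the size of \<open>H\<close>.\<close>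
    let ?M = "card (gverts n k)"
    have M: "n \<le> ?M" "?M \<le> (2 * n + 2) ^ Suc k"
      using card_gverts_ge[OF k, of n] card_gverts_le[of n k] n'(3) by auto
    have r: "3 \<le> nat \<lfloor>real ?M powr \<delta>\<rfloor>" "k * nat \<lfloor>real ?M powr \<delta>\<rfloor> \<le> R" using rounds[OF M] by auto
    have "2 - \<epsilon> \<le> 2 - \<epsilon>'" using \<epsilon>' by simp
    also have "\<dots> \<le> real k * (1 - \<eta>) / (2 + real k * (1 / 2 + \<eta>))"
      unfolding \<eta>_def by (rule gap_ratio_ge[OF \<epsilon>'(1,2) k16])
    also have "\<dots> \<le> integrality_gap (gverts n k) (EG k) (cap k) (ED k) (dem k) (nat \<lfloor>real ?M powr \<delta>\<rfloor>)"
      by (rule integrality_gap_ge[OF k r \<eta>01(2)])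
    finally have gap: "2 - \<epsilon> \<le> integrality_gap (gverts n k) (EG k) (cap k) (ED k) (dem k) (nat \<lfloor>real ?M powr \<delta>\<rfloor>)" .
    show "\<exists>n\<ge>N. \<exists>(V :: nat set) EG cap ED dem.
           sparsest_cut_instance V EG cap ED dem \<and> card V = n \<and> treewidth V EG = 2 \<and>
           integrality_gap V EG cap ED dem (nat \<lfloor>real n powr \<delta>\<rfloor>) \<ge> 2 - \<epsilon>"
    proof (intro exI conjI)
      show "N \<le> ?M" using n'(1) M(1) by simp
      show "sparsest_cut_instance (gverts n k) (EG k) (cap k) (ED k) (dem k)" by (rule instance_ok[OF k])
      show "treewidth (gverts n k) (EG k) = 2" by (rule treewidth_supply[OF n'(3) k])
      show "2 - \<epsilon> \<le> integrality_gap (gverts n k) (EG k) (cap k) (ED k) (dem k) (nat \<lfloor>real ?M powr \<delta>\<rfloor>)" by (rule gap)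
    qed (rule refl)
  qed
qed

end
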